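(* Let $\mathfrak A$ be a model-complete $\omega$-categorical structure with finite signature $\tau$ and domain $A$ such that there is an embedding $\mathfrak A^2\hookrightarrow\mathfrak A$. Then there are finitely many elements $a_1,\dots,a_n\in A$ such that $\mathrm{CSP}(\mathfrak A,\neq)$ is polynomial-time equivalent to $\mathrm{CSP}(\mathfrak A,a_1,\dots,a_n)$.
   Context: A structure is $\omega$-categorical if all countably infinite models of its first-order theory are isomorphic. A structure is model-complete if over it every first-order formula is equivalent to an existential formula. An embedding is an isomorphism onto a substructure; $\mathfrak A^2=\mathfrak A\times\mathfrak A$. For a structure $\mathfrak B$ with a finite signature $\sigma$, $\mathrm{CSP}(\mathfrak B)$ is the computational problem of deciding whether a given finite conjunction of atomic $\sigma$-formulas (equalities between terms allowed) is satisfiable in $\mathfrak B$. $(\mathfrak A,\neq)$ is the expansion of $\mathfrak A$ by the disequality relation on $A$, and $(\mathfrak A,a_1,\dots,a_n)$ is the expansion of $\mathfrak A$ by constants for $a_1,\dots,a_n$. Two computational problems are polynomial-time equivalent if there are polynomial-time reductions from each to the other. *)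

theory Defs
  imports Main "HOL-Computational_Algebra.Polynomial"
begin

section \<open>First-order structures over finite signatures\<close>

text \<open>
  A finite signature is given by the lists of arities of its function symbols and of its relation
  symbols; a symbol is an index into the respective list. Constants are function symbols of
  arity 0.
\<close>

record signature =
  fun_ar :: "nat list"
  rel_ar :: "nat list"

record 'a struct =
  univ :: "'a set"
  funs :: "nat \<Rightarrow> 'a list \<Rightarrow> 'a"
  rels :: "nat \<Rightarrow> 'a list set"

definition tuples :: "'a set \<Rightarrow> nat \<Rightarrow> 'a list set" where
  "tuples U n = {xs. length xs = n \<and> set xs \<subseteq> U}"

text \<open>
  The values of \<open>funs\<close> and \<open>rels\<close> at indices outside the signature, and of \<open>funs\<close> at lists that
  are not tuples over the domain, are irrelevant throughout.
\<close>

definition is_structure :: "signature \<Rightarrow> 'a struct \<Rightarrow> bool" where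
  "is_structure \<sigma> A \<longleftrightarrow>
     univ A \<noteq> {} \<and>
     (\<forall>f < length (fun_ar \<sigma>). \<forall>xs \<in> tuples (univ A) (fun_ar \<sigma> ! f). funs A f xs \<in> univ A) \<and>
     (\<forall>r < length (rel_ar \<sigma>). rels A r \<subseteq> tuples (univ A) (rel_ar \<sigma> ! r))"

definition isomorphism :: "signature \<Rightarrow> ('a \<Rightarrow> 'b) \<Rightarrow> 'a struct \<Rightarrow> 'b struct \<Rightarrow> bool" where
  "isomorphism \<sigma> h A B \<longleftrightarrow>
     bij_betw h (univ A) (univ B) \<and>
     (\<forall>f < length (fun_ar \<sigma>). \<forall>xs \<in> tuples (univ A) (fun_ar \<sigma> ! f).
        h (funs A f xs) = funs B f (map h xs)) \<and>
     (\<forall>r < length (rel_ar \<sigma>). \<forall>xs \<in> tuples (univ A) (rel_ar \<sigma> ! r).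
        xs \<in> rels A r \<longleftrightarrow> map h xs \<in> rels B r)"

definition substructure :: "signature \<Rightarrow> 'a struct \<Rightarrow> 'a struct \<Rightarrow> bool" where
  "substructure \<sigma> S B \<longleftrightarrow>
     is_structure \<sigma> S \<and> univ S \<subseteq> univ B \<and>
     (\<forall>f < length (fun_ar \<sigma>). \<forall>xs \<in> tuples (univ S) (fun_ar \<sigma> ! f). funs S f xs = funs B f xs) \<and>
     (\<forall>r < length (rel_ar \<sigma>). rels S r = rels B r \<inter> tuples (univ S) (rel_ar \<sigma> ! r))"

definition embedding :: "signature \<Rightarrow> ('a \<Rightarrow> 'b) \<Rightarrow> 'a struct \<Rightarrow> 'b struct \<Rightarrow> bool" where
  "embedding \<sigma> h A B \<longleftrightarrow> (\<exists>S. substructure \<sigma> S B \<and> isomorphism \<sigma> h A S)"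

definition prod_struct :: "'a struct \<Rightarrow> 'b struct \<Rightarrow> ('a \<times> 'b) struct" where
  "prod_struct A B =
     \<lparr>univ = univ A \<times> univ B,
      funs = (\<lambda>f ps. (funs A f (map fst ps), funs B f (map snd ps))),
      rels = (\<lambda>r. {ps. map fst ps \<in> rels A r \<and> map snd ps \<in> rels B r})\<rparr>"


section \<open>First-order logic\<close>

datatype trm = Var nat | Fn nat "trm list"

datatype atom = Eq trm trm | Rel nat "trm list"

datatype fm = Atom atom | Neg fm | Conj fm fm | Ex nat fm

fun trm_ok :: "signature \<Rightarrow> trm \<Rightarrow> bool" where
  "trm_ok \<sigma> (Var x) \<longleftrightarrow> True"
| "trm_ok \<sigma> (Fn f ts) \<longleftrightarrow>
     f < length (fun_ar \<sigma>) \<and> length ts = fun_ar \<sigma> ! f \<and> (\<forall>t \<in> set ts. trm_ok \<sigma> t)"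

fun atom_ok :: "signature \<Rightarrow> atom \<Rightarrow> bool" where
  "atom_ok \<sigma> (Eq s t) \<longleftrightarrow> trm_ok \<sigma> s \<and> trm_ok \<sigma> t"
| "atom_ok \<sigma> (Rel r ts) \<longleftrightarrow>
     r < length (rel_ar \<sigma>) \<and> length ts = rel_ar \<sigma> ! r \<and> (\<forall>t \<in> set ts. trm_ok \<sigma> t)"

fun fm_ok :: "signature \<Rightarrow> fm \<Rightarrow> bool" where
  "fm_ok \<sigma> (Atom \<alpha>) \<longleftrightarrow> atom_ok \<sigma> \<alpha>"
| "fm_ok \<sigma> (Neg \<phi>) \<longleftrightarrow> fm_ok \<sigma> \<phi>"
| "fm_ok \<sigma> (Conj \<phi> \<psi>) \<longleftrightarrow> fm_ok \<sigma> \<phi> \<and> fm_ok \<sigma> \<psi>"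
| "fm_ok \<sigma> (Ex x \<phi>) \<longleftrightarrow> fm_ok \<sigma> \<phi>"

fun trm_vars :: "trm \<Rightarrow> nat set" where
  "trm_vars (Var x) = {x}"
| "trm_vars (Fn f ts) = (\<Union>t \<in> set ts. trm_vars t)"

fun atom_vars :: "atom \<Rightarrow> nat set" where
  "atom_vars (Eq s t) = trm_vars s \<union> trm_vars t"
| "atom_vars (Rel r ts) = (\<Union>t \<in> set ts. trm_vars t)"

fun free_vars :: "fm \<Rightarrow> nat set" where
  "free_vars (Atom \<alpha>) = atom_vars \<alpha>"
| "free_vars (Neg \<phi>) = free_vars \<phi>"
| "free_vars (Conj \<phi> \<psi>) = free_vars \<phi> \<union> free_vars \<psi>"
| "free_vars (Ex x \<phi>) = free_vars \<phi> - {x}"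

fun val :: "'a struct \<Rightarrow> (nat \<Rightarrow> 'a) \<Rightarrow> trm \<Rightarrow> 'a" where
  "val A s (Var x) = s x"
| "val A s (Fn f ts) = funs A f (map (val A s) ts)"

fun sat_atom :: "'a struct \<Rightarrow> (nat \<Rightarrow> 'a) \<Rightarrow> atom \<Rightarrow> bool" where
  "sat_atom A s (Eq t u) \<longleftrightarrow> val A s t = val A s u"
| "sat_atom A s (Rel r ts) \<longleftrightarrow> map (val A s) ts \<in> rels A r"

fun sat :: "'a struct \<Rightarrow> (nat \<Rightarrow> 'a) \<Rightarrow> fm \<Rightarrow> bool" where
  "sat A s (Atom \<alpha>) \<longleftrightarrow> sat_atom A s \<alpha>"
| "sat A s (Neg \<phi>) \<longleftrightarrow> \<not> sat A s \<phi>"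
| "sat A s (Conj \<phi> \<psi>) \<longleftrightarrow> sat A s \<phi> \<and> sat A s \<psi>"
| "sat A s (Ex x \<phi>) \<longleftrightarrow> (\<exists>a \<in> univ A. sat A (s(x := a)) \<phi>)"

definition assignments :: "'a struct \<Rightarrow> (nat \<Rightarrow> 'a) set" where
  "assignments A = {s. range s \<subseteq> univ A}"

definition sentence :: "signature \<Rightarrow> fm \<Rightarrow> bool" where
  "sentence \<sigma> \<phi> \<longleftrightarrow> fm_ok \<sigma> \<phi> \<and> free_vars \<phi> = {}"

definition theory_of :: "signature \<Rightarrow> 'a struct \<Rightarrow> fm set" where
  "theory_of \<sigma> A = {\<phi>. sentence \<sigma> \<phi> \<and> (\<forall>s \<in> assignments A. sat A s \<phi>)}"

definition is_model :: "signature \<Rightarrow> 'a struct \<Rightarrow> fm set \<Rightarrow> bool" where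
  "is_model \<sigma> M T \<longleftrightarrow>
     is_structure \<sigma> M \<and> (\<forall>\<phi> \<in> T. \<forall>s \<in> assignments M. sat M s \<phi>)"

text \<open>
  Every countably infinite structure is isomorphic to one whose domain is an infinite set of
  natural numbers, so it suffices to quantify over models of the latter kind.
\<close>

definition omega_categorical :: "signature \<Rightarrow> 'a struct \<Rightarrow> bool" where
  "omega_categorical \<sigma> A \<longleftrightarrow>
     (\<forall>(M :: nat struct) (N :: nat struct).
        is_model \<sigma> M (theory_of \<sigma> A) \<and> infinite (univ M) \<and>
        is_model \<sigma> N (theory_of \<sigma> A) \<and> infinite (univ N) \<longrightarrow>
        (\<exists>h. isomorphism \<sigma> h M N))"

fun quantifier_free :: "fm \<Rightarrow> bool" where
  "quantifier_free (Atom \<alpha>) \<longleftrightarrow> True"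
| "quantifier_free (Neg \<phi>) \<longleftrightarrow> quantifier_free \<phi>"
| "quantifier_free (Conj \<phi> \<psi>) \<longleftrightarrow> quantifier_free \<phi> \<and> quantifier_free \<psi>"
| "quantifier_free (Ex x \<phi>) \<longleftrightarrow> False"

definition existential :: "fm \<Rightarrow> bool" where
  "existential \<phi> \<longleftrightarrow> (\<exists>xs \<psi>. quantifier_free \<psi> \<and> \<phi> = foldr Ex xs \<psi>)"

definition model_complete :: "signature \<Rightarrow> 'a struct \<Rightarrow> bool" where
  "model_complete \<sigma> A \<longleftrightarrow>
     (\<forall>\<phi>. fm_ok \<sigma> \<phi> \<longrightarrow>
        (\<exists>\<psi>. fm_ok \<sigma> \<psi> \<and> existential \<psi> \<and> free_vars \<psi> \<subseteq> free_vars \<phi> \<and>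
             (\<forall>s \<in> assignments A. sat A s \<phi> \<longleftrightarrow> sat A s \<psi>)))"


section \<open>Expansions by disequality and by constants\<close>

definition neq_sig :: "signature \<Rightarrow> signature" where
  "neq_sig \<sigma> = \<sigma>\<lparr>rel_ar := rel_ar \<sigma> @ [2]\<rparr>"

definition neq_expansion :: "signature \<Rightarrow> 'a struct \<Rightarrow> 'a struct" where
  "neq_expansion \<sigma> A =
     A\<lparr>rels := (rels A)(length (rel_ar \<sigma>) := {[a, b] | a b. a \<in> univ A \<and> b \<in> univ A \<and> a \<noteq> b})\<rparr>"

definition const_sig :: "signature \<Rightarrow> nat \<Rightarrow> signature" where
  "const_sig \<sigma> n = \<sigma>\<lparr>fun_ar := fun_ar \<sigma> @ replicate n 0\<rparr>"

definition const_expansion :: "signature \<Rightarrow> 'a struct \<Rightarrow> 'a list \<Rightarrow> 'a struct" where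
  "const_expansion \<sigma> A as =
     A\<lparr>funs := (\<lambda>f xs. if f < length (fun_ar \<sigma>) then funs A f xs
                      else as ! (f - length (fun_ar \<sigma>)))\<rparr>"


section \<open>Constraint satisfaction problems as formal languages\<close>

text \<open>
  Numbers are written in binary (least significant digit first), every digit preceded by the
  marker \<open>True\<close>, the whole number ended by the marker \<open>False\<close>. Terms and atoms are written in
  Polish notation, and a conjunction is the concatenation of its conjuncts.
\<close>

fun binary :: "nat \<Rightarrow> bool list" where
  "binary n = (if n = 0 then [] else odd n # binary (n div 2))"

declare binary.simps [simp del]

definition enc_nat :: "nat \<Rightarrow> bool list" where
  "enc_nat n = concat (map (\<lambda>b. [True, b]) (binary n)) @ [False]"

fun enc_trm :: "trm \<Rightarrow> bool list" where
  "enc_trm (Var x) = False # enc_nat x"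
| "enc_trm (Fn f ts) = True # enc_nat f @ concat (map enc_trm ts)"

fun enc_atom :: "atom \<Rightarrow> bool list" where
  "enc_atom (Eq s t) = False # enc_trm s @ enc_trm t"
| "enc_atom (Rel r ts) = True # enc_nat r @ concat (map enc_trm ts)"

definition enc_conj :: "atom list \<Rightarrow> bool list" where
  "enc_conj \<alpha>s = concat (map enc_atom \<alpha>s)"

definition csp_instance :: "signature \<Rightarrow> atom list \<Rightarrow> bool" where
  "csp_instance \<sigma> \<alpha>s \<longleftrightarrow> (\<forall>\<alpha> \<in> set \<alpha>s. atom_ok \<sigma> \<alpha>)"

definition satisfiable_in :: "'a struct \<Rightarrow> atom list \<Rightarrow> bool" where
  "satisfiable_in A \<alpha>s \<longleftrightarrow> (\<exists>s \<in> assignments A. \<forall>\<alpha> \<in> set \<alpha>s. sat_atom A s \<alpha>)"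

definition CSP :: "signature \<Rightarrow> 'a struct \<Rightarrow> bool list set" where
  "CSP \<sigma> A = {enc_conj \<alpha>s | \<alpha>s. csp_instance \<sigma> \<alpha>s \<and> satisfiable_in A \<alpha>s}"

text \<open>Over a fixed signature an instance can be recovered from its code.\<close>

lemma binary_inj: "binary m = binary n \<Longrightarrow> m = n"
proof (induction m arbitrary: n rule: less_induct)
  case (less m)
  show ?case
  proof (cases "m = 0 \<or> n = 0")
    case True
    then show ?thesis
      using less.prems binary.simps[of m] binary.simps[of n] by (auto split: if_splits)
  next
    case False
    then have "odd m = odd n" "binary (m div 2) = binary (n div 2)"
      using less.prems binary.simps[of m] binary.simps[of n] by auto
    moreover have "m div 2 < m" using False by simp
    ultimately have "m div 2 = n div 2" "odd m = odd n" using less.IH by auto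
    then show ?thesis by presburger
  qed
qed

lemma enc_nat_inj: "enc_nat m @ u = enc_nat n @ v \<Longrightarrow> m = n \<and> u = v"
proof -
  have *: "bs = cs \<and> u = v"
    if "concat (map (\<lambda>b. [True, b]) bs) @ False # u = concat (map (\<lambda>b. [True, b]) cs) @ False # v"
    for bs cs u v
    using that
  proof (induction bs arbitrary: cs)
    case Nil
    then show ?case by (cases cs) auto
  next
    case (Cons b bs)
    then show ?case by (cases cs) auto
  qed
  assume "enc_nat m @ u = enc_nat n @ v"
  then have "binary m = binary n \<and> u = v" by (intro *) (simp add: enc_nat_def)
  then show ?thesis using binary_inj by blast
qed

lemma enc_trms_inj:
  assumes "\<And>t t' u v. t \<in> set ts \<Longrightarrow> trm_ok \<sigma> t \<Longrightarrow> trm_ok \<sigma> t' \<Longrightarrow>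
             enc_trm t @ u = enc_trm t' @ v \<Longrightarrow> t = t' \<and> u = v"
    and "length ts = length ts'" "\<forall>t \<in> set ts. trm_ok \<sigma> t" "\<forall>t \<in> set ts'. trm_ok \<sigma> t"
    and "concat (map enc_trm ts) @ u = concat (map enc_trm ts') @ v"
  shows "ts = ts' \<and> u = v"
  using assms(2,1,3-)
proof (induction ts ts' rule: list_induct2)
  case Nil
  then show ?case by simp
next
  case (Cons t ts t' ts')
  have "t = t' \<and> concat (map enc_trm ts) @ u = concat (map enc_trm ts') @ v"
    by (rule Cons.prems(1)) (use Cons.prems(2-4) in simp_all)
  moreover have "ts = ts' \<and> u = v"
  proof (rule Cons.IH)
    show "t = t' \<and> u = v"
      if "t \<in> set ts" "trm_ok \<sigma> t" "trm_ok \<sigma> t'" "enc_trm t @ u = enc_trm t' @ v" for t t' u v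
      using Cons.prems(1)[of t t' u v] that by simp
  qed (use calculation Cons.prems(2,3) in simp_all)
  ultimately show ?case by simp
qed

lemma enc_trm_inj:
  "trm_ok \<sigma> t \<Longrightarrow> trm_ok \<sigma> t' \<Longrightarrow> enc_trm t @ u = enc_trm t' @ v \<Longrightarrow> t = t' \<and> u = v"
proof (induction t arbitrary: t' u v)
  case (Var x)
  then show ?case by (cases t') (auto dest: enc_nat_inj)
next
  case (Fn f ts)
  then obtain ts' where t': "t' = Fn f ts'"
    "concat (map enc_trm ts) @ u = concat (map enc_trm ts') @ v"
    by (cases t') (auto dest: enc_nat_inj)
  have "ts = ts' \<and> u = v"
    by (rule enc_trms_inj[OF Fn.IH]) (use Fn.prems t' in auto)
  then show ?case using t' by simp
qed

lemma enc_atom_inj: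
  assumes "atom_ok \<sigma> \<alpha>" "atom_ok \<sigma> \<beta>" "enc_atom \<alpha> @ u = enc_atom \<beta> @ v"
  shows "\<alpha> = \<beta> \<and> u = v"
proof (cases \<alpha>)
  case (Eq s t)
  with assms(3) obtain s' t' where \<beta>: "\<beta> = Eq s' t'" by (cases \<beta>) simp_all
  have "s = s' \<and> enc_trm t @ u = enc_trm t' @ v"
    by (rule enc_trm_inj[of \<sigma>]) (use assms Eq \<beta> in simp_all)
  moreover from this have "t = t' \<and> u = v"
    by (intro enc_trm_inj[of \<sigma>]) (use assms Eq \<beta> in simp_all)
  ultimately show ?thesis using Eq \<beta> by simp
next
  case (Rel r ts)
  with assms(3) obtain r' ts' where \<beta>: "\<beta> = Rel r' ts'" by (cases \<beta>) simp_all
  have *: "r = r' \<and> concat (map enc_trm ts) @ u = concat (map enc_trm ts') @ v"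
    by (rule enc_nat_inj) (use assms(3) Rel \<beta> in simp)
  have "ts = ts' \<and> u = v"
    by (rule enc_trms_inj[of _ \<sigma>, OF enc_trm_inj[of \<sigma>]]) (use assms(1,2) Rel \<beta> * in simp_all)
  with Rel \<beta> * show ?thesis by simp
qed

lemma enc_conj_inj:
  "csp_instance \<sigma> \<alpha>s \<Longrightarrow> csp_instance \<sigma> \<beta>s \<Longrightarrow> enc_conj \<alpha>s = enc_conj \<beta>s \<Longrightarrow> \<alpha>s = \<beta>s"
proof (induction \<alpha>s arbitrary: \<beta>s)
  have nonempty: "enc_atom \<alpha> \<noteq> []" for \<alpha> by (cases \<alpha>) simp_all
  {
    case Nil
    then show ?case by (cases \<beta>s) (simp_all add: enc_conj_def nonempty)
  next
    case (Cons \<alpha> \<alpha>s)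
    then obtain \<beta> \<beta>s' where \<beta>: "\<beta>s = \<beta> # \<beta>s'"
      by (cases \<beta>s) (simp_all add: enc_conj_def nonempty)
    have "\<alpha> = \<beta> \<and> enc_conj \<alpha>s = enc_conj \<beta>s'"
      by (rule enc_atom_inj[of \<sigma>])
        (use Cons.prems \<beta> in \<open>simp_all add: enc_conj_def csp_instance_def\<close>)
    then show ?case using Cons.IH[of \<beta>s'] Cons.prems(1,2) \<beta> by (simp add: csp_instance_def)
  }
qed


section \<open>Polynomial-time Turing reductions\<close>

text \<open>
  Deterministic oracle Turing machines with finitely many two-way infinite tapes. Tape 0 is the
  input tape, tape 1 is the oracle tape. States, tape symbols and tapes are numbered from 0.
  Symbol 0 is the blank, symbols 1 and 2 stand for the bits \<open>False\<close> and \<open>True\<close>. Given a state and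
  the list of symbols under the heads, \<open>delta\<close> yields the next state and, for every tape, the
  symbol to be written and the head movement.
\<close>

record otm =
  tape_count :: nat
  symbol_count :: nat
  state_count :: nat
  start :: nat
  accept :: nat
  reject :: nat
  query :: nat
  ans_yes :: nat
  ans_no :: nat
  delta :: "nat \<Rightarrow> nat list \<Rightarrow> nat \<times> (nat \<times> int) list"

definition is_otm :: "otm \<Rightarrow> bool" where
  "is_otm M \<longleftrightarrow>
     2 \<le> tape_count M \<and> 3 \<le> symbol_count M \<and>
     {start M, accept M, reject M, query M, ans_yes M, ans_no M} \<subseteq> {..<state_count M} \<and>
     distinct [accept M, reject M, query M] \<and>
     (\<forall>q < state_count M. \<forall>as \<in> tuples {..<symbol_count M} (tape_count M).
        fst (delta M q as) < state_count M \<and>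
        snd (delta M q as) \<in> tuples ({..<symbol_count M} \<times> {-1, 0, 1}) (tape_count M))"

text \<open>A tape consists of its contents and the position of its head.\<close>

type_synonym tape = "(int \<Rightarrow> nat) \<times> int"

type_synonym config = "nat \<times> tape list"

definition blank_tape :: tape where
  "blank_tape = (\<lambda>_. 0, 0)"

definition bit :: "bool \<Rightarrow> nat" where
  "bit b = (if b then 2 else 1)"

definition word_tape :: "bool list \<Rightarrow> tape" where
  "word_tape w = (\<lambda>i. if 0 \<le> i \<and> i < int (length w) then bit (w ! nat i) else 0, 0)"

definition initial :: "otm \<Rightarrow> bool list \<Rightarrow> config" where
  "initial M w = (start M, word_tape w # replicate (tape_count M - 1) blank_tape)"

fun act :: "nat \<times> int \<Rightarrow> tape \<Rightarrow> tape" where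
  "act (a, d) (c, h) = (c(h := a), h + d)"

text \<open>
  The query word extends from cell 0 of the oracle tape up to the first blank. A query leaves all
  tapes unchanged; in particular the oracle tape is not erased.
\<close>

definition holds_word :: "tape \<Rightarrow> bool list \<Rightarrow> bool" where
  "holds_word t w \<longleftrightarrow>
     (\<forall>i < length w. fst t (int i) = bit (w ! i)) \<and> fst t (int (length w)) = 0"

definition step :: "otm \<Rightarrow> bool list set \<Rightarrow> config \<Rightarrow> config" where
  "step M X = (\<lambda>(q, ts).
     if q = accept M \<or> q = reject M then (q, ts)
     else if q = query M then
       (if \<exists>w \<in> X. holds_word (ts ! 1) w then ans_yes M else ans_no M, ts)
     else
       (case delta M q (map (\<lambda>(c, h). c h) ts) of (q', acts) \<Rightarrow> (q', map2 act acts ts)))"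

definition decides_in_time ::
  "otm \<Rightarrow> bool list set \<Rightarrow> bool list set \<Rightarrow> (nat \<Rightarrow> nat) \<Rightarrow> bool" where
  "decides_in_time M X L T \<longleftrightarrow>
     (\<forall>w. \<exists>n \<le> T (length w).
        fst ((step M X ^^ n) (initial M w)) = (if w \<in> L then accept M else reject M))"

definition poly_time_reducible :: "bool list set \<Rightarrow> bool list set \<Rightarrow> bool" where
  "poly_time_reducible L X \<longleftrightarrow>
     (\<exists>M (p :: nat poly). is_otm M \<and> decides_in_time M X L (poly p))"

definition poly_time_equivalent :: "bool list set \<Rightarrow> bool list set \<Rightarrow> bool" where
  "poly_time_equivalent L X \<longleftrightarrow> poly_time_reducible L X \<and> poly_time_reducible X L"

end

theory Submission
  imports Defs "HOL-Library.Countable_Set"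
begin

text \<open>
  \<open>\<omega>\<close>-categoricity is used through the theorem of Ryll-Nardzewski: if infinitely many \<open>n\<close>-ary relations
  were definable, there would be a nonprincipal type, and hence two countable models of which one
  realises and the other omits it. So only finitely many relations of each arity have a primitive
  positive definition in \<open>(A, \<noteq>)\<close>.

  Let \<open>P\<^sub>1, \<dots>, P\<^sub>k\<close> be the minimal nonempty primitive positive binary relations contained in \<open>\<noteq>\<close>, and choose
  the constants \<open>(c\<^sub>1, \<dots>, c\<^sub>k, d\<^sub>1, \<dots>, d\<^sub>k)\<close> in a minimal nonempty primitive positive relation \<open>Q\<close> all of whose
  elements satisfy \<open>P\<^sub>j(c\<^sub>j, d\<^sub>j)\<close>. For positive \<open>\<phi>\<close>, \<open>\<phi> \<and> s \<noteq> t\<close> is satisfiable iff \<open>\<phi> \<and> s = c\<^sub>j \<and> t = d\<^sub>j\<close> is for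
  some \<open>j\<close>, and since \<open>A\<^sup>2\<close> embeds into \<open>A\<close>, several disequalities are satisfiable together with \<open>\<phi>\<close> iff each
  one of them is. This is a Turing reduction to the CSP with constants. Conversely, the constants
  may be replaced by variables constrained by \<open>Q\<close>: by minimality of \<open>Q\<close>, if some element of \<open>Q\<close>
  satisfies a primitive positive formula, then all do.

  Both reductions are computed by one kind of oracle machine. For every position \<open>p\<close> of the input and
  some \<open>j\<close> it needs a positive answer to the query obtained by a left-to-right translation of the
  input in which the atom whose header ends at \<open>p\<close> gets a special treatment that depends on \<open>j\<close>. A
  counter of pending subterms suffices to parse the Polish notation.
\<close>

section \<open>Definable sets of assignments\<close>

text \<open>The constants serve two opposite purposes. They must represent every way in which two
  terms can differ, and they must be replaceable by variables. Minimal binary relations give the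
  first: any nonempty primitive positive part of the disequality relation contains some minimal one,
  hence the pair of constants taken from it. The second concerns the whole tuple at once, since
  relations chosen separately for the pairs would not control how different pairs interact. This is
  why Q is sought below the product of all P_j, which keeps each pair in its own relation.
  Finiteness is used twice, in arity 2 to have finitely many pairs and in arity 2k to find Q. The
  resulting criterion is a conjunction over the disequalities of a disjunction over the pairs, each
  member concerning another instance; the Turing reduction evaluates this combination query by
  query. The countable models live on sets of natural numbers, as in the definition of categoricity.
  Their construction uses definable sets of assignments over A as conditions, so that consistency of
  a condition is just nonemptiness.\<close>

instance trm :: countable by countable_datatype
instance atom :: countable by countable_datatype
instance fm :: countable by countable_datatype

lemma val_cong: "(\<And>x. x \<in> trm_vars t \<Longrightarrow> s x = s' x) \<Longrightarrow> val A s t = val A s' t"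
proof (induction t)
  case (Fn f ts)
  have "map (val A s) ts = map (val A s') ts" using Fn by (auto intro!: map_cong)
  then show ?case by (metis val.simps(2))
qed simp

lemma sat_atom_cong: "(\<And>x. x \<in> atom_vars \<alpha> \<Longrightarrow> s x = s' x) \<Longrightarrow> sat_atom A s \<alpha> = sat_atom A s' \<alpha>"
proof (cases \<alpha>)
  case (Eq t u)
  assume *: "\<And>x. x \<in> atom_vars \<alpha> \<Longrightarrow> s x = s' x"
  have "val A s t = val A s' t" by (rule val_cong) (use * Eq in auto)
  moreover have "val A s u = val A s' u" by (rule val_cong) (use * Eq in auto)
  ultimately show ?thesis using Eq by simp
next
  case (Rel r ts)
  assume *: "\<And>x. x \<in> atom_vars \<alpha> \<Longrightarrow> s x = s' x"
  have "map (val A s) ts = map (val A s') ts"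
    by (intro map_cong refl val_cong) (use * Rel in auto)
  then show ?thesis using Rel by (metis sat_atom.simps(2))
qed

lemma sat_cong: "(\<And>x. x \<in> free_vars \<phi> \<Longrightarrow> s x = s' x) \<Longrightarrow> sat A s \<phi> = sat A s' \<phi>"
proof (induction \<phi> arbitrary: s s')
  case (Atom \<alpha>)
  then show ?case using sat_atom_cong[of \<alpha> s s' A] by simp
next
  case (Neg \<phi>)
  from Neg.IH[of s s'] Neg.prems show ?case by simp
next
  case (Conj \<phi> \<psi>)
  from Conj.IH(1)[of s s'] Conj.IH(2)[of s s'] Conj.prems show ?case by simp
next
  case (Ex x \<phi>)
  have "sat A (s(x := a)) \<phi> = sat A (s'(x := a)) \<phi>" for a
    by (rule Ex.IH) (use Ex.prems in auto)
  then show ?case by simp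
qed

lemma finite_trm_vars: "finite (trm_vars t)"
  by (induction t) auto

lemma finite_free_vars: "finite (free_vars \<phi>)"
proof (induction \<phi>)
  case (Atom \<alpha>)
  then show ?case by (cases \<alpha>) (auto simp: finite_trm_vars)
qed auto

lemma assignments_iff: "t \<in> assignments A \<longleftrightarrow> (\<forall>x. t x \<in> univ A)"
  by (auto simp: assignments_def)

lemma assignments_upd: "t \<in> assignments A \<Longrightarrow> a \<in> univ A \<Longrightarrow> t(x := a) \<in> assignments A"
  by (auto simp: assignments_iff)

text \<open>Sets of total assignments instead of relations of a fixed arity: Boolean operations and
  projections then need no bookkeeping of variables.\<close>

definition definable :: "signature \<Rightarrow> 'a struct \<Rightarrow> (nat \<Rightarrow> 'a) set \<Rightarrow> bool" where
  "definable \<sigma> A S \<longleftrightarrow> (\<exists>\<phi>. fm_ok \<sigma> \<phi> \<and> S = {t \<in> assignments A. sat A t \<phi>})"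

lemma definable_subset: "definable \<sigma> A S \<Longrightarrow> S \<subseteq> assignments A"
  by (auto simp: definable_def)

lemma definable_sat: "fm_ok \<sigma> \<phi> \<Longrightarrow> definable \<sigma> A {t \<in> assignments A. sat A t \<phi>}"
  by (auto simp: definable_def)

lemma definable_assignments: "definable \<sigma> A (assignments A)"
  using definable_sat[of \<sigma> "Atom (Eq (Var 0) (Var 0))" A] by simp

lemma definable_Int:
  assumes "definable \<sigma> A S" "definable \<sigma> A T"
  shows "definable \<sigma> A (S \<inter> T)"
proof -
  obtain \<phi> \<psi> where "fm_ok \<sigma> \<phi>" "S = {t \<in> assignments A. sat A t \<phi>}"
    "fm_ok \<sigma> \<psi>" "T = {t \<in> assignments A. sat A t \<psi>}"
    using assms by (auto simp: definable_def)
  then have "fm_ok \<sigma> (Conj \<phi> \<psi>)" "S \<inter> T = {t \<in> assignments A. sat A t (Conj \<phi> \<psi>)}" by auto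
  then show ?thesis unfolding definable_def by blast
qed

lemma definable_Diff:
  assumes "definable \<sigma> A S" "definable \<sigma> A T"
  shows "definable \<sigma> A (S - T)"
proof -
  obtain \<phi> \<psi> where "fm_ok \<sigma> \<phi>" "S = {t \<in> assignments A. sat A t \<phi>}"
    "fm_ok \<sigma> \<psi>" "T = {t \<in> assignments A. sat A t \<psi>}"
    using assms by (auto simp: definable_def)
  then have "fm_ok \<sigma> (Conj \<phi> (Neg \<psi>))" "S - T = {t \<in> assignments A. sat A t (Conj \<phi> (Neg \<psi>))}"
    by auto
  then show ?thesis unfolding definable_def by blast
qed

lemma definable_project:
  assumes "definable \<sigma> A S"
  shows "definable \<sigma> A {t \<in> assignments A. \<exists>a \<in> univ A. t(x := a) \<in> S}"
proof -
  obtain \<phi> where \<phi>: "fm_ok \<sigma> \<phi>" "S = {t \<in> assignments A. sat A t \<phi>}"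
    using assms by (auto simp: definable_def)
  then have "{t \<in> assignments A. \<exists>a \<in> univ A. t(x := a) \<in> S} = {t \<in> assignments A. sat A t (Ex x \<phi>)}"
    by (auto simp: assignments_upd)
  then show ?thesis using \<phi>(1) definable_sat[of \<sigma> "Ex x \<phi>" A] by simp
qed

lemma ex_rename_trm:
  "\<exists>t'. (trm_ok \<sigma> t \<longrightarrow> trm_ok \<sigma> t') \<and> (\<forall>s. val A s t' = val A (s \<circ> r) t)"
proof (induction t)
  case (Var x)
  show ?case by (rule exI[of _ "Var (r x)"]) simp
next
  case (Fn f ts)
  then obtain g where g: "\<forall>t \<in> set ts. (trm_ok \<sigma> t \<longrightarrow> trm_ok \<sigma> (g t)) \<and> (\<forall>s. val A s (g t) = val A (s \<circ> r) t)"
    by metis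
  have "map (val A s) (map g ts) = map (val A (s \<circ> r)) ts" for s
    using g by simp
  then have "\<forall>s. val A s (Fn f (map g ts)) = val A (s \<circ> r) (Fn f ts)"
    by (metis val.simps(2))
  moreover have "trm_ok \<sigma> (Fn f ts) \<longrightarrow> trm_ok \<sigma> (Fn f (map g ts))" using g by simp
  ultimately show ?case by blast
qed

text \<open>Only a formula with the right truth values in \<open>A\<close> is asked for, so no
  syntactic substitution has to be defined. A quantified variable moves to some \<open>y\<close>
  outside the image of the free variables under \<open>r\<close>, which prevents capture.\<close>

lemma ex_rename:
  "fm_ok \<sigma> \<phi> \<Longrightarrow> \<exists>\<psi>. fm_ok \<sigma> \<psi> \<and> (\<forall>s. sat A s \<psi> = sat A (s \<circ> r) \<phi>)"
proof (induction \<phi> arbitrary: r)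
  case (Atom \<alpha>)
  obtain g where g: "\<And>t. (trm_ok \<sigma> t \<longrightarrow> trm_ok \<sigma> (g t)) \<and> (\<forall>s. val A s (g t) = val A (s \<circ> r) t)"
    using ex_rename_trm by metis
  show ?case
  proof (cases \<alpha>)
    case (Eq t u)
    then show ?thesis using g Atom by (intro exI[of _ "Atom (Eq (g t) (g u))"]) (simp add: comp_def)
  next
    case (Rel r' ts)
    have "map (val A s) (map g ts) = map (val A (s \<circ> r)) ts" for s
      using g by simp
    then have "\<forall>s. sat A s (Atom (Rel r' (map g ts))) = sat A (s \<circ> r) (Atom \<alpha>)"
      by (metis Rel sat.simps(1) sat_atom.simps(2))
    moreover have "fm_ok \<sigma> (Atom (Rel r' (map g ts)))" using g Atom Rel by simp
    ultimately show ?thesis by blast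
  qed
next
  case (Neg \<phi>)
  then obtain \<psi> where "fm_ok \<sigma> \<psi> \<and> (\<forall>s. sat A s \<psi> = sat A (s \<circ> r) \<phi>)" by (metis fm_ok.simps(2))
  then show ?case by (intro exI[of _ "Neg \<psi>"]) (simp add: comp_def)
next
  case (Conj \<phi>1 \<phi>2)
  then obtain \<psi>1 \<psi>2 where "fm_ok \<sigma> \<psi>1 \<and> (\<forall>s. sat A s \<psi>1 = sat A (s \<circ> r) \<phi>1)"
    "fm_ok \<sigma> \<psi>2 \<and> (\<forall>s. sat A s \<psi>2 = sat A (s \<circ> r) \<phi>2)" by (metis fm_ok.simps(3))
  then show ?case by (intro exI[of _ "Conj \<psi>1 \<psi>2"]) (simp add: comp_def)
next
  case (Ex x \<phi>)
  have "finite (r ` free_vars \<phi>)" using finite_free_vars by blast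
  then obtain y where y: "y \<notin> r ` free_vars \<phi>" using ex_new_if_finite infinite_UNIV_nat by metis
  obtain \<psi> where \<psi>: "fm_ok \<sigma> \<psi>" "\<forall>s. sat A s \<psi> = sat A (s \<circ> r(x := y)) \<phi>"
    using Ex.IH[of "r(x := y)"] Ex.prems by (metis fm_ok.simps(4))
  have "sat A ((s(y := a)) \<circ> r(x := y)) \<phi> = sat A ((s \<circ> r)(x := a)) \<phi>" for s a
    by (rule sat_cong) (use y in auto)
  then show ?case using \<psi> by (intro exI[of _ "Ex y \<psi>"]) (simp add: comp_def)
qed

lemma definable_rename:
  assumes "definable \<sigma> A S"
  shows "definable \<sigma> A {t \<in> assignments A. t \<circ> r \<in> S}"
proof -
  obtain \<phi> where \<phi>: "fm_ok \<sigma> \<phi>" "S = {t \<in> assignments A. sat A t \<phi>}"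
    using assms by (auto simp: definable_def)
  obtain \<psi> where \<psi>: "fm_ok \<sigma> \<psi>" "\<forall>s. sat A s \<psi> = sat A (s \<circ> r) \<phi>"
    using ex_rename[OF \<phi>(1)] by metis
  have "{t \<in> assignments A. t \<circ> r \<in> S} = {t \<in> assignments A. sat A t \<psi>}"
    using \<phi>(2) \<psi>(2) by (auto simp: assignments_iff)
  then show ?thesis using \<psi>(1) definable_sat by metis
qed

text \<open>The definable relations of arity \<open>n\<close>, still carried by total assignments.
  The dependence on the coordinates below \<open>n\<close> is semantic; a defining formula may
  mention other variables.\<close>

definition ndef :: "signature \<Rightarrow> 'a struct \<Rightarrow> nat \<Rightarrow> (nat \<Rightarrow> 'a) set set" where
  "ndef \<sigma> A n = {S. definable \<sigma> A S \<and>
     (\<forall>t \<in> assignments A. \<forall>t' \<in> assignments A. (\<forall>i < n. t i = t' i) \<longrightarrow> (t \<in> S \<longleftrightarrow> t' \<in> S))}"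

lemma ndefI:
  assumes "definable \<sigma> A S"
    and "\<And>t t'. t \<in> assignments A \<Longrightarrow> t' \<in> assignments A \<Longrightarrow> \<forall>i < n. t i = t' i \<Longrightarrow> t \<in> S \<longleftrightarrow> t' \<in> S"
  shows "S \<in> ndef \<sigma> A n"
  unfolding ndef_def by (intro CollectI conjI ballI impI assms)

lemma definable_support:
  assumes "definable \<sigma> A S"
  shows "\<exists>N. S \<in> ndef \<sigma> A N"
proof -
  obtain \<phi> where \<phi>: "fm_ok \<sigma> \<phi>" "S = {t \<in> assignments A. sat A t \<phi>}"
    using assms by (auto simp: definable_def)
  obtain N where N: "\<forall>x \<in> free_vars \<phi>. x < N"
    using finite_free_vars finite_nat_set_iff_bounded by blast
  have "S \<in> ndef \<sigma> A N"
  proof (rule ndefI[OF assms])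
    fix t t' assume t: "t \<in> assignments A" "t' \<in> assignments A" "\<forall>i < N. t i = t' i"
    have "sat A t \<phi> = sat A t' \<phi>"
    proof (rule sat_cong)
      fix x assume "x \<in> free_vars \<phi>"
      then show "t x = t' x" using N t(3) by blast
    qed
    then show "t \<in> S \<longleftrightarrow> t' \<in> S" using \<phi>(2) t(1,2) by blast
  qed
  then show ?thesis ..
qed

lemma countable_definable: "countable {S. definable \<sigma> A S}"
proof -
  have "{S. definable \<sigma> A S} \<subseteq> (\<lambda>\<phi>. {t \<in> assignments A. sat A t \<phi>}) ` UNIV"
    by (auto simp: definable_def)
  then show ?thesis by (rule countable_subset) simp
qed

lemma definable_eq_var: "definable \<sigma> A {t \<in> assignments A. t x = t y}"
  using definable_sat[of \<sigma> "Atom (Eq (Var x) (Var y))" A] by simp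

lemma definable_eq_fun:
  "f < length (fun_ar \<sigma>) \<Longrightarrow> length zs = fun_ar \<sigma> ! f \<Longrightarrow>
    definable \<sigma> A {t \<in> assignments A. t x = funs A f (map t zs)}"
  using definable_sat[of \<sigma> "Atom (Eq (Var x) (Fn f (map Var zs)))" A] by (simp add: comp_def)

text \<open>Serves to make the Henkin models infinite: it expresses that \<open>x\<close> avoids
  finitely many given elements.\<close>

lemma definable_fresh:
  "finite D \<Longrightarrow> definable \<sigma> A {t \<in> assignments A. \<forall>d \<in> D. t x \<noteq> t d}"
proof (induction D rule: finite_induct)
  case empty
  then show ?case using definable_assignments by simp
next
  case (insert d D)
  have "{t \<in> assignments A. \<forall>e \<in> insert d D. t x \<noteq> t e} =
    {t \<in> assignments A. \<forall>d \<in> D. t x \<noteq> t d} - {t \<in> assignments A. t x = t d}" by auto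
  then show ?case using definable_Diff[OF insert.IH definable_eq_var[of \<sigma> A x d]] by simp
qed

lemma val_in_univ:
  "is_structure \<sigma> A \<Longrightarrow> s \<in> assignments A \<Longrightarrow> trm_ok \<sigma> t \<Longrightarrow> val A s t \<in> univ A"
proof (induction t)
  case (Var x)
  then show ?case by (simp add: assignments_iff)
next
  case (Fn f ts)
  then have "map (val A s) ts \<in> tuples (univ A) (fun_ar \<sigma> ! f)" by (auto simp: tuples_def)
  then show ?case using Fn.prems by (simp add: is_structure_def)
qed

section \<open>Henkin models from generic sequences of definable sets\<close>

lemma decseq_subset: "(\<And>i. \<Theta> (Suc i) \<subseteq> \<Theta> i) \<Longrightarrow> i \<le> j \<Longrightarrow> \<Theta> j \<subseteq> (\<Theta> i :: 'b set)"
  using lift_Suc_antimono_le by blast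

text \<open>The sequence approximates a complete type of \<open>A\<close> in variables indexed by
  the natural numbers. \<open>decide\<close> makes the type complete, and \<open>witness\<close>
  supplies for every existential statement in it a variable naming a witness. The model consists of
  the variables modulo the equalities that belong to the type.\<close>

locale henkin =
  fixes \<sigma> :: signature and A :: "'a struct" and \<Theta> :: "nat \<Rightarrow> (nat \<Rightarrow> 'a) set"
  assumes is_struct: "is_structure \<sigma> A"
    and infinite_univ: "infinite (univ A)"
    and decreasing: "\<And>i. \<Theta> (Suc i) \<subseteq> \<Theta> i"
    and nonempty: "\<And>i. \<Theta> i \<noteq> {}"
    and assignments: "\<And>i. \<Theta> i \<subseteq> assignments A"
    and decide: "\<And>S. definable \<sigma> A S \<Longrightarrow> \<exists>i. \<Theta> i \<subseteq> S \<or> \<Theta> i \<inter> S = {}"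
    and witness: "\<And>S x i. definable \<sigma> A S \<Longrightarrow> \<Theta> i \<subseteq> {t. \<exists>a \<in> univ A. t(x := a) \<in> S} \<Longrightarrow>
      \<exists>y j. \<Theta> j \<subseteq> {t. t(x := t y) \<in> S}"
begin

text \<open>Truth on some \<open>\<Theta> i\<close> and hence on all later ones. These predicates
  form a filter, and the limit type consists of the formulas that hold eventually.\<close>

definition ev :: "((nat \<Rightarrow> 'a) \<Rightarrow> bool) \<Rightarrow> bool" where
  "ev P \<longleftrightarrow> (\<exists>i. \<forall>t \<in> \<Theta> i. P t)"

lemma ev_mono: "ev P \<Longrightarrow> (\<And>t. t \<in> assignments A \<Longrightarrow> P t \<Longrightarrow> Q t) \<Longrightarrow> ev Q"
  unfolding ev_def using assignments by blast

lemma ev_all: "(\<And>t. t \<in> assignments A \<Longrightarrow> P t) \<Longrightarrow> ev P"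
  unfolding ev_def using assignments by blast

lemma ev_cong: "ev R \<Longrightarrow> (\<And>t. t \<in> assignments A \<Longrightarrow> R t \<Longrightarrow> P t = Q t) \<Longrightarrow> ev P \<longleftrightarrow> ev Q"
proof -
  have "ev Q" if "ev R" "ev P" "\<And>t. t \<in> assignments A \<Longrightarrow> R t \<Longrightarrow> P t = Q t" for R P Q
  proof -
    obtain i j where "\<forall>t \<in> \<Theta> i. R t" "\<forall>t \<in> \<Theta> j. P t" using \<open>ev R\<close> \<open>ev P\<close> by (auto simp: ev_def)
    then have "\<forall>t \<in> \<Theta> (max i j). Q t"
      using that(3) assignments decseq_subset[of \<Theta>, OF decreasing] by (meson in_mono max.cobounded1 max.cobounded2)
    then show ?thesis by (auto simp: ev_def)
  qed
  then show "ev R \<Longrightarrow> (\<And>t. t \<in> assignments A \<Longrightarrow> R t \<Longrightarrow> P t = Q t) \<Longrightarrow> ev P \<longleftrightarrow> ev Q"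
    by metis
qed

lemma ev_conj: "ev (\<lambda>t. P t \<and> Q t) \<longleftrightarrow> ev P \<and> ev Q"
  using ev_cong[of P "\<lambda>t. P t \<and> Q t" Q] ev_mono[of "\<lambda>t. P t \<and> Q t"] by blast

lemma ev_conjI: "ev P \<Longrightarrow> ev Q \<Longrightarrow> ev (\<lambda>t. P t \<and> Q t)"
  by (simp only: ev_conj simp_thms)

lemma ev_const: "ev (\<lambda>_. P) \<longleftrightarrow> P"
  unfolding ev_def using nonempty by auto

text \<open>By \<open>decide\<close> the filter is an ultrafilter on definable predicates;
  \<open>nonempty\<close> keeps it proper.\<close>

lemma ev_not:
  assumes "definable \<sigma> A {t \<in> assignments A. P t}"
  shows "ev (\<lambda>t. \<not> P t) \<longleftrightarrow> \<not> ev P"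
proof
  assume "ev (\<lambda>t. \<not> P t)"
  then show "\<not> ev P" using ev_conj[of P "\<lambda>t. \<not> P t"] ev_const[of False] by simp
next
  assume "\<not> ev P"
  obtain i where "\<Theta> i \<subseteq> {t \<in> assignments A. P t} \<or> \<Theta> i \<inter> {t \<in> assignments A. P t} = {}"
    using decide[OF assms] by blast
  moreover have "\<not> \<Theta> i \<subseteq> {t \<in> assignments A. P t}" using \<open>\<not> ev P\<close> unfolding ev_def by blast
  ultimately have "\<forall>t \<in> \<Theta> i. \<not> P t" using assignments[of i] by blast
  then show "ev (\<lambda>t. \<not> P t)" unfolding ev_def by blast
qed

lemma ev_witness:
  assumes "definable \<sigma> A {t \<in> assignments A. P t}"
    and "ev (\<lambda>t. \<exists>a \<in> univ A. P (t(x := a)))"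
  shows "\<exists>y. ev (\<lambda>t. P (t(x := t y)))"
proof -
  obtain i where "\<Theta> i \<subseteq> {t. \<exists>a \<in> univ A. t(x := a) \<in> {t \<in> assignments A. P t}}"
  proof -
    obtain i where "\<forall>t \<in> \<Theta> i. \<exists>a \<in> univ A. P (t(x := a))" using assms(2) by (auto simp: ev_def)
    moreover have "t \<in> assignments A" if "t \<in> \<Theta> i" for t using that assignments[of i] by auto
    ultimately show ?thesis by (intro that[of i] subsetI) (use assignments_upd in fastforce)
  qed
  from witness[OF assms(1) this] obtain y j
    where "\<Theta> j \<subseteq> {t. t(x := t y) \<in> {t \<in> assignments A. P t}}" by blast
  then have "\<forall>t \<in> \<Theta> j. P (t(x := t y))" by blast
  then show ?thesis unfolding ev_def by (intro exI)
qed

text \<open>The least variable of each class replaces a quotient, so that the universe is a set of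
  natural numbers and \<open>omega_categorical\<close> applies directly.\<close>

definition rep :: "nat \<Rightarrow> nat" where
  "rep x = (LEAST y. ev (\<lambda>t. t y = t x))"

lemma ev_rep: "ev (\<lambda>t. t (rep x) = t x)"
  unfolding rep_def by (rule LeastI[of "\<lambda>y. ev (\<lambda>t. t y = t x)" x]) (simp add: ev_const)

lemma rep_eq_iff: "rep x = rep y \<longleftrightarrow> ev (\<lambda>t. t x = t y)"
proof
  assume "rep x = rep y"
  then have "ev (\<lambda>t. t (rep x) = t x \<and> t (rep x) = t y)" using ev_rep[of x] ev_rep[of y] ev_conj by simp
  then show "ev (\<lambda>t. t x = t y)" by (rule ev_mono) (metis (no_types))
next
  assume "ev (\<lambda>t. t x = t y)"
  then have "ev (\<lambda>t. t z = t x) = ev (\<lambda>t. t z = t y)" for z by (rule ev_cong) simp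
  then show "rep x = rep y" by (simp add: rep_def)
qed

lemma rep_rep: "rep (rep x) = rep x"
  using rep_eq_iff ev_rep by simp

text \<open>Elements are variables. A function value is a variable that eventually equals the value
  in \<open>A\<close>; all choices have the same representative, so \<open>SOME\<close> is
  harmless.\<close>

definition model :: "nat struct" where
  "model = \<lparr>univ = range rep,
     funs = (\<lambda>f zs. rep (SOME z. ev (\<lambda>t. t z = funs A f (map t zs)))),
     rels = (\<lambda>r. {zs \<in> tuples (range rep) (rel_ar \<sigma> ! r). ev (\<lambda>t. map t zs \<in> rels A r)})\<rparr>"

lemma structure_model: "is_structure \<sigma> model"
  by (auto simp: is_structure_def model_def)

lemma map_fun_in_univ:
  "f < length (fun_ar \<sigma>) \<Longrightarrow> length zs = fun_ar \<sigma> ! f \<Longrightarrow> t \<in> assignments A \<Longrightarrow> funs A f (map t zs) \<in> univ A"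
  using is_struct by (simp add: is_structure_def tuples_def assignments_iff image_subset_iff)

text \<open>The variable chosen in \<open>model\<close> exists because it witnesses the true
  statement that some \<open>x\<close> equals the function value. Taking \<open>x\<close> outside
  \<open>zs\<close> keeps the arguments fixed when \<open>x\<close> is updated.\<close>

lemma ev_funs_model:
  assumes "f < length (fun_ar \<sigma>)" "length zs = fun_ar \<sigma> ! f"
  shows "ev (\<lambda>t. t (funs model f zs) = funs A f (map t zs))"
proof -
  obtain x where x: "x \<notin> set zs" using ex_new_if_finite infinite_UNIV_nat finite_set by metis
  then have upd: "map (t(x := a)) zs = map t zs" for t :: "nat \<Rightarrow> 'a" and a by auto
  have "\<exists>z. ev (\<lambda>t. (t(x := t z)) x = funs A f (map (t(x := t z)) zs))"
  proof (rule ev_witness[where P = "\<lambda>t. t x = funs A f (map t zs)"])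
    show "definable \<sigma> A {t \<in> assignments A. t x = funs A f (map t zs)}"
      using assms definable_eq_fun by blast
    show "ev (\<lambda>t. \<exists>a \<in> univ A. (t(x := a)) x = funs A f (map (t(x := a)) zs))"
      unfolding upd using assms map_fun_in_univ by (intro ev_all) simp
  qed
  then have "\<exists>z. ev (\<lambda>t. t z = funs A f (map t zs))" by (simp add: upd del: fun_upd_apply map_eq_conv) simp
  then have *: "ev (\<lambda>t. t (SOME z. ev (\<lambda>t. t z = funs A f (map t zs))) = funs A f (map t zs))"
    by (rule someI_ex)
  show ?thesis
    by (rule ev_mono[of "\<lambda>t. t (rep (SOME z. ev (\<lambda>t. t z = funs A f (map t zs)))) = t (SOME z. ev (\<lambda>t. t z = funs A f (map t zs)))
       \<and> t (SOME z. ev (\<lambda>t. t z = funs A f (map t zs))) = funs A f (map t zs)"])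
      (use * ev_rep ev_conj in \<open>auto simp: model_def\<close>)
qed

lemma ev_Ball: "(\<And>x. x \<in> set xs \<Longrightarrow> ev (P x)) \<Longrightarrow> ev (\<lambda>t. \<forall>x \<in> set xs. P x t)"
  by (induction xs) (auto simp: ev_const ev_conj)

lemma ev_map_val:
  assumes "\<And>u. u \<in> set ts \<Longrightarrow> ev (\<lambda>t. t (g u) = h t u)"
  shows "ev (\<lambda>t. map t (map g ts) = map (h t) ts)"
  using ev_mono[OF ev_Ball[of ts "\<lambda>u t. t (g u) = h t u"], of "\<lambda>t. map t (map g ts) = map (h t) ts"] assms
  by auto

text \<open>An assignment \<open>s\<close> of the model has variables as values; composed with an
  assignment \<open>t\<close> of \<open>A\<close> it becomes the assignment
  \<open>t \<circ> s\<close> of \<open>A\<close>.\<close>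

lemma ev_val_model:
  assumes "s \<in> assignments model" "trm_ok \<sigma> u"
  shows "ev (\<lambda>t. t (val model s u) = val A (t \<circ> s) u)"
  using assms(2)
proof (induction u)
  case (Var x)
  then show ?case by (simp add: ev_const)
next
  case (Fn f us)
  let ?zs = "map (val model s) us"
  have 1: "ev (\<lambda>t. map t ?zs = map (val A (t \<circ> s)) us)"
    by (rule ev_map_val) (use Fn in \<open>auto simp: comp_def\<close>)
  have 2: "ev (\<lambda>t. t (funs model f ?zs) = funs A f (map t ?zs))"
    by (rule ev_funs_model) (use Fn.prems in auto)
  from 1 2 have "ev (\<lambda>t. map t ?zs = map (val A (t \<circ> s)) us \<and> t (funs model f ?zs) = funs A f (map t ?zs))"
    by (rule ev_conjI)
  then show ?case unfolding val.simps by (rule ev_mono) (simp only:)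
qed

lemma univ_model_iff: "z \<in> univ model \<longleftrightarrow> rep z = z"
  using rep_rep by (auto simp: model_def image_iff) metis

text \<open>The truth lemma. Negation rests on the ultrafilter property, the quantifier on
  witnesses; atoms reduce to the eventual behaviour of terms.\<close>

lemma sat_model_iff:
  "fm_ok \<sigma> \<phi> \<Longrightarrow> s \<in> assignments model \<Longrightarrow> sat model s \<phi> \<longleftrightarrow> ev (\<lambda>t. sat A (t \<circ> s) \<phi>)"
proof (induction \<phi> arbitrary: s)
  case (Atom \<alpha>)
  note s = Atom.prems(2)
  show ?case
  proof (cases \<alpha>)
    case (Eq u v)
    let ?x = "val model s u" and ?y = "val model s v"
    have ok: "trm_ok \<sigma> u" "trm_ok \<sigma> v" using Atom.prems Eq by auto
    have "ev (\<lambda>t. t ?x = val A (t \<circ> s) u \<and> t ?y = val A (t \<circ> s) v)"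
      using ev_val_model[OF s] ok by (intro ev_conjI) auto
    then have "ev (\<lambda>t. t ?x = t ?y) \<longleftrightarrow> ev (\<lambda>t. val A (t \<circ> s) u = val A (t \<circ> s) v)"
      by (rule ev_cong) simp
    moreover have "rep ?x = ?x" "rep ?y = ?y"
      using val_in_univ[OF structure_model s] ok univ_model_iff by auto
    ultimately show ?thesis using rep_eq_iff[of ?x ?y] Eq by (simp add: comp_def)
  next
    case (Rel r us)
    let ?zs = "map (val model s) us"
    have ok: "r < length (rel_ar \<sigma>)" "length us = rel_ar \<sigma> ! r" "\<forall>u \<in> set us. trm_ok \<sigma> u"
      using Atom.prems Rel by auto
    have zs: "?zs \<in> tuples (range rep) (rel_ar \<sigma> ! r)"
      using val_in_univ[OF structure_model s] ok by (auto simp: tuples_def model_def)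
    have "ev (\<lambda>t. map t ?zs = map (val A (t \<circ> s)) us)"
      by (rule ev_map_val) (use ok ev_val_model[OF s] in auto)
    then have 1: "ev (\<lambda>t. map t ?zs \<in> rels A r) \<longleftrightarrow> ev (\<lambda>t. map (val A (t \<circ> s)) us \<in> rels A r)"
      by (rule ev_cong) (simp only:)
    have "xs \<in> rels model r \<longleftrightarrow> ev (\<lambda>t. map t xs \<in> rels A r)"
      if "xs \<in> tuples (range rep) (rel_ar \<sigma> ! r)" for xs using that by (simp add: model_def)
    from this[OF zs] show ?thesis unfolding Rel sat.simps sat_atom.simps 1 .
  qed
next
  case (Neg \<phi>)
  have "definable \<sigma> A {t \<in> assignments A. sat A (t \<circ> s) \<phi>}"
    using ex_rename[of \<sigma> \<phi> A s] Neg.prems(1) definable_sat[of \<sigma> _ A] by fastforce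
  then show ?case using Neg.IH[of s] Neg.prems ev_not[of "\<lambda>t. sat A (t \<circ> s) \<phi>"] by (simp add: comp_def)
next
  case (Conj \<phi> \<psi>)
  then show ?case using ev_conj by (simp add: comp_def)
next
  case (Ex x \<phi>)
  have ok: "fm_ok \<sigma> \<phi>" using Ex.prems by simp
  have comp: "t \<circ> s(x := z) = (t \<circ> s)(x := t z)" for t :: "nat \<Rightarrow> 'a" and z by auto
  show ?case
  proof
    assume "sat model s (Ex x \<phi>)"
    then obtain z where z: "z \<in> univ model" "sat model (s(x := z)) \<phi>" by auto
    have "ev (\<lambda>t. sat A (t \<circ> s(x := z)) \<phi>)"
      using Ex.IH[OF ok] assignments_upd[OF Ex.prems(2) z(1)] z(2) by blast
    then show "ev (\<lambda>t. sat A (t \<circ> s) (Ex x \<phi>))"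
      by (rule ev_mono) (auto simp: comp assignments_iff)
  next
    assume ev: "ev (\<lambda>t. sat A (t \<circ> s) (Ex x \<phi>))"
    \<comment> \<open>The predicate is read through \<open>s\<close>, whose values are variables
      again. A \<open>y\<close> that \<open>s\<close> does not use on \<open>\<phi>\<close> lets the
      quantified value vary without touching the other variables.\<close>
    obtain y where y: "y \<notin> s ` free_vars \<phi>"
      using ex_new_if_finite infinite_UNIV_nat finite_free_vars by (metis finite_imageI)
    define P where "P t = sat A (t \<circ> s(x := y)) \<phi>" for t
    have P_upd: "P (t(y := a)) = sat A ((t \<circ> s)(x := a)) \<phi>" for t a
      unfolding P_def by (rule sat_cong) (use y in auto)
    have "definable \<sigma> A {t \<in> assignments A. P t}"
      using ex_rename[OF ok, of A "s(x := y)"] definable_sat[of \<sigma> _ A] unfolding P_def by fastforce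
    moreover have "ev (\<lambda>t. \<exists>a \<in> univ A. P (t(y := a)))" using ev by (simp add: P_upd)
    ultimately obtain z where "ev (\<lambda>t. P (t(y := t z)))" using ev_witness by blast
    then have "ev (\<lambda>t. t (rep z) = t z \<and> sat A ((t \<circ> s)(x := t z)) \<phi>)"
      using ev_rep ev_conj by (simp add: P_upd)
    then have "ev (\<lambda>t. sat A (t \<circ> s(x := rep z)) \<phi>)" by (rule ev_mono) (simp add: comp)
    moreover have "rep z \<in> univ model" by (simp add: model_def)
    ultimately show "sat model s (Ex x \<phi>)"
      using Ex.IH[OF ok assignments_upd[OF Ex.prems(2)]] by (metis sat.simps(4))
  qed
qed

lemma model_theory: "is_model \<sigma> model (theory_of \<sigma> A)"
  unfolding is_model_def
proof (intro conjI ballI structure_model)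
  fix \<phi> s assume \<phi>: "\<phi> \<in> theory_of \<sigma> A" and s: "s \<in> assignments model"
  have "ev (\<lambda>t. sat A (t \<circ> s) \<phi>)"
    using \<phi> by (intro ev_all) (auto simp: theory_of_def assignments_iff)
  then show "sat model s \<phi>" using sat_model_iff \<phi> s by (simp add: theory_of_def sentence_def)
qed

text \<open>If the universe were finite, then, \<open>A\<close> being infinite, a witness distinct
  from all its members would exist eventually; yet the representative of that witness is one of
  these members.\<close>

lemma infinite_model: "infinite (univ model)"
proof
  assume fin: "finite (univ model)"
  then obtain x where x: "x \<notin> univ model" using ex_new_if_finite infinite_UNIV_nat by metis
  have "\<exists>y. ev (\<lambda>t. \<forall>d \<in> univ model. (t(x := t y)) x \<noteq> (t(x := t y)) d)"
  proof (rule ev_witness[OF definable_fresh[OF fin]], rule ev_all)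
    fix t assume "t \<in> assignments A"
    obtain a where "a \<in> univ A" "a \<notin> t ` univ model"
      using fin infinite_univ by (meson finite_imageI finite_subset subsetI)
    then show "\<exists>a \<in> univ A. \<forall>d \<in> univ model. (t(x := a)) x \<noteq> (t(x := a)) d"
      using x by (intro bexI[of _ a]) auto
  qed
  then obtain y where "ev (\<lambda>t. \<forall>d \<in> univ model. (t(x := t y)) x \<noteq> (t(x := t y)) d)" by blast
  then have y: "ev (\<lambda>t. \<forall>d \<in> univ model. t y \<noteq> t d)"
    by (rule ev_mono) (use x in \<open>metis fun_upd_apply\<close>)
  have "ev (\<lambda>t. (\<forall>d \<in> univ model. t y \<noteq> t d) \<and> t (rep y) = t y)" by (rule ev_conjI[OF y ev_rep])
  then have "ev (\<lambda>_. False)" by (rule ev_mono) (use univ_model_iff[of "rep y"] rep_rep in auto)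
  then show False by (simp add: ev_const)
qed

end

section \<open>Finitely many definable relations\<close>

text \<open>Rasiowa-Sikorski: \<open>P\<close> selects the conditions, and each of countably many
  requirements \<open>Q r\<close> can be met by shrinking a condition. Dependent choice handles the
  requirements along an enumeration.\<close>

lemma generic_sequence:
  assumes step: "\<And>r S. r \<in> R \<Longrightarrow> P S \<Longrightarrow> \<exists>S'. P S' \<and> S' \<subseteq> S \<and> Q r S'"
    and start: "P (S0 :: 'b set)" and "countable R"
  shows "\<exists>\<Theta>. (\<forall>i :: nat. P (\<Theta> i)) \<and> (\<forall>i. \<Theta> (Suc i) \<subseteq> \<Theta> i) \<and> (\<forall>r \<in> R. \<exists>i. Q r (\<Theta> i))"
proof (cases "R = {}")
  case True
  then show ?thesis using start by (intro exI[of _ "\<lambda>_. S0"]) simp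
next
  case False
  have R: "from_nat_into R ` UNIV = R" using range_from_nat_into[OF False \<open>countable R\<close>] by simp
  have "\<exists>f. \<forall>n. P (f n) \<and> (f (Suc n) \<subseteq> f n \<and> Q (from_nat_into R n) (f (Suc n)))"
    by (rule dependent_nat_choice) (use start step from_nat_into[OF False] in blast)+
  then obtain \<Theta> where \<Theta>: "\<forall>n. P (\<Theta> n) \<and> (\<Theta> (Suc n) \<subseteq> \<Theta> n \<and> Q (from_nat_into R n) (\<Theta> (Suc n)))" ..
  have "\<exists>i. Q r (\<Theta> i)" if r: "r \<in> R" for r
  proof -
    obtain i where "r = from_nat_into R i" using R r by blast
    then show ?thesis using \<Theta> by blast
  qed
  then show ?thesis using \<Theta> by (intro exI[of _ \<Theta>]) simp
qed

section \<open>Invariance of truth under isomorphism\<close>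

lemma isomorphism_assignments:
  assumes "isomorphism \<sigma> h A B" "s \<in> assignments A"
  shows "h \<circ> s \<in> assignments B"
  using assms by (auto simp: isomorphism_def assignments_iff bij_betw_def)

lemma isomorphism_val:
  assumes "isomorphism \<sigma> h A B" "is_structure \<sigma> A" "s \<in> assignments A" "trm_ok \<sigma> t"
  shows "h (val A s t) = val B (h \<circ> s) t"
  using assms(4)
proof (induction t)
  case (Var x)
  then show ?case by simp
next
  case (Fn f ts)
  have "map (val A s) ts \<in> tuples (univ A) (fun_ar \<sigma> ! f)"
    using Fn.prems val_in_univ[OF assms(2,3)] by (auto simp: tuples_def)
  then have "h (funs A f (map (val A s) ts)) = funs B f (map h (map (val A s) ts))"
    using assms(1) Fn.prems unfolding isomorphism_def by auto
  moreover have "map h (map (val A s) ts) = map (val B (h \<circ> s)) ts" using Fn by (auto simp: comp_def)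
  ultimately show ?case by (metis val.simps(2))
qed

lemma isomorphism_sat:
  assumes iso: "isomorphism \<sigma> h A B" and "is_structure \<sigma> A"
  shows "s \<in> assignments A \<Longrightarrow> fm_ok \<sigma> \<phi> \<Longrightarrow> sat A s \<phi> \<longleftrightarrow> sat B (h \<circ> s) \<phi>"
proof (induction \<phi> arbitrary: s)
  case (Atom \<alpha>)
  note val = isomorphism_val[OF assms Atom.prems(1)]
  show ?case
  proof (cases \<alpha>)
    case (Eq t u)
    have ok: "trm_ok \<sigma> t" "trm_ok \<sigma> u" using Atom.prems(2) Eq by auto
    have "val A s t \<in> univ A" "val A s u \<in> univ A" using ok val_in_univ[OF assms(2) Atom.prems(1)] by auto
    then have "val A s t = val A s u \<longleftrightarrow> h (val A s t) = h (val A s u)"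
      using iso unfolding isomorphism_def bij_betw_def by (metis inj_on_contraD)
    then show ?thesis using Eq val ok by (simp add: comp_def)
  next
    case (Rel r ts)
    have ok: "r < length (rel_ar \<sigma>)" "length ts = rel_ar \<sigma> ! r" "\<forall>t \<in> set ts. trm_ok \<sigma> t"
      using Atom.prems(2) Rel by auto
    have "map (val A s) ts \<in> tuples (univ A) (rel_ar \<sigma> ! r)"
      using ok val_in_univ[OF assms(2) Atom.prems(1)] by (auto simp: tuples_def)
    then have "map (val A s) ts \<in> rels A r \<longleftrightarrow> map h (map (val A s) ts) \<in> rels B r"
      using iso ok unfolding isomorphism_def by auto
    moreover have "map h (map (val A s) ts) = map (val B (h \<circ> s)) ts" using ok val by auto
    ultimately show ?thesis unfolding Rel by (metis sat.simps(1) sat_atom.simps(2))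
  qed
next
  case (Neg \<phi>)
  then show ?case by (simp add: comp_def)
next
  case (Conj \<phi> \<psi>)
  then show ?case by (simp add: comp_def)
next
  case (Ex x \<phi>)
  have comp: "h \<circ> s(x := a) = (h \<circ> s)(x := h a)" for a by auto
  have ok: "fm_ok \<sigma> \<phi>" using Ex.prems by simp
  have "univ B = h ` univ A" using iso by (auto simp: isomorphism_def bij_betw_def)
  moreover have "sat A (s(x := a)) \<phi> = sat B ((h \<circ> s)(x := h a)) \<phi>" if "a \<in> univ A" for a
    using Ex.IH[of "s(x := a)", OF assignments_upd[OF Ex.prems(1) that] ok] unfolding comp .
  ultimately have "(\<exists>a \<in> univ A. sat A (s(x := a)) \<phi>) \<longleftrightarrow> (\<exists>b \<in> univ B. sat B ((h \<circ> s)(x := b)) \<phi>)" by simp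
  then show ?case by (simp only: sat.simps)
qed

section \<open>Definable relations of bounded arity and their projections\<close>

lemma ndef_definable: "S \<in> ndef \<sigma> A n \<Longrightarrow> definable \<sigma> A S"
  by (simp add: ndef_def)

lemma ndef_cong:
  "S \<in> ndef \<sigma> A n \<Longrightarrow> t \<in> assignments A \<Longrightarrow> t' \<in> assignments A \<Longrightarrow> \<forall>i < n. t i = t' i \<Longrightarrow> t \<in> S \<longleftrightarrow> t' \<in> S"
  unfolding ndef_def by blast

lemma ndef_mono:
  assumes "S \<in> ndef \<sigma> A n" "n \<le> m"
  shows "S \<in> ndef \<sigma> A m"
proof (rule ndefI[OF ndef_definable[OF assms(1)]])
  fix t t' assume *: "t \<in> assignments A" "t' \<in> assignments A" "\<forall>i < m. t i = t' i"
  have "\<forall>i < n. t i = t' i" using *(3) assms(2) less_le_trans by blast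
  then show "t \<in> S \<longleftrightarrow> t' \<in> S" using ndef_cong[OF assms(1) *(1,2)] by blast
qed

lemma ndef_Int:
  assumes "S \<in> ndef \<sigma> A n" "T \<in> ndef \<sigma> A n"
  shows "S \<inter> T \<in> ndef \<sigma> A n"
proof (rule ndefI)
  show "definable \<sigma> A (S \<inter> T)" using assms by (intro definable_Int ndef_definable)
  fix t t' assume *: "t \<in> assignments A" "t' \<in> assignments A" "\<forall>i < n. t i = t' i"
  show "t \<in> S \<inter> T \<longleftrightarrow> t' \<in> S \<inter> T" using ndef_cong[OF assms(1) *] ndef_cong[OF assms(2) *] by blast
qed

lemma ndef_Diff:
  assumes "S \<in> ndef \<sigma> A n" "T \<in> ndef \<sigma> A n"
  shows "S - T \<in> ndef \<sigma> A n"
proof (rule ndefI)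
  show "definable \<sigma> A (S - T)" using assms by (intro definable_Diff ndef_definable)
  fix t t' assume *: "t \<in> assignments A" "t' \<in> assignments A" "\<forall>i < n. t i = t' i"
  show "t \<in> S - T \<longleftrightarrow> t' \<in> S - T" using ndef_cong[OF assms(1) *] ndef_cong[OF assms(2) *] by blast
qed

lemma definable_project_list:
  assumes "definable \<sigma> A S"
  shows "definable \<sigma> A {t \<in> assignments A. \<exists>t' \<in> S. \<forall>x. x \<notin> set xs \<longrightarrow> t' x = t x}"
proof (induction xs)
  case Nil
  have "{t \<in> assignments A. \<exists>t' \<in> S. \<forall>x. x \<notin> set [] \<longrightarrow> t' x = t x} = S"
    using definable_subset[OF assms] by (auto simp flip: fun_eq_iff)
  then show ?case using assms by simp
next
  case (Cons y ys)
  let ?T = "{t \<in> assignments A. \<exists>t' \<in> S. \<forall>x. x \<notin> set ys \<longrightarrow> t' x = t x}"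
  have S: "S \<subseteq> assignments A" by (rule definable_subset[OF assms])
  have "{t \<in> assignments A. \<exists>t' \<in> S. \<forall>x. x \<notin> set (y # ys) \<longrightarrow> t' x = t x} =
    {t \<in> assignments A. \<exists>a \<in> univ A. t(y := a) \<in> ?T}" (is "?L = ?R")
  proof
    show "?L \<subseteq> ?R"
    proof
      fix t assume "t \<in> ?L"
      then obtain t' where t: "t \<in> assignments A" "t' \<in> S" "\<forall>x. x \<notin> set (y # ys) \<longrightarrow> t' x = t x" by blast
      have a: "t' y \<in> univ A" using S t(2) by (auto simp: assignments_iff)
      have "t(y := t' y) \<in> ?T" using assignments_upd[OF t(1) a] t by auto
      then show "t \<in> ?R" using t(1) a by blast
    qed
    show "?R \<subseteq> ?L"
    proof
      fix t assume "t \<in> ?R"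
      then obtain a t' where t: "t \<in> assignments A" "t' \<in> S" "\<forall>x. x \<notin> set ys \<longrightarrow> t' x = (t(y := a)) x" by blast
      then have "\<forall>x. x \<notin> set (y # ys) \<longrightarrow> t' x = t x" by auto
      then show "t \<in> ?L" using t by blast
    qed
  qed
  then show ?case using definable_project[OF Cons.IH] by simp
qed

text \<open>Fixing only the first \<open>n\<close> coordinates seems to quantify over infinitely
  many variables. Since \<open>S\<close> ignores coordinates from \<open>N\<close> on, a solution
  may be reset to \<open>t\<close> there, and only the variables from \<open>n\<close> to
  \<open>N\<close> remain to be quantified.\<close>

lemma definable_project_cofinite:
  assumes "definable \<sigma> A S" and "n \<le> N"
    and N: "S \<in> ndef \<sigma> A N"
  shows "definable \<sigma> A {t \<in> assignments A. \<exists>t' \<in> S. \<forall>i < n. t' i = t i}"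
proof -
  have S: "S \<subseteq> assignments A" by (rule definable_subset[OF assms(1)])
  have "(\<exists>t' \<in> S. \<forall>i < n. t' i = t i) \<longleftrightarrow> (\<exists>t' \<in> S. \<forall>x. x \<notin> set [n..<N] \<longrightarrow> t' x = t x)"
    if t: "t \<in> assignments A" for t
  proof
    assume "\<exists>t' \<in> S. \<forall>i < n. t' i = t i"
    then obtain t' where t': "t' \<in> S" "\<forall>i < n. t' i = t i" by blast
    define u where "u i = (if i < N then t' i else t i)" for i
    have "t' \<in> assignments A" using S t'(1) by blast
    then have "u \<in> assignments A" using t by (auto simp: assignments_iff u_def)
    then have "u \<in> S" using ndef_cong[OF N, of u t'] t'(1) \<open>t' \<in> assignments A\<close> by (simp add: u_def)
    moreover have "\<forall>x. x \<notin> set [n..<N] \<longrightarrow> u x = t x" using t' by (auto simp: u_def)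
    ultimately show "\<exists>t' \<in> S. \<forall>x. x \<notin> set [n..<N] \<longrightarrow> t' x = t x" by blast
  next
    assume "\<exists>t' \<in> S. \<forall>x. x \<notin> set [n..<N] \<longrightarrow> t' x = t x"
    then obtain t' where "t' \<in> S" "\<forall>x. x \<notin> set [n..<N] \<longrightarrow> t' x = t x" by blast
    then show "\<exists>t' \<in> S. \<forall>i < n. t' i = t i" by (intro bexI[of _ t']) auto
  qed
  then have "{t \<in> assignments A. \<exists>t' \<in> S. \<forall>i < n. t' i = t i} =
    {t \<in> assignments A. \<exists>t' \<in> S. \<forall>x. x \<notin> set [n..<N] \<longrightarrow> t' x = t x}" by blast
  then show ?thesis using definable_project_list[OF assms(1), of "[n..<N]"] by simp
qed

lemma definable_projection:
  assumes "definable \<sigma> A S"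
  shows "definable \<sigma> A {t \<in> assignments A. \<exists>t' \<in> S. \<forall>i < n. t' i = t i}"
proof -
  obtain N where N: "S \<in> ndef \<sigma> A N" using definable_support[OF assms] by blast
  show ?thesis 
    by (rule definable_project_cofinite[OF assms, of n "max n N"]) (use N in \<open>auto intro: ndef_mono\<close>)
qed

lemma ndef_assignments: "assignments A \<in> ndef \<sigma> A n"
  by (simp add: ndef_def definable_assignments)

lemma ndef_projection:
  assumes "definable \<sigma> A S"
  shows "{t \<in> assignments A. \<exists>t' \<in> S. \<forall>i < n. t' i = t i} \<in> ndef \<sigma> A n"
proof (rule ndefI[OF definable_projection[OF assms]])
  fix t u assume *: "t \<in> assignments A" "u \<in> assignments A" "\<forall>i < n. t i = u i"
  have "(\<forall>i < n. f i = t i) \<longleftrightarrow> (\<forall>i < n. f i = u i)" for f using *(3) by metis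
  then show "t \<in> {t \<in> assignments A. \<exists>t' \<in> S. \<forall>i < n. t' i = t i} \<longleftrightarrow>
    u \<in> {t \<in> assignments A. \<exists>t' \<in> S. \<forall>i < n. t' i = t i}" using *(1,2) by blast
qed

text \<open>A set \<open>T\<close> is recovered from \<open>T \<inter> b\<close> and
  \<open>T - b\<close>, so two finite families of pieces would give only finitely many
  \<open>T\<close>.\<close>

lemma infinite_subsets_split:
  assumes "infinite {T \<in> ndef \<sigma> A n. T \<subseteq> S}" "S \<in> ndef \<sigma> A n" "b \<in> ndef \<sigma> A n"
  shows "infinite {T \<in> ndef \<sigma> A n. T \<subseteq> S \<inter> b} \<or> infinite {T \<in> ndef \<sigma> A n. T \<subseteq> S - b}"
proof (rule ccontr)
  assume "\<not> ?thesis"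
  then have "finite ((\<lambda>(U, V). U \<union> V) ` ({T \<in> ndef \<sigma> A n. T \<subseteq> S \<inter> b} \<times> {T \<in> ndef \<sigma> A n. T \<subseteq> S - b}))" by simp
  moreover have "{T \<in> ndef \<sigma> A n. T \<subseteq> S} \<subseteq>
    (\<lambda>(U, V). U \<union> V) ` ({T \<in> ndef \<sigma> A n. T \<subseteq> S \<inter> b} \<times> {T \<in> ndef \<sigma> A n. T \<subseteq> S - b})"
  proof
    fix T assume T: "T \<in> {T \<in> ndef \<sigma> A n. T \<subseteq> S}"
    then have "T \<inter> b \<in> ndef \<sigma> A n" "T - b \<in> ndef \<sigma> A n" using ndef_Int ndef_Diff assms(3) by blast+
    then show "T \<in> (\<lambda>(U, V). U \<union> V) ` ({T \<in> ndef \<sigma> A n. T \<subseteq> S \<inter> b} \<times> {T \<in> ndef \<sigma> A n. T \<subseteq> S - b})"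
      using T by (intro image_eqI[of _ _ "(T \<inter> b, T - b)"]) auto
  qed
  ultimately show False using assms(1) finite_subset by blast
qed

text \<open>Each member of \<open>ndef\<close> is decided in turn while keeping infinitely many
  definable subsets below the current set. The limit is a complete type that no nonempty definable
  set isolates.\<close>

lemma nonprincipal_sequence:
  assumes inf: "infinite (ndef \<sigma> A n)"
  shows "\<exists>\<pi> :: nat \<Rightarrow> _. (\<forall>k. \<pi> k \<in> ndef \<sigma> A n) \<and> (\<forall>k. \<pi> (Suc k) \<subseteq> \<pi> k) \<and> (\<forall>k. \<pi> k \<noteq> {}) \<and>
    (\<forall>S \<in> ndef \<sigma> A n. (\<forall>k. S \<subseteq> \<pi> k) \<longrightarrow> S = {})"
proof -
  let ?big = "\<lambda>S. infinite {T \<in> ndef \<sigma> A n. T \<subseteq> S}"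
  have 1: "\<exists>S'. (S' \<in> ndef \<sigma> A n \<and> ?big S') \<and> S' \<subseteq> S \<and> (S' \<subseteq> b \<or> S' \<inter> b = {})"
    if b: "b \<in> ndef \<sigma> A n" and S: "S \<in> ndef \<sigma> A n \<and> ?big S" for b S
  proof -
    have "?big (S \<inter> b) \<or> ?big (S - b)" using infinite_subsets_split S b by blast
    then show ?thesis
    proof
      assume "?big (S \<inter> b)"
      then show ?thesis using ndef_Int[of S \<sigma> A n b] S b by (intro exI[of _ "S \<inter> b"]) simp
    next
      assume "?big (S - b)"
      then show ?thesis using ndef_Diff[of S \<sigma> A n b] S b by (intro exI[of _ "S - b"]) auto
    qed
  qed
  have "{T \<in> ndef \<sigma> A n. T \<subseteq> assignments A} = ndef \<sigma> A n"
    using definable_subset[OF ndef_definable] by blast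
  then have 2: "assignments A \<in> ndef \<sigma> A n \<and> ?big (assignments A)"
    using ndef_assignments inf by metis
  have 3: "countable (ndef \<sigma> A n)"
    by (rule countable_subset[OF _ countable_definable[of \<sigma> A]]) (auto simp: ndef_def)
  have "\<exists>\<pi>. (\<forall>i :: nat. \<pi> i \<in> ndef \<sigma> A n \<and> ?big (\<pi> i)) \<and> (\<forall>i. \<pi> (Suc i) \<subseteq> \<pi> i) \<and>
    (\<forall>b \<in> ndef \<sigma> A n. \<exists>i. \<pi> i \<subseteq> b \<or> \<pi> i \<inter> b = {})"
    by (rule generic_sequence[of "ndef \<sigma> A n" "\<lambda>S. S \<in> ndef \<sigma> A n \<and> ?big S"]) (fact 1, fact 2, fact 3)
  then obtain \<pi> where \<pi>: "\<forall>i :: nat. \<pi> i \<in> ndef \<sigma> A n \<and> ?big (\<pi> i)" "\<forall>i. \<pi> (Suc i) \<subseteq> \<pi> i"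
    "\<forall>b \<in> ndef \<sigma> A n. \<exists>i. \<pi> i \<subseteq> b \<or> \<pi> i \<inter> b = {}"
    by (elim exE conjE) (rule that)
  show ?thesis
  proof (intro exI[of _ \<pi>] conjI ballI allI impI)
    show "\<pi> k \<noteq> {}" for k
    proof
      assume "\<pi> k = {}"
      then have "{T \<in> ndef \<sigma> A n. T \<subseteq> \<pi> k} \<subseteq> {{}}" by auto
      moreover have "?big (\<pi> k)" using \<pi>(1) by blast
      ultimately show False using finite_subset by blast
    qed
  next
    fix S assume S: "S \<in> ndef \<sigma> A n" "\<forall>k. S \<subseteq> \<pi> k"
    show "S = {}"
    proof (rule ccontr)
      assume "S \<noteq> {}"
      have "\<exists>i. \<pi> i \<subseteq> S \<or> \<pi> i \<inter> S = {}" using \<pi>(3) S(1) by blast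
      then obtain i where i: "\<pi> i \<subseteq> S" using S(2) \<open>S \<noteq> {}\<close> by blast
      \<comment> \<open>A nonempty \<open>S\<close> below the whole sequence is an atom of the
        algebra, because the sequence decides each of its subsets. As some \<open>\<pi> i\<close>
        lies inside \<open>S\<close>, that \<open>\<pi> i\<close> would have at most two definable
        subsets.\<close>
      have "T = {} \<or> T = S" if T: "T \<in> ndef \<sigma> A n" "T \<subseteq> S" for T
      proof -
        obtain j where "\<pi> j \<subseteq> T \<or> \<pi> j \<inter> T = {}" using \<pi>(3) T(1) by blast
        moreover have "S \<subseteq> \<pi> j" using S(2) by blast
        ultimately show ?thesis using T(2) by blast
      qed
      then have "{T \<in> ndef \<sigma> A n. T \<subseteq> \<pi> i} \<subseteq> {{}, S}" using i by blast
      moreover have "?big (\<pi> i)" using \<pi>(1) by blast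
      ultimately show False by (meson finite.emptyI finite_insert finite_subset)
    qed
  qed (use \<pi> in auto)
qed

text \<open>
  Conditions of the Henkin construction are definable sets meeting every \<open>\<rho> k\<close>. A constant
  sequence \<open>\<rho>\<close> imposes nothing; for \<open>\<rho> = \<pi>\<close> the generic model realises the type \<open>\<pi>\<close>.
\<close>

lemma henkin_sequence:
  fixes \<rho> :: "nat \<Rightarrow> (nat \<Rightarrow> 'a) set"
  assumes struct: "is_structure \<sigma> A" and inf: "infinite (univ A)"
    and \<rho>: "\<And>k. \<rho> k \<in> ndef \<sigma> A n" "\<And>k. \<rho> (Suc k) \<subseteq> \<rho> k" "\<And>k. \<rho> k \<noteq> {}"
    and R: "countable R"
      "\<And>r S. r \<in> R \<Longrightarrow> definable \<sigma> A S \<Longrightarrow> (\<And>k. S \<inter> \<rho> k \<noteq> {}) \<Longrightarrow>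
        \<exists>S'. definable \<sigma> A S' \<and> (\<forall>k. S' \<inter> \<rho> k \<noteq> {}) \<and> S' \<subseteq> S \<and> Q r S'"
  shows "\<exists>\<Theta>. henkin \<sigma> A \<Theta> \<and> (\<forall>i k. \<Theta> i \<inter> \<rho> k \<noteq> {}) \<and> (\<forall>r \<in> R. \<exists>i. Q r (\<Theta> i))"
proof -
  let ?P = "\<lambda>S. definable \<sigma> A S \<and> (\<forall>k. S \<inter> \<rho> k \<noteq> {})"
  let ?D = "{S. definable \<sigma> A S}"
  \<comment> \<open>Three kinds of requirements share one enumeration: deciding a definable set,
    providing a witness for an existential statement, and the requirements handed in by
    \<open>R\<close>.\<close>
  let ?R = "Inl ` ?D \<union> Inr ` (Inl ` (?D \<times> (UNIV :: nat set)) \<union> Inr ` R)"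
  let ?Q = "\<lambda>r S. case r of Inl T \<Rightarrow> S \<subseteq> T \<or> S \<inter> T = {}
    | Inr (Inl (T, x)) \<Rightarrow> S \<inter> {t \<in> assignments A. \<exists>a \<in> univ A. t(x := a) \<in> T} = {} \<or>
        (\<exists>y. S \<subseteq> {t. t(x := t y) \<in> T})
    | Inr (Inr r) \<Rightarrow> Q r S"
  have mono: "\<rho> k' \<subseteq> \<rho> k" if "k \<le> k'" for k k'
    by (rule decseq_subset[of \<rho>, OF _ that]) (rule \<rho>(2))
  have sub: "\<rho> k \<subseteq> assignments A" for k using \<rho>(1)[of k] definable_subset by (auto simp: ndef_def)
  \<comment> \<open>If \<open>S \<inter> T\<close> misses one \<open>\<rho> k\<close>, it misses all
    later ones, so \<open>S - T\<close> meets the later ones and, by monotonicity, all of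
    them.\<close>
  have decide: "\<exists>S'. ?P S' \<and> S' \<subseteq> S \<and> (S' \<subseteq> T \<or> S' \<inter> T = {})" if S: "?P S" and T: "definable \<sigma> A T" for S T
  proof (cases "\<forall>k. (S \<inter> T) \<inter> \<rho> k \<noteq> {}")
    case True
    then show ?thesis using S T definable_Int by (intro exI[of _ "S \<inter> T"]) auto
  next
    case False
    then obtain k where k: "(S \<inter> T) \<inter> \<rho> k = {}" by blast
    have "(S - T) \<inter> \<rho> k' \<noteq> {}" for k'
    proof -
      obtain t where "t \<in> S \<inter> \<rho> (max k k')" using S by blast
      then have "t \<in> (S - T) \<inter> \<rho> k'" using k mono[of k "max k k'"] mono[of k' "max k k'"] by auto
      then show ?thesis by blast
    qed
    then show ?thesis using S T definable_Diff by (intro exI[of _ "S - T"]) auto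
  qed
  have 1: "\<exists>S'. ?P S' \<and> S' \<subseteq> S \<and> ?Q r S'" if r: "r \<in> ?R" and S: "?P S" for r S
  proof -
    consider T where "r = Inl T" "definable \<sigma> A T" | T x where "r = Inr (Inl (T, x))" "definable \<sigma> A T"
      | q where "r = Inr (Inr q)" "q \<in> R" using r by blast
    then show ?thesis
    proof cases
      case 1
      then show ?thesis using decide[OF S] by simp
    next
      case 2
      let ?T = "{t \<in> assignments A. \<exists>a \<in> univ A. t(x := a) \<in> T}"
      obtain S1 where S1: "?P S1" "S1 \<subseteq> S" "S1 \<subseteq> ?T \<or> S1 \<inter> ?T = {}"
        using decide[OF S definable_project[OF 2(2), of x]] by blast
      show ?thesis
      proof (cases "S1 \<subseteq> ?T")
        case True
        obtain N where N: "S1 \<in> ndef \<sigma> A N" using definable_support[OF conjunct1[OF S1(1)]] by blast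
        obtain M where M: "T \<in> ndef \<sigma> A M" using definable_support[OF 2(2)] by blast
        \<comment> \<open>Beyond the supports of \<open>S1\<close>, \<open>T\<close> and every
          \<open>\<rho> k\<close>, and different from \<open>x\<close>: giving \<open>y\<close> the
          value of the witness changes none of these memberships.\<close>
        define y where "y = max (max N M) (max n (Suc x))"
        have y: "N \<le> y" "M \<le> y" "n \<le> y" "x < y" by (simp_all add: y_def)
        define S' where "S' = S1 \<inter> {t \<in> assignments A. t \<circ> id(x := y) \<in> T}"
        have ren: "t \<circ> id(x := y) = t(x := t y)" for t :: "nat \<Rightarrow> 'a" by auto
        have "definable \<sigma> A S'"
          unfolding S'_def by (rule definable_Int[OF _ definable_rename[OF 2(2)]]) (use S1(1) in blast)
        moreover have "S' \<inter> \<rho> k \<noteq> {}" for k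
        proof -
          obtain t where t: "t \<in> S1" "t \<in> \<rho> k" using S1(1) by blast
          then obtain a where a: "a \<in> univ A" "t(x := a) \<in> T" using True by blast
          have tA: "t \<in> assignments A" using t(2) sub by blast
          let ?t = "t(y := a)"
          have tA': "?t \<in> assignments A" using tA a(1) by (rule assignments_upd)
          have "?t \<in> S1" using ndef_cong[OF N tA' tA] t(1) y(1) by simp
          moreover have "?t \<in> \<rho> k"
          proof -
            have "\<forall>i < n. ?t i = t i" using y(3) by simp
            then show ?thesis using ndef_cong[OF \<rho>(1)[of k] tA' tA] t(2) by blast
          qed
          moreover have "?t(x := a) \<in> T"
            using ndef_cong[OF M assignments_upd[OF tA' a(1), of x] assignments_upd[OF tA a(1), of x]] a(2) y(2) by simp
          ultimately have "?t \<in> S' \<inter> \<rho> k" using tA' by (simp add: S'_def ren)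
          then show ?thesis by blast
        qed
        moreover have "S' \<subseteq> {t. t(x := t y) \<in> T}" unfolding S'_def ren by blast
        moreover have "S' \<subseteq> S" using S1(2) by (auto simp: S'_def)
        ultimately show ?thesis using 2(1) by (intro exI[of _ S']) auto
      next
        case False
        then show ?thesis using S1 2(1) by (intro exI[of _ S1]) auto
      qed
    next
      case 3
      then show ?thesis using R(2)[of q S] S by auto
    qed
  qed
  have 2: "?P (assignments A)" using definable_assignments \<rho>(3) sub by (metis inf.absorb_iff2)
  have 3: "countable ?R" using countable_definable[of \<sigma> A] R(1) by simp
  have "\<exists>\<Theta>. (\<forall>i :: nat. ?P (\<Theta> i)) \<and> (\<forall>i. \<Theta> (Suc i) \<subseteq> \<Theta> i) \<and> (\<forall>r \<in> ?R. \<exists>i. ?Q r (\<Theta> i))"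
    by (rule generic_sequence[of ?R ?P ?Q]) (fact 1, fact 2, fact 3)
  then obtain \<Theta>
    where P: "\<forall>i :: nat. ?P (\<Theta> i)" and dec: "\<forall>i. \<Theta> (Suc i) \<subseteq> \<Theta> i" and Q: "\<forall>r \<in> ?R. \<exists>i. ?Q r (\<Theta> i)"
    by (elim exE conjE) (rule that)
  have anti: "\<Theta> j \<subseteq> \<Theta> i" if "i \<le> j" for i j
    by (rule decseq_subset[OF _ that]) (use dec in blast)
  have "henkin \<sigma> A \<Theta>"
  proof
    fix S assume S: "definable \<sigma> A S"
    have "\<exists>i. ?Q (Inl S) (\<Theta> i)" by (rule bspec[OF Q]) (use S in auto)
    then show "\<exists>i. \<Theta> i \<subseteq> S \<or> \<Theta> i \<inter> S = {}" by simp
  next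
    fix S x i assume S: "definable \<sigma> A S" "\<Theta> i \<subseteq> {t. \<exists>a \<in> univ A. t(x := a) \<in> S}"
    have "\<exists>j. ?Q (Inr (Inl (S, x))) (\<Theta> j)" by (rule bspec[OF Q]) (use S in auto)
    then obtain j where j: "\<Theta> j \<inter> {t \<in> assignments A. \<exists>a \<in> univ A. t(x := a) \<in> S} = {} \<or>
        (\<exists>y. \<Theta> j \<subseteq> {t. t(x := t y) \<in> S})" by auto
    have "?P (\<Theta> (max i j))" using P by blast
    then obtain t where "t \<in> \<Theta> (max i j)" "t \<in> assignments A" using definable_subset by blast
    then have "t \<in> \<Theta> i" "t \<in> \<Theta> j" "t \<in> assignments A"
      using anti[of i "max i j"] anti[of j "max i j"] by auto
    then have "\<Theta> j \<inter> {t \<in> assignments A. \<exists>a \<in> univ A. t(x := a) \<in> S} \<noteq> {}" using S(2) by blast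
    then show "\<exists>y j. \<Theta> j \<subseteq> {t. t(x := t y) \<in> S}" using j by blast
  next
    show "\<Theta> i \<noteq> {}" for i using P by blast
    show "\<Theta> i \<subseteq> assignments A" for i using P definable_subset by blast
    show "\<Theta> (Suc i) \<subseteq> \<Theta> i" for i using dec by blast
  qed (use struct inf in auto)
  moreover have "\<forall>i k. \<Theta> i \<inter> \<rho> k \<noteq> {}" using P by blast
  moreover have "\<exists>i. Q r (\<Theta> i)" if "r \<in> R" for r
  proof -
    have "\<exists>i. ?Q (Inr (Inr r)) (\<Theta> i)" by (rule bspec[OF Q]) (use that in auto)
    then show ?thesis by simp
  qed
  ultimately show ?thesis by blast
qed

text \<open>In the model from \<open>\<Theta>\<close>, whose members meet every
  \<open>\<pi> k\<close>, the variables below \<open>n\<close> realise the type. In the model from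
  \<open>\<Xi>\<close> one requirement per list \<open>ys\<close> keeps the variables
  \<open>ys\<close> out of some \<open>\<pi> k\<close>. An isomorphism would carry the realisation
  into the omitting model.\<close>

lemma omega_categorical_finite_ndef:
  fixes A :: "'a struct"
  assumes struct: "is_structure \<sigma> A" and cat: "omega_categorical \<sigma> A" and inf: "infinite (univ A)"
  shows "finite (ndef \<sigma> A n)"
proof (rule ccontr)
  assume "infinite (ndef \<sigma> A n)"
  from nonprincipal_sequence[OF this] obtain \<pi> where \<pi>': "\<forall>k :: nat. \<pi> k \<in> ndef \<sigma> A n"
    "\<forall>k. \<pi> (Suc k) \<subseteq> \<pi> k" "\<forall>k. \<pi> k \<noteq> {}" "\<forall>S \<in> ndef \<sigma> A n. (\<forall>k. S \<subseteq> \<pi> k) \<longrightarrow> S = {}"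
    by (elim exE conjE) (rule that)
  note \<pi> = \<pi>'[rule_format]
  have "\<exists>\<phi>. fm_ok \<sigma> \<phi> \<and> \<pi> k = {t \<in> assignments A. sat A t \<phi>}" for k
    using \<pi>(1)[of k] by (simp add: ndef_def definable_def)
  then obtain p where p: "\<And>k. fm_ok \<sigma> (p k)" "\<And>k. \<pi> k = {t \<in> assignments A. sat A t (p k)}" by metis
  have "\<exists>\<Theta>. henkin \<sigma> A \<Theta> \<and> (\<forall>i k. \<Theta> i \<inter> \<pi> k \<noteq> {}) \<and> (\<forall>r \<in> {} :: unit set. \<exists>i :: nat. True)"
    by (rule henkin_sequence[where n = n and \<rho> = \<pi> and Q = "\<lambda>_ _. True"]) (use struct inf \<pi> in simp_all)
  then obtain \<Theta> where \<Theta>: "henkin \<sigma> A \<Theta>" "\<forall>i k. \<Theta> i \<inter> \<pi> k \<noteq> {}" by blast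
  have ne: "assignments A \<noteq> {}" using \<pi>(3) p(2) by blast
  have omit: "\<exists>S'. definable \<sigma> A S' \<and> (\<forall>k :: nat. S' \<inter> assignments A \<noteq> {}) \<and> S' \<subseteq> S \<and>
      (\<exists>k. \<forall>t \<in> S'. \<forall>t' \<in> \<pi> k. \<exists>i < n. t' i \<noteq> t (ys ! i))"
    if S: "definable \<sigma> A S" "\<And>k :: nat. S \<inter> assignments A \<noteq> {}" for S and ys :: "nat list"
  proof -
    text \<open>\<open>V\<close> is the set of values that the variables \<open>ys\<close> take on \<open>S\<close>, moved to the variables below \<open>n\<close>.\<close>
    define c where "c i = (if i < n then ys ! i else i)" for i
    obtain N where N: "S \<in> ndef \<sigma> A N" using definable_support[OF S(1)] by blast
    \<comment> \<open>The copy of \<open>S\<close> lives on the variables from \<open>n\<close> on.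
      This frees the variables below \<open>n\<close> to record the values of
      \<open>ys\<close>.\<close>
    define W where "W = {t \<in> assignments A. t \<circ> (\<lambda>i. n + i) \<in> S} \<inter>
      {t \<in> assignments A. \<forall>i < n. t i = t (n + ys ! i)}"
    define V where "V = {t \<in> assignments A. \<exists>t' \<in> W. \<forall>i < n. t' i = t i}"
    have "definable \<sigma> A {t \<in> assignments A. \<forall>i < m. t i = t (n + ys ! i)}" for m
    proof (induction m)
      case 0
      then show ?case using definable_assignments by simp
    next
      case (Suc m)
      have "{t \<in> assignments A. \<forall>i < Suc m. t i = t (n + ys ! i)} =
        {t \<in> assignments A. \<forall>i < m. t i = t (n + ys ! i)} \<inter> {t \<in> assignments A. t m = t (n + ys ! m)}"
        by (auto simp: less_Suc_eq)
      then show ?case using definable_Int[OF Suc.IH definable_eq_var] by simp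
    qed
    then have "definable \<sigma> A W" unfolding W_def by (intro definable_Int definable_rename S(1))
    then have V: "V \<in> ndef \<sigma> A n" unfolding V_def by (rule ndef_projection)
    have inV: "(\<lambda>i. if i < n then t (ys ! i) else t (i - n)) \<in> V" if t: "t \<in> S" for t
    proof -
      let ?u = "\<lambda>i. if i < n then t (ys ! i) else t (i - n)"
      have "?u \<in> assignments A" using t definable_subset[OF S(1)] by (auto simp: assignments_iff)
      moreover have "?u \<circ> (\<lambda>i. n + i) = t" by auto
      ultimately have "?u \<in> W" using t by (auto simp: W_def)
      then show ?thesis using \<open>?u \<in> assignments A\<close> unfolding V_def
        by (intro CollectI conjI bexI[of _ ?u] allI impI refl)
    qed
    obtain t0 where "t0 \<in> S" using S(2) by blast
    from inV[OF this] have "V \<noteq> {}" by (metis empty_iff)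
    \<comment> \<open>Nonprincipality enters here: the nonempty \<open>n\<close>-ary set
      \<open>V\<close> cannot lie below all \<open>\<pi> k\<close>. The tuple \<open>v\<close>
      outside \<open>\<pi> k\<close> shows that \<open>S\<close> survives the removal of the
      assignments whose values at \<open>ys\<close> lie in \<open>\<pi> k\<close>.\<close>
    then have "\<exists>k. \<not> V \<subseteq> \<pi> k" using \<pi>(4)[OF V] by metis
    then obtain k v where v: "v \<in> V" "v \<notin> \<pi> k" by (elim exE) (metis subsetI)
    define S' where "S' = S - {t \<in> assignments A. t \<circ> c \<in> \<pi> k}"
    have \<pi>k: "t \<in> \<pi> k \<longleftrightarrow> t' \<in> \<pi> k" if "t \<in> assignments A" "t' \<in> assignments A" "\<forall>i < n. t i = t' i" for t t'
      by (rule ndef_cong[OF \<pi>(1)[of k]]) (use that in auto)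
    have "definable \<sigma> A S'" unfolding S'_def
      by (intro definable_Diff S(1) definable_rename) (use \<pi>(1)[of k] in \<open>simp add: ndef_def\<close>)
    moreover have "S' \<inter> assignments A \<noteq> {}"
    proof -
      obtain w where w: "w \<in> assignments A" "w \<circ> (\<lambda>i. n + i) \<in> S" "\<forall>i < n. w i = w (n + ys ! i)" "\<forall>i < n. w i = v i"
        using v(1) unfolding V_def W_def by blast
      let ?t = "w \<circ> (\<lambda>i. n + i)"
      have t: "?t \<in> assignments A" using w(1) by (auto simp: assignments_iff)
      then have tc: "?t \<circ> c \<in> assignments A" by (auto simp: assignments_iff)
      have vA: "v \<in> assignments A" using v(1) by (auto simp: V_def)
      have tv: "\<forall>i < n. (?t \<circ> c) i = v i"
      proof (intro allI impI)
        fix i assume "i < n"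
        then have "w (n + ys ! i) = v i" using w(3)[rule_format, of i] w(4)[rule_format, of i] by metis
        then show "(?t \<circ> c) i = v i" using \<open>i < n\<close> by (simp add: c_def)
      qed
      have "?t \<circ> c \<notin> \<pi> k" using \<pi>k[OF tc vA tv] v(2) by blast
      then have "?t \<in> S'" using w(2) unfolding S'_def by blast
      then show ?thesis using t by blast
    qed
    moreover have "\<exists>i < n. t' i \<noteq> t (ys ! i)" if t: "t \<in> S'" "t' \<in> \<pi> k" for t t'
    proof (rule ccontr)
      assume "\<not> ?thesis"
      then have eq: "\<forall>i < n. t' i = (t \<circ> c) i" by (simp add: c_def)
      have tA: "t \<in> assignments A" using t(1) definable_subset[OF S(1)] by (auto simp: S'_def)
      then have tc: "t \<circ> c \<in> assignments A" by (auto simp: assignments_iff)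
      have "t' \<in> assignments A" using t(2) p(2) by blast
      then have "t \<circ> c \<in> \<pi> k" using \<pi>k[OF _ tc eq] t(2) by blast
      then show False using t(1) tA by (auto simp: S'_def)
    qed
    moreover have "S' \<subseteq> S" by (auto simp: S'_def)
    ultimately show ?thesis by blast
  qed
  have "\<exists>\<Xi>. henkin \<sigma> A \<Xi> \<and> (\<forall>i. \<forall>k :: nat. \<Xi> i \<inter> assignments A \<noteq> {}) \<and>
    (\<forall>ys \<in> (UNIV :: nat list set). \<exists>j. \<exists>k. \<forall>t \<in> \<Xi> j. \<forall>t' \<in> \<pi> k. \<exists>i < n. t' i \<noteq> t (ys ! i))"
    by (rule henkin_sequence[where n = n and \<rho> = "\<lambda>_. assignments A" and R = UNIV
        and Q = "\<lambda>ys S. \<exists>k. \<forall>t \<in> S. \<forall>t' \<in> \<pi> k. \<exists>i < n. t' i \<noteq> t (ys ! i)"])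
      (use struct inf ndef_assignments ne omit in simp_all)
  then obtain \<Xi> where \<Xi>: "henkin \<sigma> A \<Xi>"
    "\<forall>ys :: nat list. \<exists>j. \<exists>k. \<forall>t \<in> \<Xi> j. \<forall>t' \<in> \<pi> k. \<exists>i < n. t' i \<noteq> t (ys ! i)" by blast
  interpret M: henkin \<sigma> A \<Theta> by fact
  interpret N: henkin \<sigma> A \<Xi> by fact
  obtain h where h: "isomorphism \<sigma> h M.model N.model"
    using cat M.model_theory M.infinite_model N.model_theory N.infinite_model unfolding omega_categorical_def by blast
  have M: "M.rep \<in> assignments M.model" by (auto simp: assignments_iff M.model_def)
  have N: "h \<circ> M.rep \<in> assignments N.model" using isomorphism_assignments[OF h M] .
  have real: "sat M.model M.rep (p k)" for k
  proof -
    have "\<exists>i. \<Theta> i \<subseteq> \<pi> k \<or> \<Theta> i \<inter> \<pi> k = {}" using M.decide \<pi>(1)[of k] by (simp add: ndef_def)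
    then obtain i where i: "\<Theta> i \<subseteq> \<pi> k" using \<Theta>(2) by blast
    have "M.ev (\<lambda>t. t \<in> \<pi> k)" unfolding M.ev_def using i by blast
    moreover have "M.ev (\<lambda>t. \<forall>x \<in> set [0..<n]. t (M.rep x) = t x)" by (rule M.ev_Ball) (rule M.ev_rep)
    ultimately have "M.ev (\<lambda>t. t \<in> \<pi> k \<and> (\<forall>x \<in> set [0..<n]. t (M.rep x) = t x))" by (rule M.ev_conjI)
    then have "M.ev (\<lambda>t. sat A (t \<circ> M.rep) (p k))"
    proof (rule M.ev_mono)
      fix t assume t: "t \<in> assignments A" "t \<in> \<pi> k \<and> (\<forall>x \<in> set [0..<n]. t (M.rep x) = t x)"
      have "t \<circ> M.rep \<in> assignments A" using t(1) by (simp add: assignments_iff)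
      moreover have "\<forall>i < n. t i = (t \<circ> M.rep) i" using t(2) by simp
      ultimately have "t \<circ> M.rep \<in> \<pi> k" using ndef_cong[OF \<pi>(1)[of k] t(1)] t(2) by blast
      then show "sat A (t \<circ> M.rep) (p k)" using p(2) by blast
    qed
    then show ?thesis using M.sat_model_iff[OF p(1) M] by blast
  qed
  let ?s = "h \<circ> M.rep"
  \<comment> \<open>The images under \<open>h\<close> of the realising elements are variables of the
    second model, so omitting the type at this list was one of the requirements.\<close>
  obtain j k where jk: "\<forall>t \<in> \<Xi> j. \<forall>t' \<in> \<pi> k. \<exists>i < n. t' i \<noteq> t (map ?s [0..<n] ! i)"
    using \<Xi>(2) by blast
  have "sat N.model ?s (p k)" using isomorphism_sat[OF h M.structure_model M p(1)] real by blast
  then have "N.ev (\<lambda>t. sat A (t \<circ> ?s) (p k))" using N.sat_model_iff[OF p(1) N] by blast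
  moreover have "N.ev (\<lambda>t. \<forall>t' \<in> \<pi> k. \<exists>i < n. t' i \<noteq> t (?s i))" unfolding N.ev_def using jk by (intro exI[of _ j]) fastforce
  ultimately have "N.ev (\<lambda>t. sat A (t \<circ> ?s) (p k) \<and> (\<forall>t' \<in> \<pi> k. \<exists>i < n. t' i \<noteq> t (?s i)))" by (rule N.ev_conjI)
  then have "N.ev (\<lambda>_. False)"
  proof (rule N.ev_mono)
    fix t assume t: "t \<in> assignments A" "sat A (t \<circ> ?s) (p k) \<and> (\<forall>t' \<in> \<pi> k. \<exists>i < n. t' i \<noteq> t (?s i))"
    then have "t \<circ> ?s \<in> \<pi> k" using p(2) by (auto simp: assignments_iff)
    then show False using t(2) by auto
  qed
  then show False using N.ev_const by blast
qed

section \<open>Primitive positive relations\<close>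

definition sats :: "'a struct \<Rightarrow> atom list \<Rightarrow> (nat \<Rightarrow> 'a) \<Rightarrow> bool" where
  "sats A \<alpha>s s \<longleftrightarrow> (\<forall>\<alpha> \<in> set \<alpha>s. sat_atom A s \<alpha>)"

lemma sats_simps [simp]:
  "sats A [] s" "sats A (\<alpha> # \<alpha>s) s \<longleftrightarrow> sat_atom A s \<alpha> \<and> sats A \<alpha>s s"
  "sats A (\<alpha>s @ \<beta>s) s \<longleftrightarrow> sats A \<alpha>s s \<and> sats A \<beta>s s"
  by (auto simp: sats_def)

lemma satisfiable_in_iff: "satisfiable_in A \<alpha>s \<longleftrightarrow> (\<exists>s \<in> assignments A. sats A \<alpha>s s)"
  by (simp add: satisfiable_in_def sats_def)

section \<open>Evaluation in the expansions\<close>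

lemma ar_neq_sig [simp]: "fun_ar (neq_sig \<sigma>) = fun_ar \<sigma>" "rel_ar (neq_sig \<sigma>) = rel_ar \<sigma> @ [2]"
  by (simp_all add: neq_sig_def)

lemma ar_const_sig [simp]:
  "fun_ar (const_sig \<sigma> m) = fun_ar \<sigma> @ replicate m 0" "rel_ar (const_sig \<sigma> m) = rel_ar \<sigma>"
  by (simp_all add: const_sig_def)

lemma trm_ok_neq_sig [simp]: "trm_ok (neq_sig \<sigma>) t = trm_ok \<sigma> t"
  by (induction t) auto

lemma univ_neq_expansion [simp]: "univ (neq_expansion \<sigma> A) = univ A"
  by (simp add: neq_expansion_def)

lemma assignments_neq_expansion [simp]: "assignments (neq_expansion \<sigma> A) = assignments A"
  by (simp add: assignments_def)

lemma funs_neq_expansion [simp]: "funs (neq_expansion \<sigma> A) = funs A"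
  by (simp add: neq_expansion_def)

lemma val_neq_expansion [simp]: "val (neq_expansion \<sigma> A) s t = val A s t"
proof (induction t)
  case (Fn f ts)
  then have "map (val (neq_expansion \<sigma> A) s) ts = map (val A s) ts" by simp
  then show ?case by (simp only: val.simps funs_neq_expansion)
qed simp

lemma univ_const_expansion [simp]: "univ (const_expansion \<sigma> A as) = univ A"
  by (simp add: const_expansion_def)

lemma assignments_const_expansion [simp]: "assignments (const_expansion \<sigma> A as) = assignments A"
  by (simp add: assignments_def)

lemma rels_neq_expansion:
  "rels (neq_expansion \<sigma> A) r = (if r = length (rel_ar \<sigma>) then {[a, b] | a b. a \<in> univ A \<and> b \<in> univ A \<and> a \<noteq> b} else rels A r)"
  by (simp add: neq_expansion_def)

lemma atom_ok_neq_sig_cases: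
  assumes "atom_ok (neq_sig \<sigma>) \<alpha>"
  obtains (pos) "atom_ok \<sigma> \<alpha>" | (neq) u v where "\<alpha> = Rel (length (rel_ar \<sigma>)) [u, v]" "trm_ok \<sigma> u" "trm_ok \<sigma> v"
proof (cases \<alpha>)
  case (Eq u v)
  then show ?thesis using assms pos by simp
next
  case (Rel r ts)
  show ?thesis
  proof (cases "r < length (rel_ar \<sigma>)")
    case True
    then show ?thesis using assms pos Rel by (simp add: nth_append)
  next
    case False
    then have r: "r = length (rel_ar \<sigma>)" "length ts = 2" using assms Rel by (auto simp: nth_append)
    then obtain u v where "ts = [u, v]" by (auto simp: numeral_2_eq_2 length_Suc_conv)
    then show ?thesis using neq r Rel assms by simp
  qed
qed

lemma sat_atom_pos:
  "atom_ok \<sigma> \<alpha> \<Longrightarrow> sat_atom (neq_expansion \<sigma> A) s \<alpha> = sat_atom A s \<alpha>"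
  by (cases \<alpha>) (auto simp: rels_neq_expansion cong: map_cong)

lemma sats_pos:
  "csp_instance \<sigma> \<alpha>s \<Longrightarrow> sats (neq_expansion \<sigma> A) \<alpha>s s = sats A \<alpha>s s"
  by (simp add: sats_def csp_instance_def sat_atom_pos)

lemma sat_atom_neq:
  "is_structure \<sigma> A \<Longrightarrow> s \<in> assignments A \<Longrightarrow> trm_ok \<sigma> u \<Longrightarrow> trm_ok \<sigma> v \<Longrightarrow>
    sat_atom (neq_expansion \<sigma> A) s (Rel (length (rel_ar \<sigma>)) [u, v]) \<longleftrightarrow> val A s u \<noteq> val A s v"
  by (auto simp: rels_neq_expansion val_in_univ)

lemma atom_ok_neq_sig: "atom_ok \<sigma> \<alpha> \<Longrightarrow> atom_ok (neq_sig \<sigma>) \<alpha>"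
  by (cases \<alpha>) (auto simp: nth_append)

lemma csp_instance_neq_sig: "csp_instance \<sigma> \<alpha>s \<Longrightarrow> csp_instance (neq_sig \<sigma>) \<alpha>s"
  by (simp add: csp_instance_def atom_ok_neq_sig)

lemma csp_instance_simps [simp]:
  "csp_instance \<sigma> []" "csp_instance \<sigma> (\<alpha> # \<alpha>s) \<longleftrightarrow> atom_ok \<sigma> \<alpha> \<and> csp_instance \<sigma> \<alpha>s"
  "csp_instance \<sigma> (\<alpha>s @ \<beta>s) \<longleftrightarrow> csp_instance \<sigma> \<alpha>s \<and> csp_instance \<sigma> \<beta>s"
  by (auto simp: csp_instance_def)

text \<open>A primitive positive definition without quantifier prefix: \<open>s\<close> ranges over
  all variables, and only the values of the terms \<open>us\<close> are retained. Allowing terms as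
  entries lets the two sides of a disequality be used directly.\<close>

definition ppt :: "signature \<Rightarrow> 'a struct \<Rightarrow> trm list \<Rightarrow> atom list \<Rightarrow> 'a list set" where
  "ppt \<sigma> A us \<alpha>s = {map (val A s) us | s. s \<in> assignments A \<and> sats (neq_expansion \<sigma> A) \<alpha>s s}"

definition pp_rels :: "signature \<Rightarrow> 'a struct \<Rightarrow> nat \<Rightarrow> 'a list set set" where
  "pp_rels \<sigma> A n = {ppt \<sigma> A us \<alpha>s | us \<alpha>s. length us = n \<and> (\<forall>u \<in> set us. trm_ok \<sigma> u) \<and> csp_instance (neq_sig \<sigma>) \<alpha>s}"

lemma definable_sat_atom:
  assumes "is_structure \<sigma> A" "atom_ok (neq_sig \<sigma>) \<alpha>"
  shows "definable \<sigma> A {t \<in> assignments A. sat_atom (neq_expansion \<sigma> A) t \<alpha>}"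
  using assms(2)
proof (cases rule: atom_ok_neq_sig_cases)
  case pos
  then show ?thesis using definable_sat[of \<sigma> "Atom \<alpha>" A] by (simp add: sat_atom_pos)
next
  case (neq u v)
  have "{t \<in> assignments A. sat_atom (neq_expansion \<sigma> A) t \<alpha>} = {t \<in> assignments A. sat A t (Neg (Atom (Eq u v)))}"
    using neq sat_atom_neq[OF assms(1)] by auto
  then show ?thesis using neq definable_sat[of \<sigma> "Neg (Atom (Eq u v))" A] by simp
qed

lemma definable_sats:
  assumes "is_structure \<sigma> A" "csp_instance (neq_sig \<sigma>) \<alpha>s"
  shows "definable \<sigma> A {t \<in> assignments A. sats (neq_expansion \<sigma> A) \<alpha>s t}"
  using assms(2)
proof (induction \<alpha>s)
  case Nil
  then show ?case by (simp add: definable_assignments)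
next
  case (Cons \<alpha> \<alpha>s)
  have "{t \<in> assignments A. sats (neq_expansion \<sigma> A) (\<alpha> # \<alpha>s) t} =
    {t \<in> assignments A. sat_atom (neq_expansion \<sigma> A) t \<alpha>} \<inter> {t \<in> assignments A. sats (neq_expansion \<sigma> A) \<alpha>s t}" by auto
  then show ?case using Cons definable_Int[OF definable_sat_atom[OF assms(1)]] by simp
qed

lemma definable_eq_val:
  assumes "trm_ok \<sigma> u"
  shows "definable \<sigma> A {t \<in> assignments A. t i = val A (t \<circ> r) u}"
proof -
  obtain u' where u': "trm_ok \<sigma> u'" "\<forall>s. val A s u' = val A (s \<circ> r) u" using ex_rename_trm assms by metis
  have "{t \<in> assignments A. t i = val A (t \<circ> r) u} = {t \<in> assignments A. sat A t (Atom (Eq (Var i) u'))}"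
    by (simp add: u'(2))
  then show ?thesis using definable_sat[of \<sigma> "Atom (Eq (Var i) u')" A] u'(1) by simp
qed

text \<open>The atoms are moved to the variables from \<open>length us\<close> on, the lower
  variables are equated with the terms one by one, and the result is projected to them.\<close>

lemma ppt_ndef:
  assumes struct: "is_structure \<sigma> A" and us: "\<forall>u \<in> set us. trm_ok \<sigma> u" and \<alpha>s: "csp_instance (neq_sig \<sigma>) \<alpha>s"
  shows "\<exists>P \<in> ndef \<sigma> A (length us). ppt \<sigma> A us \<alpha>s = (\<lambda>t. map t [0..<length us]) ` P"
proof -
  let ?n = "length us"
  let ?r = "\<lambda>i. ?n + i"
  define D where "D m = {t \<in> assignments A. t \<circ> ?r \<in> {t \<in> assignments A. sats (neq_expansion \<sigma> A) \<alpha>s t}} \<inter>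
    {t \<in> assignments A. \<forall>i < m. t i = val A (t \<circ> ?r) (us ! i)}" for m
  have "definable \<sigma> A (D m)" if "m \<le> ?n" for m
    using that
  proof (induction m)
    case 0
    have "D 0 = {t \<in> assignments A. t \<circ> ?r \<in> {t \<in> assignments A. sats (neq_expansion \<sigma> A) \<alpha>s t}}" by (auto simp: D_def)
    then show ?case using definable_rename[OF definable_sats[OF struct \<alpha>s], of ?r] by metis
  next
    case (Suc m)
    have "D (Suc m) = D m \<inter> {t \<in> assignments A. t m = val A (t \<circ> ?r) (us ! m)}"
      unfolding D_def less_Suc_eq by blast
    moreover have "trm_ok \<sigma> (us ! m)" using Suc.prems us by simp
    ultimately show ?case using definable_Int[OF Suc.IH definable_eq_val] Suc.prems by simp
  qed
  then have D: "definable \<sigma> A (D ?n)" by simp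
  let ?P = "{t \<in> assignments A. \<exists>t' \<in> D ?n. \<forall>i < ?n. t' i = t i}"
  have "ppt \<sigma> A us \<alpha>s = (\<lambda>t. map t [0..<?n]) ` ?P"
  proof (intro subset_antisym subsetI)
    fix x assume "x \<in> ppt \<sigma> A us \<alpha>s"
    then obtain s where s: "x = map (val A s) us" "s \<in> assignments A" "sats (neq_expansion \<sigma> A) \<alpha>s s"
      by (auto simp: ppt_def)
    define t where "t i = (if i < ?n then val A s (us ! i) else s (i - ?n))" for i
    have tr: "t \<circ> ?r = s" by (auto simp: t_def)
    have "t \<in> assignments A" using s(2) us val_in_univ[OF struct s(2)] by (auto simp: assignments_iff t_def)
    then have "t \<in> D ?n" using s by (simp add: D_def tr) (simp add: t_def)
    then have "t \<in> ?P" using \<open>t \<in> assignments A\<close> by blast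
    moreover have "x = map t [0..<?n]" unfolding s(1) by (rule nth_equalityI) (simp_all add: t_def)
    ultimately show "x \<in> (\<lambda>t. map t [0..<?n]) ` ?P" by blast
  next
    fix x assume "x \<in> (\<lambda>t. map t [0..<?n]) ` ?P"
    then obtain t t' where t: "x = map t [0..<?n]" "t' \<in> D ?n" "\<forall>i < ?n. t' i = t i" by blast
    have *: "t' \<circ> ?r \<in> assignments A" "sats (neq_expansion \<sigma> A) \<alpha>s (t' \<circ> ?r)" "\<forall>i < ?n. t' i = val A (t' \<circ> ?r) (us ! i)"
      using t(2) unfolding D_def by blast+
    have "x = map (val A (t' \<circ> ?r)) us" unfolding t(1)
    proof (rule nth_equalityI)
      fix i assume "i < length (map t [0..<?n])"
      then have i: "i < ?n" by simp
      then show "map t [0..<?n] ! i = map (val A (t' \<circ> ?r)) us ! i" using t(3)[rule_format, OF i] *(3)[rule_format, OF i] by simp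
    qed simp
    then show "x \<in> ppt \<sigma> A us \<alpha>s" unfolding ppt_def using *(1,2) by blast
  qed
  then show ?thesis using ndef_projection[OF D] by blast
qed

text \<open>A finite domain carries only finitely many relations of each arity; over an infinite one
  each such relation is the image of a member of the finite set
  \<open>ndef \<sigma> A n\<close>.\<close>

lemma finite_pp_rels:
  assumes "is_structure \<sigma> A" "omega_categorical \<sigma> A"
  shows "finite (pp_rels \<sigma> A n)"
proof (cases "finite (univ A)")
  case True
  have "pp_rels \<sigma> A n \<subseteq> Pow {xs. set xs \<subseteq> univ A \<and> length xs = n}"
    using val_in_univ[OF assms(1)] by (auto simp: pp_rels_def ppt_def)
  then show ?thesis using finite_lists_length_eq[OF True] by (meson finite_Pow_iff finite_subset)
next
  case False
  have "pp_rels \<sigma> A n \<subseteq> (\<lambda>P. (\<lambda>t. map t [0..<n]) ` P) ` ndef \<sigma> A n"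
    using ppt_ndef[OF assms(1)] by (fastforce simp: pp_rels_def)
  then show ?thesis using omega_categorical_finite_ndef[OF assms False] by (meson finite_imageI finite_subset)
qed

lemma ex_minimal_pp_rel:
  assumes "finite (pp_rels \<sigma> A n)" "R \<in> pp_rels \<sigma> A n" "R \<noteq> {}"
  shows "\<exists>P \<in> pp_rels \<sigma> A n. P \<noteq> {} \<and> P \<subseteq> R \<and> (\<forall>P' \<in> pp_rels \<sigma> A n. P' \<noteq> {} \<and> P' \<subseteq> P \<longrightarrow> P' = P)"
proof -
  have "finite (pp_rels \<sigma> A n - {{}})" "R \<in> pp_rels \<sigma> A n - {{}}" using assms by auto
  from finite_has_minimal2[OF this] obtain P where P: "P \<in> pp_rels \<sigma> A n - {{}}" "P \<subseteq> R"
    "\<forall>P' \<in> pp_rels \<sigma> A n - {{}}. P' \<subseteq> P \<longrightarrow> P = P'" by (elim bexE conjE) (rule that)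
  have "P' = P" if "P' \<in> pp_rels \<sigma> A n" "P' \<noteq> {} \<and> P' \<subseteq> P" for P' using P(3) that by auto
  then show ?thesis using P(1,2) by (intro bexI[of _ P] conjI ballI impI) auto
qed

lemma ppt_in_pp_rels:
  "\<forall>u \<in> set us. trm_ok \<sigma> u \<Longrightarrow> csp_instance (neq_sig \<sigma>) \<alpha>s \<Longrightarrow> ppt \<sigma> A us \<alpha>s \<in> pp_rels \<sigma> A (length us)"
  by (auto simp: pp_rels_def)

section \<open>Replacing constants by variables\<close>

text \<open>The constant with index \<open>F + i\<close> becomes the even variable
  \<open>2 * i\<close>, while variables are renamed by \<open>g\<close>. With
  \<open>g x = 2 * x + 1\<close> the two ranges are disjoint. On terms without constants it is a
  mere renaming and serves to separate copies of formulas.\<close>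

fun conv :: "(nat \<Rightarrow> nat) \<Rightarrow> nat \<Rightarrow> trm \<Rightarrow> trm" where
  "conv g F (Var x) = Var (g x)"
| "conv g F (Fn f ts) = (if f < F then Fn f (map (conv g F) ts) else Var (2 * (f - F)))"

fun conv_atom :: "(nat \<Rightarrow> nat) \<Rightarrow> nat \<Rightarrow> atom \<Rightarrow> atom" where
  "conv_atom g F (Eq s t) = Eq (conv g F s) (conv g F t)"
| "conv_atom g F (Rel r ts) = Rel r (map (conv g F) ts)"

lemma trm_ok_conv: "trm_ok (const_sig \<sigma> m) t \<Longrightarrow> trm_ok \<sigma> (conv g (length (fun_ar \<sigma>)) t)"
  by (induction t) (auto simp: nth_append)

lemma trm_ok_const_sig: "trm_ok \<sigma> t \<Longrightarrow> trm_ok (const_sig \<sigma> m) t"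
  by (induction t) (auto simp: nth_append)

lemma trm_ok_conv': "trm_ok \<sigma> t \<Longrightarrow> trm_ok \<sigma> (conv g (length (fun_ar \<sigma>)) t)"
  using trm_ok_conv trm_ok_const_sig by blast

lemma val_conv_rename: "trm_ok \<sigma> t \<Longrightarrow> val A s (conv g (length (fun_ar \<sigma>)) t) = val A (s \<circ> g) t"
proof (induction t)
  case (Fn f ts)
  then have "map (val A s) (map (conv g (length (fun_ar \<sigma>))) ts) = map (val A (s \<circ> g)) ts" by (auto simp: comp_def)
  then show ?case using Fn.prems by (simp only: conv.simps trm_ok.simps val.simps if_True)
qed simp

lemma sat_atom_conv_rename:
  assumes "atom_ok (neq_sig \<sigma>) \<alpha>"
  shows "sat_atom (neq_expansion \<sigma> A) s (conv_atom g (length (fun_ar \<sigma>)) \<alpha>) = sat_atom (neq_expansion \<sigma> A) (s \<circ> g) \<alpha>"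
proof (cases \<alpha>)
  case (Eq u v)
  then show ?thesis using assms val_conv_rename[of \<sigma> _ A s g] by (simp add: comp_def)
next
  case (Rel r ts)
  then have "\<forall>t \<in> set ts. trm_ok \<sigma> t" using assms by simp
  then have "map (val A s) (map (conv g (length (fun_ar \<sigma>))) ts) = map (val A (s \<circ> g)) ts"
    using val_conv_rename[of \<sigma> _ A s g] by auto
  then have "map (val (neq_expansion \<sigma> A) s) (map (conv g (length (fun_ar \<sigma>))) ts) = map (val (neq_expansion \<sigma> A) (s \<circ> g)) ts"
    by simp
  then show ?thesis unfolding Rel conv_atom.simps sat_atom.simps by (simp only:)
qed

lemma sats_conv_rename:
  "csp_instance (neq_sig \<sigma>) \<alpha>s \<Longrightarrow>
    sats (neq_expansion \<sigma> A) (map (conv_atom g (length (fun_ar \<sigma>))) \<alpha>s) s = sats (neq_expansion \<sigma> A) \<alpha>s (s \<circ> g)"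
  by (simp add: sats_def csp_instance_def sat_atom_conv_rename)

lemma atom_ok_conv_rename: "atom_ok (neq_sig \<sigma>) \<alpha> \<Longrightarrow> atom_ok (neq_sig \<sigma>) (conv_atom g (length (fun_ar \<sigma>)) \<alpha>)"
  by (cases \<alpha>) (auto simp: trm_ok_conv')

lemma csp_instance_conv_rename:
  "csp_instance (neq_sig \<sigma>) \<alpha>s \<Longrightarrow> csp_instance (neq_sig \<sigma>) (map (conv_atom g (length (fun_ar \<sigma>))) \<alpha>s)"
  by (simp add: csp_instance_def atom_ok_conv_rename)

lemma val_conv_const:
  "trm_ok (const_sig \<sigma> m) t \<Longrightarrow> (\<And>i. i < m \<Longrightarrow> s (2 * i) = as ! i) \<Longrightarrow>
    val A s (conv g (length (fun_ar \<sigma>)) t) = val (const_expansion \<sigma> A as) (s \<circ> g) t"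
proof (induction t)
  case (Fn f ts)
  let ?B = "const_expansion \<sigma> A as"
  show ?case
  proof (cases "f < length (fun_ar \<sigma>)")
    case True
    have "map (val A s) (map (conv g (length (fun_ar \<sigma>))) ts) = map (val ?B (s \<circ> g)) ts" using Fn by (auto simp: comp_def)
    moreover have "funs ?B f = funs A f" using True by (simp add: const_expansion_def)
    ultimately show ?thesis using True by (simp only: conv.simps val.simps if_True)
  next
    case False
    then have "f - length (fun_ar \<sigma>) < m" using Fn.prems(1) by (auto simp: nth_append)
    then show ?thesis using False Fn.prems(2) by (simp add: const_expansion_def)
  qed
qed simp

lemma sat_atom_conv_const:
  assumes "atom_ok (const_sig \<sigma> m) \<alpha>" "\<And>i. i < m \<Longrightarrow> s (2 * i) = as ! i"
  shows "sat_atom (neq_expansion \<sigma> A) s (conv_atom g (length (fun_ar \<sigma>)) \<alpha>) = sat_atom (const_expansion \<sigma> A as) (s \<circ> g) \<alpha>"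
proof (cases \<alpha>)
  case (Eq u v)
  then show ?thesis using assms(1) val_conv_const[of \<sigma> m _ s as A g, OF _ assms(2)] by (simp add: comp_def)
next
  case (Rel r ts)
  then have ok: "\<forall>t \<in> set ts. trm_ok (const_sig \<sigma> m) t" "r < length (rel_ar \<sigma>)"
    using assms(1) by (auto simp: nth_append)
  have "map (val A s) (map (conv g (length (fun_ar \<sigma>))) ts) = map (val (const_expansion \<sigma> A as) (s \<circ> g)) ts"
    using val_conv_const[of \<sigma> m _ s as A g, OF _ assms(2)] ok by auto
  then have "map (val (neq_expansion \<sigma> A) s) (map (conv g (length (fun_ar \<sigma>))) ts) = map (val (const_expansion \<sigma> A as) (s \<circ> g)) ts"
    by simp
  moreover have "rels (neq_expansion \<sigma> A) r = rels (const_expansion \<sigma> A as) r"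
    using ok(2) by (simp add: rels_neq_expansion const_expansion_def)
  ultimately show ?thesis unfolding Rel conv_atom.simps sat_atom.simps by (simp only:)
qed

lemma sats_conv_const:
  assumes "csp_instance (const_sig \<sigma> m) \<alpha>s" "\<And>i. i < m \<Longrightarrow> s (2 * i) = as ! i"
  shows "sats (neq_expansion \<sigma> A) (map (conv_atom g (length (fun_ar \<sigma>))) \<alpha>s) s = sats (const_expansion \<sigma> A as) \<alpha>s (s \<circ> g)"
  using assms(1) sat_atom_conv_const[of \<sigma> m _ s as A g, OF _ assms(2)] by (simp add: sats_def csp_instance_def)

lemma csp_instance_conv_const:
  assumes "csp_instance (const_sig \<sigma> m) \<alpha>s"
  shows "csp_instance (neq_sig \<sigma>) (map (conv_atom g (length (fun_ar \<sigma>))) \<alpha>s)"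
proof -
  have "atom_ok \<sigma> (conv_atom g (length (fun_ar \<sigma>)) \<alpha>)" if "atom_ok (const_sig \<sigma> m) \<alpha>" for \<alpha>
    using that by (cases \<alpha>) (auto simp: trm_ok_conv)
  then show ?thesis using assms atom_ok_neq_sig by (auto simp: csp_instance_def)
qed

section \<open>Convexity\<close>

lemma val_prod_embedding:
  assumes e: "\<And>f xs ys. f < length (fun_ar \<sigma>) \<Longrightarrow> xs \<in> tuples (univ A) (fun_ar \<sigma> ! f) \<Longrightarrow> ys \<in> tuples (univ A) (fun_ar \<sigma> ! f) \<Longrightarrow>
      e (funs A f xs, funs A f ys) = funs A f (map e (zip xs ys))"
    and "is_structure \<sigma> A" "s \<in> assignments A" "s' \<in> assignments A" "trm_ok \<sigma> t"
  shows "val A (\<lambda>x. e (s x, s' x)) t = e (val A s t, val A s' t)"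
  using assms(5)
proof (induction t)
  case (Fn f ts)
  let ?s = "\<lambda>x. e (s x, s' x)"
  have "map (val A s) ts \<in> tuples (univ A) (fun_ar \<sigma> ! f)" "map (val A s') ts \<in> tuples (univ A) (fun_ar \<sigma> ! f)"
    using Fn.prems val_in_univ[OF assms(2)] assms(3,4) by (auto simp: tuples_def)
  then have "e (funs A f (map (val A s) ts), funs A f (map (val A s') ts)) =
    funs A f (map e (zip (map (val A s) ts) (map (val A s') ts)))" using e Fn.prems by simp
  moreover have "map e (zip (map (val A s) ts) (map (val A s') ts)) = map (val A ?s) ts"
    using Fn by (auto simp: zip_map_map zip_same_conv_map)
  ultimately show ?case by (simp only: val.simps)
qed simp

lemma embedding_square:
  assumes "embedding \<sigma> e (prod_struct A A) A"
  shows "inj_on e (univ A \<times> univ A)" "\<And>a b. a \<in> univ A \<Longrightarrow> b \<in> univ A \<Longrightarrow> e (a, b) \<in> univ A"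
    and "\<And>f xs ys. f < length (fun_ar \<sigma>) \<Longrightarrow> xs \<in> tuples (univ A) (fun_ar \<sigma> ! f) \<Longrightarrow> ys \<in> tuples (univ A) (fun_ar \<sigma> ! f) \<Longrightarrow>
      e (funs A f xs, funs A f ys) = funs A f (map e (zip xs ys))"
    and "\<And>r xs ys. r < length (rel_ar \<sigma>) \<Longrightarrow> xs \<in> tuples (univ A) (rel_ar \<sigma> ! r) \<Longrightarrow> ys \<in> tuples (univ A) (rel_ar \<sigma> ! r) \<Longrightarrow>
      xs \<in> rels A r \<Longrightarrow> ys \<in> rels A r \<Longrightarrow> map e (zip xs ys) \<in> rels A r"
proof -
  obtain S where S: "substructure \<sigma> S A" "isomorphism \<sigma> e (prod_struct A A) S" using assms by (auto simp: embedding_def)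
  have bij: "bij_betw e (univ A \<times> univ A) (univ S)" using S(2) by (simp add: isomorphism_def prod_struct_def)
  then show "inj_on e (univ A \<times> univ A)" by (simp add: bij_betw_def)
  have sub: "univ S \<subseteq> univ A" using S(1) by (simp add: substructure_def)
  then show "e (a, b) \<in> univ A" if "a \<in> univ A" "b \<in> univ A" for a b using bij that by (auto simp: bij_betw_def)
  have zip_tuples: "zip xs ys \<in> tuples (univ A \<times> univ A) n" "map fst (zip xs ys) = xs" "map snd (zip xs ys) = ys"
    "map e (zip xs ys) \<in> tuples (univ S) n"
    if "xs \<in> tuples (univ A) n" "ys \<in> tuples (univ A) n" for xs ys n
  proof -
    show 1: "zip xs ys \<in> tuples (univ A \<times> univ A) n"
      using that by (auto simp: tuples_def dest: set_zip_leftD set_zip_rightD)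
    show "map fst (zip xs ys) = xs" "map snd (zip xs ys) = ys" using that by (auto simp: tuples_def)
    show "map e (zip xs ys) \<in> tuples (univ S) n" using 1 bij by (auto simp: tuples_def bij_betw_def)
  qed
  show "e (funs A f xs, funs A f ys) = funs A f (map e (zip xs ys))"
    if "f < length (fun_ar \<sigma>)" "xs \<in> tuples (univ A) (fun_ar \<sigma> ! f)" "ys \<in> tuples (univ A) (fun_ar \<sigma> ! f)" for f xs ys
  proof -
    have "e (funs (prod_struct A A) f (zip xs ys)) = funs S f (map e (zip xs ys))"
      using S(2) that(1) zip_tuples(1)[OF that(2,3)] by (simp add: isomorphism_def prod_struct_def)
    moreover have "funs S f (map e (zip xs ys)) = funs A f (map e (zip xs ys))"
      using S(1) that(1) zip_tuples(4)[OF that(2,3)] by (simp add: substructure_def)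
    ultimately show ?thesis using zip_tuples(2,3)[OF that(2,3)] by (simp add: prod_struct_def)
  qed
  show "map e (zip xs ys) \<in> rels A r"
    if "r < length (rel_ar \<sigma>)" "xs \<in> tuples (univ A) (rel_ar \<sigma> ! r)" "ys \<in> tuples (univ A) (rel_ar \<sigma> ! r)"
      "xs \<in> rels A r" "ys \<in> rels A r" for r xs ys
  proof -
    have "zip xs ys \<in> rels (prod_struct A A) r" using zip_tuples(2,3)[OF that(2,3)] that(4,5) by (simp add: prod_struct_def)
    moreover have "zip xs ys \<in> rels (prod_struct A A) r \<longleftrightarrow> map e (zip xs ys) \<in> rels S r"
      using S(2) that(1) zip_tuples(1)[OF that(2,3)] by (simp add: isomorphism_def prod_struct_def)
    ultimately show ?thesis using S(1) that(1) by (auto simp: substructure_def)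
  qed
qed

text \<open>Apply the embedding of the square pointwise to the two solutions. It preserves the
  positive atoms, and its injectivity keeps two terms apart as soon as one of the solutions
  does.\<close>

lemma combine_solutions:
  assumes emb: "embedding \<sigma> e (prod_struct A A) A" and struct: "is_structure \<sigma> A"
    and \<phi>: "csp_instance \<sigma> \<phi>"
    and s: "s \<in> assignments A" "sats A \<phi> s" and s': "s' \<in> assignments A" "sats A \<phi> s'"
  shows "\<exists>t \<in> assignments A. sats A \<phi> t \<and> (\<forall>u v. trm_ok \<sigma> u \<longrightarrow> trm_ok \<sigma> v \<longrightarrow>
    val A s u \<noteq> val A s v \<or> val A s' u \<noteq> val A s' v \<longrightarrow> val A t u \<noteq> val A t v)"
proof -
  note e = embedding_square[OF emb]
  let ?t = "\<lambda>x. e (s x, s' x)"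
  have val: "val A ?t u = e (val A s u, val A s' u)" if "trm_ok \<sigma> u" for u
    by (rule val_prod_embedding[OF e(3) struct s(1) s'(1) that])
  have tA: "?t \<in> assignments A" using e(2) s(1) s'(1) by (simp add: assignments_iff)
  have neq: "val A ?t u = val A ?t v \<longleftrightarrow> val A s u = val A s v \<and> val A s' u = val A s' v" if "trm_ok \<sigma> u" "trm_ok \<sigma> v" for u v
    using inj_on_eq_iff[OF e(1), of "(val A s u, val A s' u)" "(val A s v, val A s' v)"] that
      val_in_univ[OF struct s(1)] val_in_univ[OF struct s'(1)] by (simp add: val)
  have "sat_atom A ?t \<alpha>" if "\<alpha> \<in> set \<phi>" for \<alpha>
  proof -
    have ok: "atom_ok \<sigma> \<alpha>" "sat_atom A s \<alpha>" "sat_atom A s' \<alpha>" using that \<phi> s(2) s'(2) by (auto simp: sats_def csp_instance_def)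
    show ?thesis
    proof (cases \<alpha>)
      case (Eq u v)
      then show ?thesis using ok neq by simp
    next
      case (Rel r ts)
      have "map (val A s) ts \<in> tuples (univ A) (rel_ar \<sigma> ! r)" "map (val A s') ts \<in> tuples (univ A) (rel_ar \<sigma> ! r)"
        using ok Rel val_in_univ[OF struct] s(1) s'(1) by (auto simp: tuples_def)
      then have "map e (zip (map (val A s) ts) (map (val A s') ts)) \<in> rels A r"
        using e(4)[of r "map (val A s) ts" "map (val A s') ts"] ok Rel by simp
      moreover have "map e (zip (map (val A s) ts) (map (val A s') ts)) = map (val A ?t) ts"
        using ok Rel val by (auto simp: zip_map_map zip_same_conv_map)
      ultimately show ?thesis unfolding Rel sat_atom.simps by (simp only:)
    qed
  qed
  then have "sats A \<phi> ?t" by (simp add: sats_def)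
  then show ?thesis using tA neq by (intro bexI[of _ ?t]) auto
qed

text \<open>Disequalities are added one at a time: a solution for those already treated is combined
  with one for the new pair.\<close>

lemma convexity:
  assumes emb: "embedding \<sigma> e (prod_struct A A) A" and struct: "is_structure \<sigma> A"
    and \<phi>: "csp_instance \<sigma> \<phi>" and ps: "\<forall>(u, v) \<in> set ps. trm_ok \<sigma> u \<and> trm_ok \<sigma> v"
    and sat: "\<exists>s \<in> assignments A. sats A \<phi> s"
      "\<forall>(u, v) \<in> set ps. \<exists>s \<in> assignments A. sats A \<phi> s \<and> val A s u \<noteq> val A s v"
  shows "\<exists>s \<in> assignments A. sats A \<phi> s \<and> (\<forall>(u, v) \<in> set ps. val A s u \<noteq> val A s v)"
  using ps sat(2)
proof (induction ps)
  case Nil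
  then show ?case using sat(1) by simp
next
  case (Cons p ps)
  obtain u v where p: "p = (u, v)" by (cases p)
  obtain s where s: "s \<in> assignments A" "sats A \<phi> s" "\<forall>(u, v) \<in> set ps. val A s u \<noteq> val A s v"
    using Cons by auto
  obtain s' where s': "s' \<in> assignments A" "sats A \<phi> s'" "val A s' u \<noteq> val A s' v"
    using Cons.prems(2) p by auto
  obtain t where t: "t \<in> assignments A" "sats A \<phi> t" and neq: "\<forall>u v. trm_ok \<sigma> u \<longrightarrow> trm_ok \<sigma> v \<longrightarrow>
    val A s u \<noteq> val A s v \<or> val A s' u \<noteq> val A s' v \<longrightarrow> val A t u \<noteq> val A t v"
    using combine_solutions[OF emb struct \<phi> s(1,2) s'(1,2)] by blast
  have "val A t a \<noteq> val A t b" if "(a, b) \<in> set (p # ps)" for a b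
  proof -
    have "trm_ok \<sigma> a" "trm_ok \<sigma> b" using Cons.prems(1) that by auto
    moreover have "val A s a \<noteq> val A s b \<or> val A s' a \<noteq> val A s' b" using that s(3) s'(3) p by auto
    ultimately show ?thesis using neq by blast
  qed
  then show ?case using t by auto
qed

section \<open>The choice of the constants\<close>

text \<open>All that the machine part uses about \<open>A\<close>. The first equivalence drives the
  reduction that eliminates disequalities, the second the one that eliminates constants. The pair
  number \<open>j\<close> consists of the entries \<open>j\<close> and \<open>k + j\<close> of
  \<open>as\<close>, and \<open>\<psi>\<close> states that the even variables below
  \<open>4 * k\<close> form a tuple of the isolating relation.\<close>

lemma constants_exist:
  fixes A :: "'a struct"
  assumes struct: "is_structure \<sigma> A" and cat: "omega_categorical \<sigma> A"
    and emb: "embedding \<sigma> e (prod_struct A A) A"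
  shows "\<exists>k as \<psi>. length as = 2 * k \<and> set as \<subseteq> univ A \<and> csp_instance (neq_sig \<sigma>) \<psi> \<and>
    (\<forall>\<phi> ps. csp_instance \<sigma> \<phi> \<longrightarrow> (\<forall>(u, v) \<in> set ps. trm_ok \<sigma> u \<and> trm_ok \<sigma> v) \<longrightarrow>
      ((\<exists>s \<in> assignments A. sats A \<phi> s \<and> (\<forall>(u, v) \<in> set ps. val A s u \<noteq> val A s v)) \<longleftrightarrow>
       (\<exists>s \<in> assignments A. sats A \<phi> s) \<and>
       (\<forall>(u, v) \<in> set ps. \<exists>j < k. \<exists>s \<in> assignments A. sats A \<phi> s \<and> val A s u = as ! j \<and> val A s v = as ! (k + j)))) \<and>
    (\<forall>\<alpha>s. csp_instance (const_sig \<sigma> (2 * k)) \<alpha>s \<longrightarrow>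
      (satisfiable_in (const_expansion \<sigma> A as) \<alpha>s \<longleftrightarrow>
       satisfiable_in (neq_expansion \<sigma> A) (map (conv_atom (\<lambda>x. 2 * x + 1) (length (fun_ar \<sigma>))) \<alpha>s @ \<psi>)))"
proof -
  let ?F = "length (fun_ar \<sigma>)" and ?N = "neq_expansion \<sigma> A"
  define neqs where "neqs = {[a, b] | a b. a \<in> univ A \<and> b \<in> univ A \<and> a \<noteq> b}"
  define mins where "mins = {P \<in> pp_rels \<sigma> A 2. P \<noteq> {} \<and> P \<subseteq> neqs \<and> (\<forall>P' \<in> pp_rels \<sigma> A 2. P' \<noteq> {} \<and> P' \<subseteq> P \<longrightarrow> P' = P)}"
  have fin: "finite (pp_rels \<sigma> A n)" for n by (rule finite_pp_rels[OF struct cat])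
  have "finite mins" unfolding mins_def using fin by simp
  then obtain Ps where Ps: "set Ps = mins" using finite_list by blast
  define k where "k = length Ps"
  have "\<exists>us \<alpha>s. Ps ! j = ppt \<sigma> A us \<alpha>s \<and> length us = 2 \<and> (\<forall>u \<in> set us. trm_ok \<sigma> u) \<and> csp_instance (neq_sig \<sigma>) \<alpha>s"
    if "j < k" for j
  proof -
    have "Ps ! j \<in> pp_rels \<sigma> A 2" using that Ps nth_mem[of j Ps] by (auto simp: k_def mins_def)
    then show ?thesis unfolding pp_rels_def by blast
  qed
  then obtain us \<alpha>s where P: "\<And>j. j < k \<Longrightarrow> Ps ! j = ppt \<sigma> A (us j) (\<alpha>s j)" "\<And>j. j < k \<Longrightarrow> length (us j) = 2"
    "\<And>j u. j < k \<Longrightarrow> u \<in> set (us j) \<Longrightarrow> trm_ok \<sigma> u" "\<And>j. j < k \<Longrightarrow> csp_instance (neq_sig \<sigma>) (\<alpha>s j)"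
    by metis
  have us_ok: "trm_ok \<sigma> (us j ! 0)" "trm_ok \<sigma> (us j ! 1)" if "j < k" for j
    using P(3)[OF that] P(2)[OF that] by simp_all
  text \<open>\<open>Q0\<close> is the product of the relations \<open>Ps ! j\<close>, realised with disjoint sets of variables.\<close>
  let ?g = "\<lambda>j v. v * k + j"
  define us0 where "us0 = map (\<lambda>j. conv (?g j) ?F (us j ! 0)) [0..<k] @ map (\<lambda>j. conv (?g j) ?F (us j ! 1)) [0..<k]"
  define \<alpha>0 where "\<alpha>0 = concat (map (\<lambda>j. map (conv_atom (?g j) ?F) (\<alpha>s j)) [0..<k])"
  define Q0 where "Q0 = ppt \<sigma> A us0 \<alpha>0"
  have sats0: "sats ?N \<alpha>0 s \<longleftrightarrow> (\<forall>j < k. sats ?N (\<alpha>s j) (s \<circ> ?g j))" for s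
  proof -
    have "sats ?N \<alpha>0 s \<longleftrightarrow> (\<forall>j < k. sats ?N (map (conv_atom (?g j) ?F) (\<alpha>s j)) s)"
      by (auto simp: \<alpha>0_def sats_def)
    moreover have "sats ?N (map (conv_atom (?g j) ?F) (\<alpha>s j)) s = sats ?N (\<alpha>s j) (s \<circ> ?g j)" if "j < k" for j
      by (rule sats_conv_rename[OF P(4)[OF that]])
    ultimately show ?thesis by blast
  qed
  have val0: "map (val A s) us0 ! j = val A (s \<circ> ?g j) (us j ! 0)" "map (val A s) us0 ! (k + j) = val A (s \<circ> ?g j) (us j ! 1)"
    if "j < k" for s j using that us_ok val_conv_rename[of \<sigma> _ A s "?g j"] by (simp_all add: us0_def nth_append)
  have len0: "length us0 = 2 * k" by (simp add: us0_def)
  have Q0: "Q0 \<in> pp_rels \<sigma> A (2 * k)"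
  proof -
    have "\<forall>u \<in> set us0. trm_ok \<sigma> u" using us_ok trm_ok_conv' by (auto simp: us0_def)
    moreover have "csp_instance (neq_sig \<sigma>) \<alpha>0" using csp_instance_conv_rename P(4)
      unfolding csp_instance_def \<alpha>0_def by fastforce
    ultimately show ?thesis using ppt_in_pp_rels[of us0] len0 by (simp add: Q0_def)
  qed
  have "Q0 \<noteq> {}"
  proof -
    have "\<exists>s \<in> assignments A. sats ?N (\<alpha>s j) s" if "j < k" for j
    proof -
      have "Ps ! j \<noteq> {}" using that Ps nth_mem[of j Ps] by (auto simp: k_def mins_def)
      then show ?thesis using P(1)[OF that] by (auto simp: ppt_def)
    qed
    then obtain S where S: "\<And>j. j < k \<Longrightarrow> S j \<in> assignments A" "\<And>j. j < k \<Longrightarrow> sats ?N (\<alpha>s j) (S j)" by metis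
    obtain a where a: "a \<in> univ A" using struct by (auto simp: is_structure_def)
    \<comment> \<open>The inverse of the separation of copies: the remainder modulo \<open>k\<close>
      names the copy and the quotient the original variable. For \<open>k = 0\<close> there are no
      copies and any value does.\<close>
    define s where "s v = (if k = 0 then a else S (v mod k) (v div k))" for v
    have "s \<in> assignments A" using S(1) a by (auto simp: assignments_iff s_def)
    moreover have "s \<circ> ?g j = S j" if "j < k" for j using that by (auto simp: s_def)
    then have "sats ?N \<alpha>0 s" unfolding sats0 using S(2) by metis
    ultimately show ?thesis by (auto simp: Q0_def ppt_def)
  qed
  obtain Q where Q: "Q \<in> pp_rels \<sigma> A (2 * k)" "Q \<noteq> {}" "Q \<subseteq> Q0"
    "\<And>P'. P' \<in> pp_rels \<sigma> A (2 * k) \<Longrightarrow> P' \<noteq> {} \<Longrightarrow> P' \<subseteq> Q \<Longrightarrow> P' = Q"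
    using ex_minimal_pp_rel[OF fin Q0 \<open>Q0 \<noteq> {}\<close>] by metis
  obtain as where as: "as \<in> Q" using Q(2) by blast
  obtain us1 \<alpha>1 where Q1: "Q = ppt \<sigma> A us1 \<alpha>1" "length us1 = 2 * k" "\<forall>u \<in> set us1. trm_ok \<sigma> u" "csp_instance (neq_sig \<sigma>) \<alpha>1"
    using Q(1) unfolding pp_rels_def by blast
  have len: "length as = 2 * k" using as Q1 by (auto simp: ppt_def)
  have as_univ: "set as \<subseteq> univ A" using as Q1 val_in_univ[OF struct] by (auto simp: ppt_def)
  have as_P: "[as ! j, as ! (k + j)] \<in> Ps ! j" if "j < k" for j
  proof -
    obtain s where s: "s \<in> assignments A" "sats ?N \<alpha>0 s" "as = map (val A s) us0" using as Q(3) by (auto simp: Q0_def ppt_def)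
    have "map f (us j) = [f (us j ! 0), f (us j ! 1)]" for f :: "trm \<Rightarrow> 'a"
      using P(2)[OF that] by (auto simp: numeral_2_eq_2 length_Suc_conv)
    then have "[as ! j, as ! (k + j)] = map (val A (s \<circ> ?g j)) (us j)"
      unfolding s(3) val0[OF that] by simp
    moreover have "s \<circ> ?g j \<in> assignments A" using s(1) by (simp add: assignments_iff)
    moreover have "sats ?N (\<alpha>s j) (s \<circ> ?g j)" using s(2) that unfolding sats0 by blast
    ultimately show ?thesis unfolding P(1)[OF that] ppt_def by (intro CollectI exI conjI)
  qed
  have as_neq: "as ! j \<noteq> as ! (k + j)" if "j < k" for j
  proof -
    have "Ps ! j \<subseteq> neqs" using that Ps nth_mem[of j Ps] by (auto simp: k_def mins_def)
    then show ?thesis using as_P[OF that] by (auto simp: neqs_def)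
  qed
  have single: "(\<exists>s \<in> assignments A. sats A \<phi> s \<and> val A s u \<noteq> val A s v) \<longleftrightarrow>
      (\<exists>j < k. \<exists>s \<in> assignments A. sats A \<phi> s \<and> val A s u = as ! j \<and> val A s v = as ! (k + j))"
    if \<phi>: "csp_instance \<sigma> \<phi>" and uv: "trm_ok \<sigma> u" "trm_ok \<sigma> v" for \<phi> u v
  proof
    assume "\<exists>s \<in> assignments A. sats A \<phi> s \<and> val A s u \<noteq> val A s v"
    then obtain s where s: "s \<in> assignments A" "sats A \<phi> s" "val A s u \<noteq> val A s v" by blast
    define \<beta>s where "\<beta>s = Rel (length (rel_ar \<sigma>)) [u, v] # \<phi>"
    have \<beta>s: "sats ?N \<beta>s t \<longleftrightarrow> sats A \<phi> t \<and> val A t u \<noteq> val A t v" if "t \<in> assignments A" for t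
      using sat_atom_neq[OF struct that uv] sats_pos[OF \<phi>] by (auto simp: \<beta>s_def)
    \<comment> \<open>The value pairs that \<open>u\<close> and \<open>v\<close> attain when they
      differ. A minimal relation below \<open>R\<close> is one of the \<open>Ps ! j\<close>, whence
      the pair of constants number \<open>j\<close> belongs to \<open>R\<close>.\<close>
    define R where "R = ppt \<sigma> A [u, v] \<beta>s"
    have "csp_instance (neq_sig \<sigma>) \<beta>s" using uv csp_instance_neq_sig[OF \<phi>] by (simp add: \<beta>s_def nth_append)
    then have R: "R \<in> pp_rels \<sigma> A 2" using ppt_in_pp_rels[of "[u, v]" \<sigma> \<beta>s A] uv by (simp add: R_def numeral_2_eq_2)
    have "R \<noteq> {}" using s \<beta>s[OF s(1)] by (auto simp: R_def ppt_def)
    have "R \<subseteq> neqs"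
    proof
      fix x assume "x \<in> R"
      then obtain t where t: "t \<in> assignments A" "sats ?N \<beta>s t" "x = [val A t u, val A t v]" by (auto simp: R_def ppt_def)
      then show "x \<in> neqs" using \<beta>s[OF t(1)] val_in_univ[OF struct t(1)] uv by (auto simp: neqs_def)
    qed
    obtain P where P': "P \<in> pp_rels \<sigma> A 2" "P \<noteq> {}" "P \<subseteq> R"
      "\<forall>P' \<in> pp_rels \<sigma> A 2. P' \<noteq> {} \<and> P' \<subseteq> P \<longrightarrow> P' = P"
      using ex_minimal_pp_rel[OF fin R \<open>R \<noteq> {}\<close>] by blast
    have "P \<in> set Ps" unfolding Ps mins_def using P' \<open>R \<subseteq> neqs\<close> by blast
    then obtain j where j: "j < k" "P = Ps ! j" by (auto simp: in_set_conv_nth k_def)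
    have "[as ! j, as ! (k + j)] \<in> R" using as_P[OF j(1)] j(2) P'(3) by blast
    then obtain t where t: "t \<in> assignments A" "sats ?N \<beta>s t" "as ! j = val A t u" "as ! (k + j) = val A t v"
      by (auto simp: R_def ppt_def)
    then show "\<exists>j < k. \<exists>s \<in> assignments A. sats A \<phi> s \<and> val A s u = as ! j \<and> val A s v = as ! (k + j)"
      using j(1) \<beta>s[OF t(1)] by (intro exI[of _ j]) auto
  next
    assume "\<exists>j < k. \<exists>s \<in> assignments A. sats A \<phi> s \<and> val A s u = as ! j \<and> val A s v = as ! (k + j)"
    then show "\<exists>s \<in> assignments A. sats A \<phi> s \<and> val A s u \<noteq> val A s v" using as_neq by metis
  qed
  have part1: "(\<exists>s \<in> assignments A. sats A \<phi> s \<and> (\<forall>(u, v) \<in> set ps. val A s u \<noteq> val A s v)) \<longleftrightarrow>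
       (\<exists>s \<in> assignments A. sats A \<phi> s) \<and>
       (\<forall>(u, v) \<in> set ps. \<exists>j < k. \<exists>s \<in> assignments A. sats A \<phi> s \<and> val A s u = as ! j \<and> val A s v = as ! (k + j))"
    if \<phi>: "csp_instance \<sigma> \<phi>" and ps: "\<forall>(u, v) \<in> set ps. trm_ok \<sigma> u \<and> trm_ok \<sigma> v" for \<phi> ps
  proof -
    have "(\<forall>(u, v) \<in> set ps. \<exists>j < k. \<exists>s \<in> assignments A. sats A \<phi> s \<and> val A s u = as ! j \<and> val A s v = as ! (k + j)) \<longleftrightarrow>
      (\<forall>(u, v) \<in> set ps. \<exists>s \<in> assignments A. sats A \<phi> s \<and> val A s u \<noteq> val A s v)"
      using single[OF \<phi>] ps by blast
    moreover have "(\<exists>s \<in> assignments A. sats A \<phi> s \<and> (\<forall>(u, v) \<in> set ps. val A s u \<noteq> val A s v)) \<longleftrightarrow>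
       (\<exists>s \<in> assignments A. sats A \<phi> s) \<and> (\<forall>(u, v) \<in> set ps. \<exists>s \<in> assignments A. sats A \<phi> s \<and> val A s u \<noteq> val A s v)"
      using convexity[OF emb struct \<phi> ps] by blast
    ultimately show ?thesis by blast
  qed
  \<comment> \<open>Three disjoint ranges: the constants use the even variables below
    \<open>4 * k\<close>, the auxiliary variables of \<open>Q\<close> the even ones from there on,
    and the instance the odd ones.\<close>
  let ?h = "\<lambda>v. 2 * (v + 2 * k)"
  define \<psi> where "\<psi> = map (conv_atom ?h ?F) \<alpha>1 @ map (\<lambda>i. Eq (Var (2 * i)) (conv ?h ?F (us1 ! i))) [0..<2 * k]"
  have us1_ok: "trm_ok \<sigma> (us1 ! i)" if "i < 2 * k" for i using Q1(2,3) that by simp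
  have \<psi>_ok: "csp_instance (neq_sig \<sigma>) \<psi>"
    unfolding \<psi>_def using csp_instance_conv_rename[OF Q1(4)] us1_ok trm_ok_conv' by (auto simp: csp_instance_def)
  have sats\<psi>: "sats ?N \<psi> t \<longleftrightarrow> sats ?N \<alpha>1 (t \<circ> ?h) \<and> (\<forall>i < 2 * k. t (2 * i) = val A (t \<circ> ?h) (us1 ! i))" for t
  proof -
    have "sats ?N (map (\<lambda>i. Eq (Var (2 * i)) (conv ?h ?F (us1 ! i))) [0..<2 * k]) t \<longleftrightarrow>
      (\<forall>i < 2 * k. t (2 * i) = val A (t \<circ> ?h) (us1 ! i))"
      using val_conv_rename[OF us1_ok, of _ A t ?h] by (auto simp: sats_def)
    then show ?thesis unfolding \<psi>_def sats_simps sats_conv_rename[OF Q1(4)] by blast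
  qed
  have part2: "satisfiable_in (const_expansion \<sigma> A as) \<beta>s \<longleftrightarrow>
       satisfiable_in ?N (map (conv_atom (\<lambda>x. 2 * x + 1) ?F) \<beta>s @ \<psi>)"
    if \<beta>s: "csp_instance (const_sig \<sigma> (2 * k)) \<beta>s" for \<beta>s
  proof
    assume "satisfiable_in (const_expansion \<sigma> A as) \<beta>s"
    then obtain s where s: "s \<in> assignments A" "sats (const_expansion \<sigma> A as) \<beta>s s" by (auto simp: satisfiable_in_iff)
    obtain s' where s': "s' \<in> assignments A" "sats ?N \<alpha>1 s'" "as = map (val A s') us1" using as by (auto simp: Q1(1) ppt_def)
    \<comment> \<open>One assignment assembled over the three ranges: \<open>s\<close> solves the
      instance, \<open>as\<close> fills the places of the constants, and \<open>s'\<close> certifies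
      \<open>as \<in> Q\<close>.\<close>
    define t where "t x = (if odd x then s (x div 2) else if x div 2 < 2 * k then as ! (x div 2) else s' (x div 2 - 2 * k))" for x
    have "t \<in> assignments A" using s(1) s'(1) as_univ len nth_mem[of _ as] by (auto simp: assignments_iff t_def)
    moreover have 1: "t (2 * i) = as ! i" if "i < 2 * k" for i using that by (simp add: t_def)
    moreover have "t \<circ> (\<lambda>x. 2 * x + 1) = s" by (auto simp: t_def)
    then have "sats ?N (map (conv_atom (\<lambda>x. 2 * x + 1) ?F) \<beta>s) t"
      using sats_conv_const[of \<sigma> "2 * k" \<beta>s t as A "\<lambda>x. 2 * x + 1", OF \<beta>s 1] s(2) by metis
    moreover have "t \<circ> ?h = s'" by (auto simp: t_def)
    then have "sats ?N \<psi> t" unfolding sats\<psi> using s'(2) 1 s'(3) Q1(2) by auto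
    ultimately show "satisfiable_in ?N (map (conv_atom (\<lambda>x. 2 * x + 1) ?F) \<beta>s @ \<psi>)" by (auto simp: satisfiable_in_iff)
  next
    define \<gamma>s where "\<gamma>s = map (conv_atom (\<lambda>x. 2 * x + 1) ?F) \<beta>s @ \<psi>"
    assume "satisfiable_in ?N (map (conv_atom (\<lambda>x. 2 * x + 1) ?F) \<beta>s @ \<psi>)"
    then obtain t where t: "t \<in> assignments A" "sats ?N \<gamma>s t" by (auto simp: satisfiable_in_iff \<gamma>s_def)
    \<comment> \<open>The tuples of \<open>Q\<close> with which the instance is satisfiable in place
      of the constants. This nonempty primitive positive part of the minimal \<open>Q\<close> is all
      of \<open>Q\<close>, so it contains \<open>as\<close>.\<close>
    define R where "R = ppt \<sigma> A (map (\<lambda>i. Var (2 * i)) [0..<2 * k]) \<gamma>s"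
    have "csp_instance (neq_sig \<sigma>) \<gamma>s" using csp_instance_conv_const[OF \<beta>s] \<psi>_ok by (simp add: \<gamma>s_def)
    then have "R \<in> pp_rels \<sigma> A (2 * k)" using ppt_in_pp_rels[of "map (\<lambda>i. Var (2 * i)) [0..<2 * k]" \<sigma> \<gamma>s A] by (simp add: R_def)
    moreover have "R \<noteq> {}" using t by (auto simp: R_def ppt_def)
    moreover have "R \<subseteq> Q"
    proof
      fix x assume "x \<in> R"
      then obtain s where s: "s \<in> assignments A" "sats ?N \<gamma>s s" "x = map (val A s) (map (\<lambda>i. Var (2 * i)) [0..<2 * k])"
        unfolding R_def ppt_def by blast
      then have *: "sats ?N \<alpha>1 (s \<circ> ?h)" "\<forall>i < 2 * k. s (2 * i) = val A (s \<circ> ?h) (us1 ! i)" using sats\<psi> by (auto simp: \<gamma>s_def)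
      have "x = map (val A (s \<circ> ?h)) us1"
        unfolding s(3) using Q1(2) *(2) by (intro nth_equalityI) auto
      moreover have "s \<circ> ?h \<in> assignments A" using s(1) by (simp add: assignments_iff)
      ultimately show "x \<in> Q" using *(1) unfolding Q1(1) ppt_def by blast
    qed
    ultimately have "R = Q" by (rule Q(4))
    then obtain s where s: "s \<in> assignments A" "sats ?N \<gamma>s s" "as = map (val A s) (map (\<lambda>i. Var (2 * i)) [0..<2 * k])"
      using as unfolding R_def ppt_def by blast
    have "s (2 * i) = as ! i" if "i < 2 * k" for i using that by (simp add: s(3))
    then have "sats (const_expansion \<sigma> A as) \<beta>s (s \<circ> (\<lambda>x. 2 * x + 1))"
      using sats_conv_const[of \<sigma> "2 * k" \<beta>s s as A "\<lambda>x. 2 * x + 1", OF \<beta>s] s(2) by (simp only: \<gamma>s_def sats_simps)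
    moreover have "s \<circ> (\<lambda>x. 2 * x + 1) \<in> assignments A" using s(1) by (simp add: assignments_iff)
    ultimately show "satisfiable_in (const_expansion \<sigma> A as) \<beta>s" by (auto simp: satisfiable_in_iff)
  qed
  show ?thesis
    by (rule exI[of _ k], rule exI[of _ as], rule exI[of _ \<psi>]) (use len as_univ \<psi>_ok part1 part2 in blast)
qed

section \<open>Parsing instances by a counter transducer\<close>

lemma binary_0 [simp]: "binary 0 = []"
  by (simp add: binary.simps)

lemma binary_pos: "n > 0 \<Longrightarrow> binary n = odd n # binary (n div 2)"
  by (simp add: binary.simps[of n])

lemma binary_last: "binary n \<noteq> [] \<Longrightarrow> last (binary n)"
proof (induction n rule: less_induct)
  case (less n)
  then have n: "n > 0" by (cases n) auto
  show ?case
  proof (cases "n div 2 = 0")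
    case True
    then have "n = 1" using n by linarith
    then show ?thesis by (simp add: binary_pos)
  next
    case False
    moreover have "binary (n div 2) \<noteq> []" using False binary_pos[of "n div 2"] by simp
    ultimately show ?thesis using less.IH[of "n div 2"] n binary_pos[OF n] by simp
  qed
qed

text \<open>The least significant digit comes first, so a digit list is a code iff its last digit,
  if any, is 1. The parser checks this condition with the flag of its state
  \<open>V\<close>.\<close>

lemma ex_binary: "ds = [] \<or> last ds \<Longrightarrow> \<exists>n. ds = binary n"
proof (induction ds)
  case Nil
  show ?case by (rule exI[of _ 0]) simp
next
  case (Cons b ds)
  then obtain n where n: "ds = binary n" by (auto split: if_splits)
  have "n > 0 \<or> b" using Cons.prems n by (cases n) auto
  then have "b # ds = binary (2 * n + of_bool b)" using n by (auto simp: binary_pos)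
  then show ?case ..
qed

definition digits :: "bool list \<Rightarrow> bool list" where
  "digits ds = concat (map (\<lambda>b. [True, b]) ds)"

lemma enc_nat_digits: "enc_nat n = digits (binary n) @ [False]"
  by (simp add: enc_nat_def digits_def)

lemma digits_simps [simp]: "digits [] = []" "digits (b # ds) = True # b # digits ds"
  by (simp_all add: digits_def)

definition pre :: "'b list \<Rightarrow> 'b list option \<Rightarrow> 'b list option" where
  "pre x = map_option ((@) x)"

lemma pre_simps [simp]: "pre x None = None" "pre x (Some y) = Some (x @ y)" "pre [] z = z"
  "pre x z = None \<longleftrightarrow> z = None"
  by (cases z; simp add: pre_def)+

lemma pre_pre: "pre x (pre y z) = pre (x @ y) z"
  by (cases z) simp_all

text \<open>
  A state consists of a visibility flag, the output due when the pending terms have ended (after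
  which one more term follows), and the lexical state: inside a header \<open>H\<close>, inside a function
  symbol \<open>T\<close>, before the marker of a digit (the flag says that the last digit was 0) or before a
  digit of a variable. \<open>T []\<close> is the state between two tokens.
\<close>

datatype lex = H "bool list" | T "bool list" | V bool | D

type_synonym tstate = "bool \<times> bool list option \<times> lex"

text \<open>\<open>fo\<close> and \<open>vpre\<close> are the texts emitted for a function symbol
  and at the start of a variable. \<open>ho\<close> treats an atom header, where \<open>None\<close>
  stands for equality: it returns the text, the number of terms to expect, their visibility and
  possibly a text due later. In that last case the atom is binary and its two terms form separate
  groups with the text between them.\<close>

locale transducer =
  fixes S :: signature
    and fo :: "nat \<Rightarrow> bool list"
    and ho :: "nat option \<Rightarrow> bool \<Rightarrow> nat \<Rightarrow> bool list \<times> nat \<times> bool \<times> bool list option"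
    and vpre :: "bool list"
  assumes ho_None: "ho h sel j = (out, n, v, None) \<Longrightarrow> n = (case h of None \<Rightarrow> 2 | Some r \<Rightarrow> rel_ar S ! r)"
    and ho_Some: "ho h sel j = (out, n, v, Some out') \<Longrightarrow> n = 1 \<and> (case h of None \<Rightarrow> 2 | Some r \<Rightarrow> rel_ar S ! r) = 2 \<and> v"
begin

definition har :: "nat option \<Rightarrow> nat" where
  "har h = (case h of None \<Rightarrow> 2 | Some r \<Rightarrow> rel_ar S ! r)"

definition hcode :: "nat option \<Rightarrow> bool list" where
  "hcode h = (case h of None \<Rightarrow> [False] | Some r \<Rightarrow> True # enc_nat r)"

definition hdrs :: "nat option set" where
  "hdrs = insert None (Some ` {..<length (rel_ar S)})"

definition hdr :: "bool list \<Rightarrow> nat option option" where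
  "hdr u = (if \<exists>h \<in> hdrs. u = hcode h then Some (SOME h. h \<in> hdrs \<and> u = hcode h) else None)"

definition tok :: "bool list \<Rightarrow> nat option" where
  "tok u = (if \<exists>f < length (fun_ar S). u = True # enc_nat f then Some (SOME f. f < length (fun_ar S) \<and> u = True # enc_nat f) else None)"

text \<open>A longer buffer cannot be completed to a symbol; cutting off there keeps the set of
  states finite.\<close>

definition L :: nat where
  "L = Max (insert 0 (length ` (hcode ` hdrs \<union> (\<lambda>f. True # enc_nat f) ` {..<length (fun_ar S)})))"

lemma hcode_inj: "hcode h @ u = hcode h' @ u' \<Longrightarrow> h = h' \<and> u = u'"
  by (auto simp: hcode_def split: option.splits dest: enc_nat_inj)

lemma hdr_hcode: "h \<in> hdrs \<Longrightarrow> hdr (hcode h) = Some h"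
proof -
  assume h: "h \<in> hdrs"
  have "(SOME h'. h' \<in> hdrs \<and> hcode h = hcode h') = h"
    using h hcode_inj[of h "[]" _ "[]"] by (intro some_equality) auto
  then show ?thesis using h by (auto simp: hdr_def)
qed

lemma hdr_SomeD: "hdr u = Some h \<Longrightarrow> h \<in> hdrs \<and> u = hcode h"
  unfolding hdr_def using someI_ex[of "\<lambda>h. h \<in> hdrs \<and> u = hcode h"] by (auto split: if_splits)

lemma tok_code: "f < length (fun_ar S) \<Longrightarrow> tok (True # enc_nat f) = Some f"
proof -
  assume f: "f < length (fun_ar S)"
  have "(SOME f'. f' < length (fun_ar S) \<and> True # enc_nat f = True # enc_nat f') = f"
    using f enc_nat_inj[of f "[]" _ "[]"] by (intro some_equality) auto
  then show ?thesis using f by (auto simp: tok_def)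
qed

lemma tok_SomeD: "tok u = Some f \<Longrightarrow> f < length (fun_ar S) \<and> u = True # enc_nat f"
  unfolding tok_def using someI_ex[of "\<lambda>f. f < length (fun_ar S) \<and> u = True # enc_nat f"] by (auto split: if_splits)

lemma finite_hdrs: "finite hdrs"
  by (simp add: hdrs_def)

lemma length_hcode: "h \<in> hdrs \<Longrightarrow> length (hcode h) \<le> L"
  unfolding L_def by (rule Max_ge) (auto simp: finite_hdrs)

lemma length_fcode: "f < length (fun_ar S) \<Longrightarrow> length (True # enc_nat f) \<le> L"
  unfolding L_def by (rule Max_ge) (use finite_hdrs in simp, intro insertI2 imageI UnI2, simp)

definition emit :: "bool \<Rightarrow> bool list \<Rightarrow> bool list" where
  "emit v out = (if v then out else [])"

lemma emit_Nil [simp]: "emit v [] = []"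
  by (simp add: emit_def)

lemma emit_append: "emit v (x @ y) = emit v x @ emit v y"
  by (simp add: emit_def)

text \<open>\<open>trans\<close> lowers the counter when a term begins, so \<open>z\<close> refers
  to the terms after the current one, and together with \<open>a = 0\<close> it says that the group
  has ended. A due text is then released and one further term ordered, hence the increment
  1.\<close>

definition fin_tok :: "bool \<Rightarrow> bool list option \<Rightarrow> bool \<Rightarrow> bool list \<Rightarrow> nat \<Rightarrow> tstate \<times> bool list \<times> int" where
  "fin_tok v p z out a = (if z \<and> a = 0
     then (case p of None \<Rightarrow> ((v, None, T []), emit v out, 0) | Some out' \<Rightarrow> ((v, None, T []), emit v out @ out', 1))
     else ((v, p, T []), emit v out, int a))"

definition hstep :: "nat \<Rightarrow> bool \<Rightarrow> bool list \<Rightarrow> (tstate \<times> bool list \<times> int) option" where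
  "hstep j sel u = (case hdr u of
     Some h \<Rightarrow> (case ho h sel j of (out, n, v, p) \<Rightarrow> Some ((v, p, T []), out, int n))
   | None \<Rightarrow> if length u < L then Some ((True, None, H u), [], 0) else None)"

definition tstep :: "bool \<Rightarrow> bool list option \<Rightarrow> bool \<Rightarrow> bool list \<Rightarrow> (tstate \<times> bool list \<times> int) option" where
  "tstep v p z u = (case tok u of
     Some f \<Rightarrow> Some (fin_tok v p z (fo f) (fun_ar S ! f))
   | None \<Rightarrow> if length u < L then Some ((v, p, T u), [], 0) else None)"

text \<open>The flags \<open>z\<close> and \<open>sel\<close> say that no term is pending and that the current position is the selected one.\<close>

fun trans :: "nat \<Rightarrow> tstate \<Rightarrow> bool \<Rightarrow> bool \<Rightarrow> bool \<Rightarrow> (tstate \<times> bool list \<times> int) option" where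
  "trans j (v, p, H u) z sel b = hstep j sel (u @ [b])"
| "trans j (v, p, T u) z sel b =
    (if u = [] then
       if z then hstep j sel [b]
       else if b then Some ((v, p, T [True]), [], -1)
       else Some ((v, p, V False), emit v vpre, -1)
     else tstep v p z (u @ [b]))"
| "trans j (v, p, V e) z sel b =
    (if b then Some ((v, p, D), emit v [True], 0)
     else if e then None else Some (fin_tok v p z [False] 0))"
| "trans j (v, p, D) z sel b = Some ((v, p, V (\<not> b)), emit v [b], 0)"

text \<open>The run on an abstract counter \<open>c\<close>, with \<open>i\<close> the position of
  the next bit. \<open>None\<close> means a syntax error, which includes stopping inside an
  atom.\<close>

fun arun :: "int \<Rightarrow> nat \<Rightarrow> int \<Rightarrow> tstate \<Rightarrow> int \<Rightarrow> bool list \<Rightarrow> bool list option" where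
  "arun pos j i q c [] = (if snd (snd q) = T [] \<and> c = 0 then Some [] else None)"
| "arun pos j i q c (b # bs) = (case trans j q (c = 0) (i = pos) b of
     None \<Rightarrow> None
   | Some (q', out, d) \<Rightarrow> pre out (arun pos j (i + 1) q' (c + d) bs))"

text \<open>The rest of the run at the end of a token with \<open>c\<close> terms pending, a due
  text being released if there are none. It spares the lemmas on terms the distinction whether a
  term is the last of its group.\<close>

definition cont :: "int \<Rightarrow> nat \<Rightarrow> int \<Rightarrow> bool \<Rightarrow> bool list option \<Rightarrow> nat \<Rightarrow> bool list \<Rightarrow> bool list option" where
  "cont pos j i v p c w = (if c = 0
     then (case p of None \<Rightarrow> arun pos j i (v, None, T []) 0 w
           | Some out \<Rightarrow> pre out (arun pos j i (v, None, T []) 1 w))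
     else arun pos j i (v, p, T []) (int c) w)"

fun ot :: "trm \<Rightarrow> bool list" where
  "ot (Var x) = vpre @ enc_nat x"
| "ot (Fn f ts) = fo f @ concat (map ot ts)"

text \<open>An atom is identified by the position of the last bit of its header, the moment at which
  the header is recognised and the treatment of the atom must be known.\<close>

fun oa :: "int \<Rightarrow> nat \<Rightarrow> int \<Rightarrow> nat option \<Rightarrow> trm list \<Rightarrow> bool list" where
  "oa pos j i h ts = (case ho h (i + int (length (hcode h)) - 1 = pos) j of
     (out, n, v, None) \<Rightarrow> out @ emit v (concat (map ot ts))
   | (out, n, v, Some out') \<Rightarrow> out @ ot (ts ! 0) @ out' @ ot (ts ! 1))"

fun ahead :: "atom \<Rightarrow> nat option" where
  "ahead (Eq s t) = None"
| "ahead (Rel r ts) = Some r"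

fun aargs :: "atom \<Rightarrow> trm list" where
  "aargs (Eq s t) = [s, t]"
| "aargs (Rel r ts) = ts"

fun oc :: "int \<Rightarrow> nat \<Rightarrow> int \<Rightarrow> atom list \<Rightarrow> bool list" where
  "oc pos j i [] = []"
| "oc pos j i (\<alpha> # \<alpha>s) = oa pos j i (ahead \<alpha>) (aargs \<alpha>) @ oc pos j (i + int (length (enc_atom \<alpha>))) \<alpha>s"

section \<open>The run on the code of an instance\<close>

lemma enc_atom_eq: "enc_atom \<alpha> = hcode (ahead \<alpha>) @ concat (map enc_trm (aargs \<alpha>))"
  by (cases \<alpha>) (auto simp: hcode_def)

lemma atom_ok_iff: "atom_ok S \<alpha> \<longleftrightarrow> ahead \<alpha> \<in> hdrs \<and> length (aargs \<alpha>) = har (ahead \<alpha>) \<and> (\<forall>t \<in> set (aargs \<alpha>). trm_ok S t)"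
  by (cases \<alpha>) (auto simp: hdrs_def har_def)

lemma ex_atom: "h \<in> hdrs \<Longrightarrow> length ts = har h \<Longrightarrow> \<exists>\<alpha>. ahead \<alpha> = h \<and> aargs \<alpha> = ts"
proof (cases h)
  case None
  assume "length ts = har h"
  then obtain s t where "ts = [s, t]" using None by (auto simp: har_def numeral_2_eq_2 length_Suc_conv)
  then show ?thesis using None by (intro exI[of _ "Eq s t"]) simp
next
  case (Some r)
  then show ?thesis by (intro exI[of _ "Rel r ts"]) simp
qed

text \<open>The next bit starts a header, where \<open>hstep\<close> discards visibility and due
  text; at the end of the word neither is inspected.\<close>

lemma arun_boundary: "arun pos j i (v, p, T []) 0 w = arun pos j i (True, None, T []) 0 w"
  by (cases w) auto

lemma arun_fin_tok:
  "(case fin_tok v p (c = 0) out a of (q', out', d) \<Rightarrow> pre out' (arun pos j i q' (int c + d) w)) =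
    pre (emit v out) (cont pos j i v p (c + a) w)"
  by (auto simp: fin_tok_def cont_def pre_pre split: option.splits)

lemma cont_None_iff:
  "cont pos j i v p (c + a) w = None \<longleftrightarrow>
    arun pos j i (fst (fin_tok v p (c = 0) out a)) (int c + snd (snd (fin_tok v p (c = 0) out a))) w = None"
  by (auto simp: fin_tok_def cont_def split: option.splits)

lemma arun_var_digits:
  "ds = [] \<and> \<not> e \<or> ds \<noteq> [] \<and> last ds \<Longrightarrow>
    arun pos j i (v, p, V e) (int c) (digits ds @ False # w) =
      pre (emit v (digits ds @ [False])) (cont pos j (i + int (length (digits ds)) + 1) v p c w)"
proof (induction ds arbitrary: e i)
  case Nil
  then show ?case using arun_fin_tok[of pos j "i + 1" c w v p "[False]" 0] by (simp add: prod.case_eq_if)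
next
  case (Cons b ds)
  have *: "arun pos j (i + 2) (v, p, V (\<not> b)) (int c) (digits ds @ False # w) =
    pre (emit v (digits ds @ [False])) (cont pos j (i + 2 + int (length (digits ds)) + 1) v p c w)"
    by (rule Cons.IH) (use Cons.prems in \<open>auto split: if_splits\<close>)
  have "emit v [True] @ emit v [b] @ emit v (digits ds @ [False]) = emit v (digits (b # ds) @ [False])"
    by (simp add: emit_def)
  then show ?case using * by (simp add: pre_pre add.assoc add.commute)
qed

text \<open>The codes are prefix free, so a symbol is never recognised too early.\<close>

lemma not_prefix_codeD:
  assumes "tok (u @ x) = Some f" "tok u' = Some f'" "u @ x = u' @ y"
  shows "y = []"
proof -
  have "enc_nat f = enc_nat f' @ y" using assms tok_SomeD by (metis append_Cons list.inject)
  then show ?thesis using enc_nat_inj[of f "[]" f' y] by simp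
qed

lemma arun_tok:
  "x \<noteq> [] \<Longrightarrow> u \<noteq> [] \<Longrightarrow> tok (u @ x) = Some f \<Longrightarrow>
    arun pos j i (v, p, T u) (int c) (x @ w) =
      pre (emit v (fo f)) (cont pos j (i + int (length x)) v p (c + fun_ar S ! f) w)"
proof (induction x arbitrary: u i)
  case (Cons b x)
  show ?case
  proof (cases "x = []")
    case True
    then show ?thesis
      using Cons.prems arun_fin_tok[of pos j "i + 1" c w v p "fo f" "fun_ar S ! f"] by (simp add: tstep_def prod.case_eq_if)
  next
    case False
    have "tok (u @ [b]) = None"
    proof (rule ccontr)
      assume "tok (u @ [b]) \<noteq> None"
      then obtain f' where "tok (u @ [b]) = Some f'" by blast
      from not_prefix_codeD[OF Cons.prems(3) this, of x] show False using False by simp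
    qed
    moreover have "length (u @ [b]) < L"
      using tok_SomeD[OF Cons.prems(3)] length_fcode[of f] False by (metis append_assoc append_Cons append_Nil length_append length_greater_0_conv less_add_same_cancel1 order_less_le_trans)
    ultimately have "arun pos j i (v, p, T u) (int c) ((b # x) @ w) = arun pos j (i + 1) (v, p, T (u @ [b])) (int c) (x @ w)"
      using Cons.prems by (simp add: tstep_def)
    also have "\<dots> = pre (emit v (fo f)) (cont pos j (i + 1 + int (length x)) v p (c + fun_ar S ! f) w)"
      by (rule Cons.IH) (use Cons.prems False in auto)
    finally show ?thesis by (simp add: add.assoc)
  qed
qed simp

text \<open>The behaviour on single terms is an assumption so that the induction hypothesis of
  \<open>arun_term\<close> can be supplied for the arguments of a function symbol.\<close>

lemma cont_terms:
  assumes "\<And>t i c w. t \<in> set ts \<Longrightarrow> arun pos j i (v, p, T []) (int c + 1) (enc_trm t @ w) =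
      pre (emit v (ot t)) (cont pos j (i + int (length (enc_trm t))) v p c w)"
  shows "cont pos j i v p (c + length ts) (concat (map enc_trm ts) @ w) =
      pre (emit v (concat (map ot ts))) (cont pos j (i + int (length (concat (map enc_trm ts)))) v p c w)"
  using assms
proof (induction ts arbitrary: i)
  case (Cons t ts)
  let ?w = "concat (map enc_trm ts) @ w"
  have "cont pos j i v p (c + length (t # ts)) (enc_trm t @ ?w) = arun pos j i (v, p, T []) (int (c + length ts) + 1) (enc_trm t @ ?w)"
    by (simp add: cont_def algebra_simps)
  also have "\<dots> = pre (emit v (ot t)) (cont pos j (i + int (length (enc_trm t))) v p (c + length ts) ?w)"
    by (rule Cons.prems) simp
  also have "\<dots> = pre (emit v (ot t)) (pre (emit v (concat (map ot ts)))
      (cont pos j (i + int (length (enc_trm t)) + int (length (concat (map enc_trm ts)))) v p c w))"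
    by (subst Cons.IH) (use Cons.prems in auto)
  finally show ?case by (simp add: pre_pre emit_append add.assoc)
qed simp

text \<open>The first bit of a term lowers the counter, a function symbol raises it by its arity,
  and the arguments use this up again: exactly one of \<open>c + 1\<close> pending terms is
  consumed.\<close>

lemma arun_term:
  "trm_ok S t \<Longrightarrow> arun pos j i (v, p, T []) (int c + 1) (enc_trm t @ w) =
      pre (emit v (ot t)) (cont pos j (i + int (length (enc_trm t))) v p c w)"
proof (induction t arbitrary: i c w)
  case (Var x)
  have "arun pos j (i + 1) (v, p, V False) (int c) (digits (binary x) @ False # w) =
      pre (emit v (digits (binary x) @ [False])) (cont pos j (i + 1 + int (length (digits (binary x))) + 1) v p c w)"
    by (rule arun_var_digits) (use binary_last in auto)
  then show ?case by (simp add: enc_nat_digits pre_pre emit_append algebra_simps)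
next
  case (Fn f ts)
  have f: "f < length (fun_ar S)" "length ts = fun_ar S ! f" using Fn.prems by auto
  have "arun pos j (i + 1) (v, p, T [True]) (int c) (enc_nat f @ concat (map enc_trm ts) @ w) =
    pre (emit v (fo f)) (cont pos j (i + 1 + int (length (enc_nat f))) v p (c + length ts) (concat (map enc_trm ts) @ w))"
    unfolding f(2) by (rule arun_tok) (use tok_code[OF f(1)] in \<open>auto simp: enc_nat_def\<close>)
  also have "\<dots> = pre (emit v (fo f)) (pre (emit v (concat (map ot ts)))
      (cont pos j (i + 1 + int (length (enc_nat f)) + int (length (concat (map enc_trm ts)))) v p c w))"
    by (subst cont_terms) (use Fn in auto)
  finally show ?case by (simp add: pre_pre emit_append algebra_simps)
qed

lemma cont_terms_ok:
  "\<forall>t \<in> set ts. trm_ok S t \<Longrightarrow> cont pos j i v p (c + length ts) (concat (map enc_trm ts) @ w) =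
      pre (emit v (concat (map ot ts))) (cont pos j (i + int (length (concat (map enc_trm ts)))) v p c w)"
  by (rule cont_terms, rule arun_term) auto

lemma arun_header:
  "x \<noteq> [] \<Longrightarrow> u \<noteq> [] \<Longrightarrow> u @ x = hcode h \<Longrightarrow> h \<in> hdrs \<Longrightarrow> ho h (i + int (length x) - 1 = pos) j = (out, n, v', p') \<Longrightarrow>
    arun pos j i (v, p, H u) 0 (x @ w) =
      pre out (arun pos j (i + int (length x)) (v', p', T []) (int n) w)"
proof (induction x arbitrary: u i v p)
  case (Cons b x)
  show ?case
  proof (cases "x = []")
    case True
    then have "hdr (u @ [b]) = Some h" using Cons.prems hdr_hcode by simp
    then show ?thesis using Cons.prems True by (simp add: hstep_def)
  next
    case False
    have "hdr (u @ [b]) = None"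
    proof (rule ccontr)
      assume "hdr (u @ [b]) \<noteq> None"
      then obtain h' where "hdr (u @ [b]) = Some h'" by blast
      then have "u @ [b] = hcode h'" using hdr_SomeD by blast
      then have "hcode h @ [] = hcode h' @ x" using Cons.prems(3) by (metis append.assoc append_Cons append_Nil append_Nil2)
      from hcode_inj[OF this] show False using False by simp
    qed
    moreover have "length (u @ [b]) < L"
    proof -
      have "length (hcode h) = length u + 1 + length x" using Cons.prems(3) by (metis length_append length_Cons add.assoc plus_1_eq_Suc)
      then show ?thesis using length_hcode[OF Cons.prems(4)] False by (cases x) auto
    qed
    ultimately have "arun pos j i (v, p, H u) 0 ((b # x) @ w) = arun pos j (i + 1) (True, None, H (u @ [b])) 0 (x @ w)"
      by (simp add: hstep_def)
    also have "\<dots> = pre out (arun pos j (i + 1 + int (length x)) (v', p', T []) (int n) w)"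
      by (rule Cons.IH) (use Cons.prems False in \<open>auto simp: algebra_simps\<close>)
    finally show ?thesis by (simp add: add.assoc)
  qed
qed simp

lemma arun_hcode:
  assumes "h \<in> hdrs" "ho h (i + int (length (hcode h)) - 1 = pos) j = (out, n, v', p')"
  shows "arun pos j i (v, p, T []) 0 (hcode h @ w) =
      pre out (arun pos j (i + int (length (hcode h))) (v', p', T []) (int n) w)"
proof (cases h)
  case None
  then have "hcode h = [False]" by (simp add: hcode_def)
  moreover from this have "hdr [False] = Some h" using hdr_hcode[OF assms(1)] by simp
  ultimately show ?thesis using assms(2) by (simp add: hstep_def)
next
  case (Some r)
  then have code: "hcode h = True # enc_nat r" "enc_nat r \<noteq> []" by (simp_all add: hcode_def enc_nat_def)
  have "hdr [True] = None"
  proof (rule ccontr)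
    assume "hdr [True] \<noteq> None"
    then obtain h' where "hdr [True] = Some h'" by blast
    then have "[True] = hcode h'" using hdr_SomeD by blast
    then have "hcode h @ [] = hcode h' @ enc_nat r" using code(1) by (metis append_Cons append_Nil append_Nil2)
    from hcode_inj[OF this] show False using code(2) by simp
  qed
  moreover have "1 < L" using length_hcode[OF assms(1)] code by (cases "enc_nat r") auto
  ultimately have "arun pos j i (v, p, T []) 0 (hcode h @ w) = arun pos j (i + 1) (True, None, H [True]) 0 (enc_nat r @ w)"
    using code by (simp add: hstep_def)
  also have "\<dots> = pre out (arun pos j (i + 1 + int (length (enc_nat r))) (v', p', T []) (int n) w)"
    by (rule arun_header[where h = h]) (use assms code in \<open>auto simp: algebra_simps\<close>)
  finally show ?thesis using code by (simp add: algebra_simps)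
qed

lemma arun_atom:
  assumes "atom_ok S \<alpha>"
  shows "arun pos j i (v, p, T []) 0 (enc_atom \<alpha> @ w) =
    pre (oa pos j i (ahead \<alpha>) (aargs \<alpha>)) (arun pos j (i + int (length (enc_atom \<alpha>))) (True, None, T []) 0 w)"
proof -
  define h ts where "h = ahead \<alpha>" and "ts = aargs \<alpha>"
  have ok: "h \<in> hdrs" "length ts = har h" "\<forall>t \<in> set ts. trm_ok S t" using assms by (auto simp: atom_ok_iff h_def ts_def)
  have enc: "enc_atom \<alpha> = hcode h @ concat (map enc_trm ts)" by (simp add: enc_atom_eq h_def ts_def)
  obtain out n v' p' where ho: "ho h (i + int (length (hcode h)) - 1 = pos) j = (out, n, v', p')" by (metis prod_cases4)
  let ?i = "i + int (length (hcode h))"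
  have hd: "arun pos j i (v, p, T []) 0 (enc_atom \<alpha> @ w) =
    pre out (arun pos j ?i (v', p', T []) (int n) (concat (map enc_trm ts) @ w))"
    unfolding enc append.assoc by (rule arun_hcode[OF ok(1) ho])
  have "pre out (arun pos j ?i (v', p', T []) (int n) (concat (map enc_trm ts) @ w)) =
    pre (oa pos j i h ts) (arun pos j (i + int (length (enc_atom \<alpha>))) (True, None, T []) 0 w)"
  proof (cases p')
    case None
    then have "n = length ts" using ho ho_None ok(2) unfolding har_def by metis
    then have "arun pos j ?i (v', p', T []) (int n) (concat (map enc_trm ts) @ w) = cont pos j ?i v' None (0 + length ts) (concat (map enc_trm ts) @ w)"
      using None by (simp add: cont_def)
    also have "\<dots> = pre (emit v' (concat (map ot ts))) (cont pos j (?i + int (length (concat (map enc_trm ts)))) v' None 0 w)"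
      by (rule cont_terms_ok[OF ok(3)])
    also have "cont pos j (?i + int (length (concat (map enc_trm ts)))) v' None 0 w = arun pos j (i + int (length (enc_atom \<alpha>))) (True, None, T []) 0 w"
      unfolding enc by (simp add: cont_def arun_boundary[of _ _ _ v'] add.assoc)
    finally show ?thesis using ho None by (simp add: pre_pre)
  next
    \<comment> \<open>The header announces only the first term. The end of this group releases
      \<open>out'\<close> and orders the second term.\<close>
    case (Some out')
    then have n: "n = 1" "har h = 2" "v'" using ho_Some[of h _ j out n v' out'] ho unfolding har_def by auto
    then obtain s t where ts: "ts = [s, t]" using ok(2) by (auto simp: numeral_2_eq_2 length_Suc_conv)
    have st: "trm_ok S s" "trm_ok S t" using ok(3) ts by auto
    have "arun pos j ?i (v', p', T []) (int n) (concat (map enc_trm ts) @ w) = arun pos j ?i (v', Some out', T []) (int 0 + 1) (enc_trm s @ enc_trm t @ w)"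
      using n Some ts by simp
    also have "\<dots> = pre (emit v' (ot s)) (cont pos j (?i + int (length (enc_trm s))) v' (Some out') 0 (enc_trm t @ w))"
      by (rule arun_term[OF st(1)])
    also have "cont pos j (?i + int (length (enc_trm s))) v' (Some out') 0 (enc_trm t @ w) =
      pre out' (arun pos j (?i + int (length (enc_trm s))) (v', None, T []) (int 0 + 1) (enc_trm t @ w))"
      by (simp add: cont_def)
    also have "arun pos j (?i + int (length (enc_trm s))) (v', None, T []) (int 0 + 1) (enc_trm t @ w) =
      pre (emit v' (ot t)) (cont pos j (?i + int (length (enc_trm s)) + int (length (enc_trm t))) v' None 0 w)"
      by (rule arun_term[OF st(2)])
    also have "cont pos j (?i + int (length (enc_trm s)) + int (length (enc_trm t))) v' None 0 w = arun pos j (i + int (length (enc_atom \<alpha>))) (True, None, T []) 0 w"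
      unfolding enc ts by (simp add: cont_def arun_boundary[of _ _ _ v'] add.assoc)
    finally show ?thesis using ho Some ts n(3) by (simp add: pre_pre emit_def)
  qed
  then show ?thesis using hd by (simp add: h_def ts_def)
qed

lemma arun_conj:
  "csp_instance S \<alpha>s \<Longrightarrow> arun pos j i (True, None, T []) 0 (enc_conj \<alpha>s) = Some (oc pos j i \<alpha>s)"
proof (induction \<alpha>s arbitrary: i)
  case Nil
  then show ?case by (simp add: enc_conj_def)
next
  case (Cons \<alpha> \<alpha>s)
  have "enc_conj (\<alpha> # \<alpha>s) = enc_atom \<alpha> @ enc_conj \<alpha>s" by (simp add: enc_conj_def)
  then show ?case using Cons arun_atom[of \<alpha> pos j i True None "enc_conj \<alpha>s"] by simp
qed

section \<open>Words with a successful run are codes of instances\<close>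

lemma arun_var_inv:
  "arun pos j i (v, p, V e) (int c) w \<noteq> None \<Longrightarrow>
    \<exists>ds w' i'. w = digits ds @ False # w' \<and> (ds = [] \<and> \<not> e \<or> ds \<noteq> [] \<and> last ds) \<and> cont pos j i' v p c w' \<noteq> None"
proof (induction w arbitrary: e i rule: length_induct)
  case (1 w)
  then obtain b w1 where w: "w = b # w1" by (cases w) auto
  show ?case
  proof (cases b)
    case False
    then have "\<not> e" using 1(2) w by auto
    then have "cont pos j (i + 1) v p c w1 \<noteq> None"
      using 1(2) w False cont_None_iff[of pos j "i + 1" v p c 0 w1 "[False]"] \<open>\<not> e\<close>
      by (simp add: prod.case_eq_if del: not_None_eq)
    then show ?thesis using w False \<open>\<not> e\<close> by (intro exI[of _ "[]"] exI[of _ w1] exI[of _ "i + 1"]) simp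
  next
    case True
    then have *: "arun pos j (i + 1) (v, p, D) (int c) w1 \<noteq> None" using 1(2) w by auto
    then obtain b' w2 where w1: "w1 = b' # w2" by (cases w1) auto
    then have "arun pos j (i + 1 + 1) (v, p, V (\<not> b')) (int c) w2 \<noteq> None" using * by auto
    then obtain ds w' i' where "w2 = digits ds @ False # w'" "ds = [] \<and> b' \<or> ds \<noteq> [] \<and> last ds" "cont pos j i' v p c w' \<noteq> None"
      using 1(1)[rule_format, of w2 "i + 1 + 1" "\<not> b'"] w w1 by auto
    then show ?thesis using w w1 True by (intro exI[of _ "b' # ds"] exI[of _ w'] exI[of _ i']) auto
  qed
qed

lemma arun_tok_inv:
  "u \<noteq> [] \<Longrightarrow> arun pos j i (v, p, T u) (int c) w \<noteq> None \<Longrightarrow>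
    \<exists>x w' f i'. w = x @ w' \<and> tok (u @ x) = Some f \<and> cont pos j i' v p (c + fun_ar S ! f) w' \<noteq> None"
proof (induction w arbitrary: u i)
  case (Cons b w)
  show ?case
  proof (cases "tok (u @ [b])")
    case (Some f)
    then have "cont pos j (i + 1) v p (c + fun_ar S ! f) w \<noteq> None"
      using Cons.prems cont_None_iff[of pos j "i + 1" v p c "fun_ar S ! f" w "fo f"] Some
      by (simp add: tstep_def prod.case_eq_if del: not_None_eq)
    then show ?thesis using Some by (intro exI[of _ "[b]"] exI[of _ w] exI[of _ f] exI[of _ "i + 1"]) simp
  next
    case None
    then have "arun pos j (i + 1) (v, p, T (u @ [b])) (int c) w \<noteq> None"
      using Cons.prems by (auto simp: tstep_def split: if_splits)
    from Cons.IH[OF _ this] obtain x w' f i' where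
      "w = x @ w'" "tok ((u @ [b]) @ x) = Some f" "cont pos j i' v p (c + fun_ar S ! f) w' \<noteq> None"
      by (elim meta_impE exE conjE) (simp, rule that)
    then show ?thesis by (intro exI[of _ "b # x"] exI[of _ w'] exI[of _ f] exI[of _ i']) simp
  qed
qed simp

text \<open>Reading a function symbol trades one pending term for its arguments. The rest of the
  word thus parses into a longer list, whose initial segment of the right length becomes the
  argument list.\<close>

lemma cont_terms_inv:
  "cont pos j i v p n w \<noteq> None \<Longrightarrow>
    \<exists>ts w' i'. length ts = n \<and> (\<forall>t \<in> set ts. trm_ok S t) \<and> w = concat (map enc_trm ts) @ w' \<and> cont pos j i' v p 0 w' \<noteq> None"
proof (induction w arbitrary: i n rule: length_induct)
  case (1 w)
  show ?case
  proof (cases n)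
    case 0
    then show ?thesis using 1(2) by (intro exI[of _ "[]"] exI[of _ w] exI[of _ i]) simp
  next
    case (Suc c)
    then have run: "arun pos j i (v, p, T []) (int c + 1) w \<noteq> None" using 1(2) by (simp add: cont_def algebra_simps)
    then obtain b w1 where w: "w = b # w1" by (cases w) auto
    show ?thesis
    proof (cases b)
      case False
      then have "arun pos j (i + 1) (v, p, V False) (int c) w1 \<noteq> None" using run w by auto
      from arun_var_inv[OF this] obtain ds w' i' where ds: "w1 = digits ds @ False # w'"
        "ds = [] \<and> \<not> False \<or> ds \<noteq> [] \<and> last ds" "cont pos j i' v p c w' \<noteq> None"
        by (elim exE conjE) (rule that)
      obtain x where x: "ds = binary x" using ex_binary[of ds] ds(2) by blast
      have "length w' < length w" using w ds(1) by simp
      from 1(1)[rule_format, OF this ds(3)] obtain ts w'' i'' where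
        "length ts = c" "\<forall>t \<in> set ts. trm_ok S t" "w' = concat (map enc_trm ts) @ w''" "cont pos j i'' v p 0 w'' \<noteq> None"
        by (elim exE conjE) (rule that)
      then show ?thesis using Suc w False ds(1) x
        by (intro exI[of _ "Var x # ts"] exI[of _ w''] exI[of _ i'']) (simp add: enc_nat_digits)
    next
      case True
      then have "arun pos j (i + 1) (v, p, T [True]) (int c) w1 \<noteq> None" using run w by auto
      from arun_tok_inv[OF _ this] obtain x w' f i' where
        x: "w1 = x @ w'" "tok ([True] @ x) = Some f" "cont pos j i' v p (c + fun_ar S ! f) w' \<noteq> None"
        by (elim meta_impE exE conjE) (simp, rule that)
      have f: "f < length (fun_ar S)" "x = enc_nat f" using tok_SomeD[OF x(2)] by auto
      have "length w' < length w" using w x(1) by simp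
      from 1(1)[rule_format, OF this x(3)] obtain ts w'' i'' where
        ts: "length ts = c + fun_ar S ! f" "\<forall>t \<in> set ts. trm_ok S t" "w' = concat (map enc_trm ts) @ w''" "cont pos j i'' v p 0 w'' \<noteq> None"
        by (elim exE conjE) (rule that)
      let ?a = "fun_ar S ! f"
      have "concat (map enc_trm ts) = concat (map enc_trm (take ?a ts)) @ concat (map enc_trm (drop ?a ts))"
        by (metis append_take_drop_id concat_append map_append)
      moreover have "trm_ok S (Fn f (take ?a ts))" using f(1) ts(1,2) by (auto dest: in_set_takeD)
      moreover have "\<forall>t \<in> set (drop ?a ts). trm_ok S t" using ts(2) by (auto dest: in_set_dropD)
      ultimately show ?thesis using Suc w True x(1) f(2) ts
        by (intro exI[of _ "Fn f (take ?a ts) # drop ?a ts"] exI[of _ w''] exI[of _ i'']) simp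
    qed
  qed
qed

lemma arun_header_inv:
  "arun pos j i (v, p, H u) 0 w \<noteq> None \<Longrightarrow>
    \<exists>x w' h sel out n v' p' i'. w = x @ w' \<and> hdr (u @ x) = Some h \<and> ho h sel j = (out, n, v', p') \<and>
      arun pos j i' (v', p', T []) (int n) w' \<noteq> None"
proof (induction w arbitrary: u i v p)
  case (Cons b w)
  show ?case
  proof (cases "hdr (u @ [b])")
    case (Some h)
    obtain out n v' p' where ho: "ho h (i = pos) j = (out, n, v', p')" by (metis prod_cases4)
    then have "arun pos j (i + 1) (v', p', T []) (int n) w \<noteq> None" using Cons.prems Some by (simp add: hstep_def)
    then show ?thesis using Some ho
      by (intro exI[of _ "[b]"] exI[of _ w] exI[of _ h] exI[of _ "i = pos"] exI[of _ out] exI[of _ n] exI[of _ v'] exI[of _ p'] exI[of _ "i + 1"]) simp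
  next
    case None
    then have "arun pos j (i + 1) (True, None, H (u @ [b])) 0 w \<noteq> None"
      using Cons.prems by (auto simp: hstep_def split: if_splits)
    from Cons.IH[OF this] obtain x w' h sel out n v' p' i' where
      "w = x @ w'" "hdr ((u @ [b]) @ x) = Some h" "ho h sel j = (out, n, v', p')" "arun pos j i' (v', p', T []) (int n) w' \<noteq> None"
      by (elim exE conjE) (rule that)
    then show ?thesis
      by (intro exI[of _ "b # x"] exI[of _ w'] exI[of _ h] exI[of _ sel] exI[of _ out] exI[of _ n] exI[of _ v'] exI[of _ p'] exI[of _ i']) simp
  qed
qed simp

lemma arun_hcode_inv:
  assumes "arun pos j i (v, p, T []) 0 w \<noteq> None" "w \<noteq> []"
  shows "\<exists>w' h sel out n v' p' i'. w = hcode h @ w' \<and> h \<in> hdrs \<and> ho h sel j = (out, n, v', p') \<and>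
      arun pos j i' (v', p', T []) (int n) w' \<noteq> None"
proof -
  obtain b w1 where w: "w = b # w1" using assms(2) by (cases w) auto
  \<comment> \<open>Between atoms the parser acts like a header state with empty buffer, so the
    general statement on headers applies.\<close>
  have "arun pos j i (v, p, H []) 0 w = arun pos j i (v, p, T []) 0 w" using w by simp
  with assms(1) have "arun pos j i (v, p, H []) 0 w \<noteq> None" by simp
  from arun_header_inv[OF this] obtain x w' h sel out n v' p' i' where
    "w = x @ w'" "hdr ([] @ x) = Some h" "ho h sel j = (out, n, v', p')" "arun pos j i' (v', p', T []) (int n) w' \<noteq> None"
    by (elim exE conjE) (rule that)
  then show ?thesis using hdr_SomeD[of x h]
    by (intro exI[of _ w'] exI[of _ h] exI[of _ sel] exI[of _ out] exI[of _ n] exI[of _ v'] exI[of _ p'] exI[of _ i']) simp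
qed

lemma arun_conj_inv:
  "arun pos j i (v, p, T []) 0 w \<noteq> None \<Longrightarrow> \<exists>\<alpha>s. csp_instance S \<alpha>s \<and> w = enc_conj \<alpha>s"
proof (induction w arbitrary: i v p rule: length_induct)
  case (1 w)
  show ?case
  proof (cases "w = []")
    case True
    then show ?thesis by (intro exI[of _ "[]"]) (simp add: enc_conj_def)
  next
    case False
    obtain w1 h sel out n v' p' i' where h: "w = hcode h @ w1" "h \<in> hdrs" "ho h sel j = (out, n, v', p')"
      "arun pos j i' (v', p', T []) (int n) w1 \<noteq> None"
      using arun_hcode_inv[OF 1(2) False] by (elim exE conjE) (rule that)
    have "\<exists>ts w' i' v'. length ts = har h \<and> (\<forall>t \<in> set ts. trm_ok S t) \<and> w1 = concat (map enc_trm ts) @ w' \<and>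
      arun pos j i' (v', None, T []) 0 w' \<noteq> None"
    proof (cases p')
      case None
      then have n: "n = har h" using h(3) ho_None unfolding har_def by metis
      have "cont pos j i' v' None n w1 \<noteq> None" using h(4) None by (cases n) (simp_all add: cont_def)
      from cont_terms_inv[OF this] obtain ts w2 i2 where "length ts = n" "\<forall>t \<in> set ts. trm_ok S t"
        "w1 = concat (map enc_trm ts) @ w2" "cont pos j i2 v' None 0 w2 \<noteq> None" by (elim exE conjE) (rule that)
      then show ?thesis unfolding n by (intro exI[of _ ts] exI[of _ w2] exI[of _ i2] exI[of _ v']) (simp add: cont_def)
    next
      case (Some out')
      then have n: "n = 1" "har h = 2" using ho_Some[of h sel j out n v' out'] h(3) unfolding har_def by auto
      then have "cont pos j i' v' (Some out') 1 w1 \<noteq> None" using h(4) Some by (simp add: cont_def)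
      from cont_terms_inv[OF this] obtain ss w2 i2 where s: "length ss = 1" "\<forall>t \<in> set ss. trm_ok S t"
        "w1 = concat (map enc_trm ss) @ w2" "cont pos j i2 v' (Some out') 0 w2 \<noteq> None" by (elim exE conjE) (rule that)
      then have "cont pos j i2 v' None 1 w2 \<noteq> None" by (simp add: cont_def)
      from cont_terms_inv[OF this] obtain ts w3 i3 where t: "length ts = 1" "\<forall>t \<in> set ts. trm_ok S t"
        "w2 = concat (map enc_trm ts) @ w3" "cont pos j i3 v' None 0 w3 \<noteq> None" by (elim exE conjE) (rule that)
      show ?thesis
        by (intro exI[of _ "ss @ ts"] exI[of _ w3] exI[of _ i3] exI[of _ v']) (use s t n in \<open>auto simp: cont_def\<close>)
    qed
    then obtain ts w' i2 v2 where ts: "length ts = har h" "\<forall>t \<in> set ts. trm_ok S t" "w1 = concat (map enc_trm ts) @ w'"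
      "arun pos j i2 (v2, None, T []) 0 w' \<noteq> None" by (elim exE conjE) (rule that)
    obtain \<alpha> where \<alpha>: "ahead \<alpha> = h" "aargs \<alpha> = ts" using ex_atom[OF h(2) ts(1)] by blast
    have w: "w = enc_atom \<alpha> @ w'" using h(1) ts(3) \<alpha> by (simp add: enc_atom_eq)
    have "enc_atom \<alpha> \<noteq> []" by (cases \<alpha>) auto
    then have "length w' < length w" using w by simp
    from 1(1)[rule_format, OF this ts(4)] obtain \<alpha>s where "csp_instance S \<alpha>s" "w' = enc_conj \<alpha>s"
      by (elim exE conjE) (rule that)
    moreover have "atom_ok S \<alpha>" using \<alpha> h(2) ts(1,2) by (simp add: atom_ok_iff)
    ultimately show ?thesis using w by (intro exI[of _ "\<alpha> # \<alpha>s"]) (simp add: enc_conj_def)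
  qed
qed

lemma arun_eq_Some_iff:
  "arun pos j 0 (True, None, T []) 0 w = Some out \<longleftrightarrow> (\<exists>\<alpha>s. csp_instance S \<alpha>s \<and> w = enc_conj \<alpha>s \<and> out = oc pos j 0 \<alpha>s)"
proof
  assume *: "arun pos j 0 (True, None, T []) 0 w = Some out"
  then obtain \<alpha>s where "csp_instance S \<alpha>s" "w = enc_conj \<alpha>s" using arun_conj_inv by blast
  then show "\<exists>\<alpha>s. csp_instance S \<alpha>s \<and> w = enc_conj \<alpha>s \<and> out = oc pos j 0 \<alpha>s" using * arun_conj by auto
qed (auto simp: arun_conj)

text \<open>A finite superset of the reachable states. Due texts come from finitely many headers and
  choices; the buffer \<open>[True]\<close> is listed separately because \<open>trans\<close> enters
  it without a length test.\<close>

definition states :: "nat \<Rightarrow> tstate set" where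
  "states K = UNIV \<times> insert None ((\<lambda>(h, sel, j). snd (snd (snd (ho h sel j)))) ` (hdrs \<times> UNIV \<times> {..<K})) \<times>
     (H ` {u. length u \<le> L} \<union> T ` insert [True] {u. length u \<le> L} \<union> range V \<union> {D})"

lemma finite_states: "finite (states K)"
proof -
  have "finite {u :: bool list. length u \<le> L}"
    using finite_lists_length_le[of "UNIV :: bool set" L] by simp
  then show ?thesis using finite_hdrs by (simp add: states_def)
qed

lemma start_state: "(True, None, T []) \<in> states K"
  by (simp add: states_def)

lemma trans_states:
  assumes "q \<in> states K" "j < K" "trans j q z sel b = Some (q', out, d)"
  shows "q' \<in> states K"
proof -
  have h: "q' \<in> states K" if "hstep j sel u = Some (q', out, d)" for u
  proof (cases "hdr u")
    case None
    then show ?thesis using that by (auto simp: hstep_def states_def split: if_splits)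
  next
    case (Some h)
    then have "h \<in> hdrs" using hdr_SomeD by blast
    obtain o1 n v p where ho: "ho h sel j = (o1, n, v, p)" by (metis prod_cases4)
    from ho have pm: "p \<in> (\<lambda>(h, sel, j). snd (snd (snd (ho h sel j)))) ` (hdrs \<times> UNIV \<times> {..<K})"
      using \<open>h \<in> hdrs\<close> assms(2) by (intro image_eqI[of _ _ "(h, sel, j)"]) auto
    have q': "q' = (v, p, T [])" using that Some ho by (simp add: hstep_def)
    show ?thesis unfolding states_def q' by (intro SigmaI UNIV_I insertI2 pm) simp
  qed
  obtain v p l where q: "q = (v, p, l)" by (metis prod_cases3)
  then have p: "(v', p, T []) \<in> states K" "(v', None, T []) \<in> states K" "(v', p, V e) \<in> states K" "(v', p, D) \<in> states K"
    "(v', p, T [True]) \<in> states K" for v' e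
    using assms(1) by (auto simp: states_def)
  have fin: "fst (fin_tok v' p z' o' a) \<in> states K" for v' z' o' a
    using p by (auto simp: fin_tok_def split: option.splits)
  show ?thesis
  proof (cases l)
    case (H u)
    then show ?thesis using h assms(3) q by simp
  next
    case (T u)
    have "q' \<in> states K" if "tstep v p z (u @ [b]) = Some (q', out, d)"
    proof (cases "tok (u @ [b])")
      case None
      then have "q' = (v, p, lex.T (u @ [b]))" "length (u @ [b]) \<le> L" using that by (auto simp: tstep_def split: if_splits)
      then show ?thesis using assms(1) q by (auto simp: states_def)
    next
      case (Some f)
      then have "q' = fst (fin_tok v p z (fo f) (fun_ar S ! f))" using that by (auto simp: tstep_def)
      then show ?thesis using fin by simp
    qed
    then show ?thesis using T h assms(3) q p by (auto split: if_splits)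
  next
    case (V e)
    have "q' = fst (fin_tok v p z [False] 0)" if "\<not> b" using V assms(3) q that by (auto split: if_splits)
    then show ?thesis using V assms(3) q p fin by (cases b) auto
  next
    case D
    then show ?thesis using assms(3) q p by auto
  qed
qed

end

section \<open>An oracle machine that queries the outputs of a transducer\<close>

text \<open>\<open>Rd\<close> reads an input bit, \<open>Wr\<close> writes pending output and then
  moves the counter cell by cell, \<open>Fi\<close> appends the tail to the query, \<open>Qu\<close>
  asks it, \<open>Er\<close> erases the oracle tape from the right, and \<open>Rw\<close> rewinds
  the input.\<close>

datatype ctl = Start | Rd tstate | Wr tstate "bool list" int | Fi "bool list" | Qu | Yes | No | Er | Rw | Acc | Rej

text \<open>\<open>K\<close> is the number of values of \<open>j\<close> to be tried at each
  position, and \<open>tail\<close> a fixed text that ends every query.\<close>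

locale query_transducer = transducer +
  fixes K :: nat and tail :: "bool list"
  assumes K_pos: "0 < K"
begin

text \<open>A bound on the text and the counter change caused by one input bit. It makes the control
  states finite and the time spent per bit constant.\<close>

definition B :: nat where
  "B = (SOME B. length tail \<le> B \<and> (\<forall>q \<in> states K. \<forall>j < K. \<forall>z sel b q' out d.
     trans j q z sel b = Some (q', out, d) \<longrightarrow> length out \<le> B \<and> nat \<bar>d\<bar> \<le> B))"

lemma B: "length tail \<le> B"
  "q \<in> states K \<Longrightarrow> j < K \<Longrightarrow> trans j q z sel b = Some (q', out, d) \<Longrightarrow> length out \<le> B \<and> nat \<bar>d\<bar> \<le> B"
proof -
  let ?S = "(\<lambda>(q, j, z, sel, b). case trans j q z sel b of None \<Rightarrow> 0 | Some (q', out, d) \<Rightarrow> length out + nat \<bar>d\<bar>) `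
    (states K \<times> {..<K} \<times> UNIV \<times> UNIV \<times> UNIV)"
  define M where "M = Max (insert (length tail) ?S)"
  have fin: "finite ?S" using finite_states by simp
  have "length out + nat \<bar>d\<bar> \<le> M"
    if "q \<in> states K" "j < K" "trans j q z sel b = Some (q', out, d)" for q j z sel b q' out d
  proof -
    have "length out + nat \<bar>d\<bar> \<in> ?S" using that by (intro image_eqI[of _ _ "(q, j, z, sel, b)"]) auto
    then show ?thesis unfolding M_def using fin by (intro Max_ge) auto
  qed
  moreover have "length tail \<le> M" unfolding M_def using fin by (intro Max_ge) auto
  ultimately have "length tail \<le> M \<and> (\<forall>q \<in> states K. \<forall>j < K. \<forall>z sel b q' out d.
     trans j q z sel b = Some (q', out, d) \<longrightarrow> length out \<le> M \<and> nat \<bar>d\<bar> \<le> M)" by fastforce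
  then have *: "length tail \<le> B \<and> (\<forall>q \<in> states K. \<forall>j < K. \<forall>z sel b q' out d.
     trans j q z sel b = Some (q', out, d) \<longrightarrow> length out \<le> B \<and> nat \<bar>d\<bar> \<le> B)"
    unfolding B_def by (rule someI)
  then show "length tail \<le> B" by blast
  show "q \<in> states K \<Longrightarrow> j < K \<Longrightarrow> trans j q z sel b = Some (q', out, d) \<Longrightarrow> length out \<le> B \<and> nat \<bar>d\<bar> \<le> B"
    using * by blast
qed

definition ctls :: "ctl set" where
  "ctls = {Start, Qu, Yes, No, Er, Rw, Acc, Rej} \<union> Rd ` states K \<union>
     (\<lambda>(q, out, d). Wr q out d) ` (states K \<times> {out. length out \<le> B} \<times> {- int B..int B}) \<union>
     Fi ` {out. length out \<le> B}"

lemma finite_ctls: "finite ctls"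
proof -
  have "finite {u :: bool list. length u \<le> B}"
    using finite_lists_length_le[of "UNIV :: bool set" B] by simp
  then show ?thesis using finite_states by (simp add: ctls_def)
qed

lemma ctls_simps [simp]:
  "Start \<in> ctls" "Qu \<in> ctls" "Yes \<in> ctls" "No \<in> ctls" "Er \<in> ctls" "Rw \<in> ctls" "Acc \<in> ctls" "Rej \<in> ctls"
  "Rd q \<in> ctls \<longleftrightarrow> q \<in> states K" "Wr q out d \<in> ctls \<longleftrightarrow> q \<in> states K \<and> length out \<le> B \<and> nat \<bar>d\<bar> \<le> B"
  "Fi out \<in> ctls \<longleftrightarrow> length out \<le> B"
  by (auto simp: ctls_def image_iff)

section \<open>Numbering of the control states and the machine\<close>

definition code :: "ctl \<Rightarrow> nat" where
  "code = (SOME h. bij_betw h ctls {0..<card ctls})"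

lemma code: "bij_betw code ctls {0..<card ctls}"
  unfolding code_def using ex_bij_betw_finite_nat[OF finite_ctls] by (rule someI_ex)

lemma code_less: "s \<in> ctls \<Longrightarrow> code s < card ctls"
  using code by (auto simp: bij_betw_def)

lemma code_eq_iff: "s \<in> ctls \<Longrightarrow> s' \<in> ctls \<Longrightarrow> code s = code s' \<longleftrightarrow> s = s'"
  using code by (meson bij_betw_imp_inj_on inj_on_eq_iff)

definition start_tstate :: tstate where
  "start_tstate = (True, None, T [])"

text \<open>
  Tapes 2 and 3 hold a marker in cell 0 only; the head positions are a counter for the pending
  terms and the distance from the input head to the selected position. Tape 4 holds \<open>j\<close>.
\<close>

fun prog :: "ctl \<Rightarrow> nat \<Rightarrow> nat \<Rightarrow> nat \<Rightarrow> nat \<Rightarrow> nat \<Rightarrow> ctl \<times> (nat \<times> int) list" where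
  "prog Start a0 a1 a2 a3 a4 = (Rd start_tstate, [(a0, 0), (a1, 0), (1, 0), (1, 0), (a4, 0)])"
| "prog (Rd q) a0 a1 a2 a3 a4 =
    (if a0 = 0 then (if snd (snd q) = T [] \<and> a2 \<noteq> 0 then Fi tail else Rej, [(a0, 0), (a1, 0), (a2, 0), (a3, 0), (a4, 0)])
     else case trans a4 q (a2 \<noteq> 0) (a3 \<noteq> 0) (a0 = 2) of
       None \<Rightarrow> (Rej, [(a0, 0), (a1, 0), (a2, 0), (a3, 0), (a4, 0)])
     | Some (q', out, d) \<Rightarrow> (Wr q' out d, [(a0, 1), (a1, 0), (a2, 0), (a3, -1), (a4, 0)]))"
| "prog (Wr q (x # out) d) a0 a1 a2 a3 a4 = (Wr q out d, [(a0, 0), (bit x, 1), (a2, 0), (a3, 0), (a4, 0)])"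
| "prog (Wr q [] d) a0 a1 a2 a3 a4 =
    (if d = 0 then Rd q else Wr q [] (d - sgn d), [(a0, 0), (a1, 0), (a2, sgn d), (a3, 0), (a4, 0)])"
| "prog (Fi (x # out)) a0 a1 a2 a3 a4 = (Fi out, [(a0, 0), (bit x, 1), (a2, 0), (a3, 0), (a4, 0)])"
| "prog (Fi []) a0 a1 a2 a3 a4 = (Qu, [(a0, 0), (a1, 0), (a2, 0), (a3, 0), (a4, 0)])"
| "prog Yes a0 a1 a2 a3 a4 =
    (if a3 \<noteq> 0 then (Acc, [(a0, 0), (a1, 0), (a2, 0), (a3, 0), (a4, 0)])
     else (Er, [(a0, 0), (a1, -1), (a2, 0), (a3, 1), (0, 0)]))"
| "prog No a0 a1 a2 a3 a4 =
    (if a4 + 1 < K then (Er, [(a0, 0), (a1, -1), (a2, 0), (a3, 0), (a4 + 1, 0)])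
     else (Rej, [(a0, 0), (a1, 0), (a2, 0), (a3, 0), (a4, 0)]))"
| "prog Er a0 a1 a2 a3 a4 =
    (if a1 \<noteq> 0 then (Er, [(a0, 0), (0, -1), (a2, 0), (a3, 0), (a4, 0)])
     else (Rw, [(a0, -1), (a1, 1), (a2, 0), (a3, 1), (a4, 0)]))"
| "prog Rw a0 a1 a2 a3 a4 =
    (if a0 \<noteq> 0 then (Rw, [(a0, -1), (a1, 0), (a2, 0), (a3, 1), (a4, 0)])
     else (Rd start_tstate, [(a0, 1), (a1, 0), (a2, 0), (a3, -1), (a4, 0)]))"
| "prog Qu a0 a1 a2 a3 a4 = (Rej, [])"
| "prog Acc a0 a1 a2 a3 a4 = (Rej, [])"
| "prog Rej a0 a1 a2 a3 a4 = (Rej, [])"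

text \<open>Blank and bits need three symbols; the value \<open>j\<close> is kept as a single
  symbol, which needs \<open>K\<close>.\<close>

definition syms :: nat where
  "syms = max 3 K"

text \<open>\<open>is_otm\<close> constrains \<open>delta\<close> on all states and symbols,
  reachable or not. A result of \<open>prog\<close> that fails this test is replaced by a move to
  rejection.\<close>

definition valid :: "ctl \<times> (nat \<times> int) list \<Rightarrow> bool" where
  "valid r \<longleftrightarrow> fst r \<in> ctls \<and> snd r \<in> tuples ({..<syms} \<times> {-1, 0, 1}) 5"

definition mach :: otm where
  "mach = \<lparr>tape_count = 5, symbol_count = syms, state_count = card ctls, start = code Start, accept = code Acc,
     reject = code Rej, query = code Qu, ans_yes = code Yes, ans_no = code No,
     delta = (\<lambda>n as. let r = prog (inv_into ctls code n) (as ! 0) (as ! 1) (as ! 2) (as ! 3) (as ! 4) in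
       if valid r then (code (fst r), snd r) else (code Rej, replicate 5 (0, 0)))\<rparr>"

lemma is_otm_mach: "is_otm mach"
proof -
  have 1: "(0, 0) \<in> {..<syms} \<times> {- 1, 0, 1 :: int}" by (simp add: syms_def)
  have "fst (delta mach q as) < card ctls \<and> snd (delta mach q as) \<in> tuples ({..<syms} \<times> {-1, 0, 1}) 5" for q as
  proof (cases "valid (prog (inv_into ctls code q) (as ! 0) (as ! 1) (as ! 2) (as ! 3) (as ! 4))")
    case True
    then show ?thesis by (simp add: mach_def Let_def code_less) (simp add: valid_def code_less)
  next
    case False
    then have "delta mach q as = (code Rej, replicate 5 (0, 0))" by (simp add: mach_def Let_def)
    then show ?thesis using 1 by (simp add: code_less tuples_def)
  qed
  then show ?thesis
    unfolding is_otm_def by (simp add: mach_def code_less code_eq_iff) (simp add: syms_def)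
qed

section \<open>Configurations and single steps\<close>

definition wfun :: "bool list \<Rightarrow> int \<Rightarrow> nat" where
  "wfun w = fst (word_tape w)"

lemma wfun_in: "i < length w \<Longrightarrow> wfun w (int i) = bit (w ! i)"
  by (simp add: wfun_def word_tape_def)

lemma wfun_out [simp]: "i < 0 \<Longrightarrow> wfun w i = 0" "int (length w) \<le> i \<Longrightarrow> wfun w i = 0"
  by (simp_all add: wfun_def word_tape_def)

lemma bit_simps [simp]: "bit x \<noteq> 0" "bit x = 2 \<longleftrightarrow> x" "bit x < syms"
  by (auto simp: bit_def syms_def)

lemma wfun_eq_0_iff: "wfun w i = 0 \<longleftrightarrow> i < 0 \<or> int (length w) \<le> i"
  using bit_simps(1) by (auto simp: wfun_def word_tape_def)

lemma wfun_less [simp]: "wfun w i < syms"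
  by (auto simp: wfun_def word_tape_def syms_def bit_def)

lemma wfun_push: "(wfun u)(int (length u) := bit x) = wfun (u @ [x])"
  by (auto simp: wfun_def word_tape_def nth_append fun_eq_iff nat_less_iff)

lemma wfun_pop: "(wfun (u @ [x]))(int (length u) := 0) = wfun u"
  by (auto simp: wfun_def word_tape_def nth_append fun_eq_iff nat_less_iff)

definition mark :: "int \<Rightarrow> nat" where
  "mark = (\<lambda>_. 0)(0 := 1)"

lemma mark_simps [simp]: "mark i < syms" "mark i = 0 \<longleftrightarrow> i \<noteq> 0"
  by (auto simp: mark_def syms_def)

definition reg :: "nat \<Rightarrow> int \<Rightarrow> nat" where
  "reg j = (\<lambda>_. 0)(0 := j)"

lemma reg_simps [simp]: "reg j 0 = j" "(reg j)(0 := j') = reg j'"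
  by (auto simp: reg_def)

definition cfg :: "bool list \<Rightarrow> ctl \<Rightarrow> int \<Rightarrow> bool list \<Rightarrow> int \<Rightarrow> int \<Rightarrow> int \<Rightarrow> nat \<Rightarrow> config" where
  "cfg w s i u h c e j = (code s, [(wfun w, i), (wfun u, h), (mark, c), (mark, e), (reg j, 0)])"

lemma step_prog:
  assumes "s \<in> ctls" "s \<notin> {Acc, Rej, Qu}"
    and "prog s (f0 h0) (f1 h1) (f2 h2) (f3 h3) (f4 h4) = (s', [(b0, m0), (b1, m1), (b2, m2), (b3, m3), (b4, m4)])"
    and "s' \<in> ctls" "{b0, b1, b2, b3, b4} \<subseteq> {..<syms}" "{m0, m1, m2, m3, m4} \<subseteq> {-1, 0, 1}"
  shows "step mach X (code s, [(f0, h0), (f1, h1), (f2, h2), (f3, h3), (f4, h4)]) =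
    (code s', [(f0(h0 := b0), h0 + m0), (f1(h1 := b1), h1 + m1), (f2(h2 := b2), h2 + m2), (f3(h3 := b3), h3 + m3), (f4(h4 := b4), h4 + m4)])"
proof -
  have "inv_into ctls code (code s) = s" using assms(1) code by (simp add: bij_betw_def)
  moreover have "valid (s', [(b0, m0), (b1, m1), (b2, m2), (b3, m3), (b4, m4)])"
    using assms(4-6) by (auto simp: valid_def tuples_def)
  ultimately have "delta mach (code s) [f0 h0, f1 h1, f2 h2, f3 h3, f4 h4] = (code s', [(b0, m0), (b1, m1), (b2, m2), (b3, m3), (b4, m4)])"
    using assms(3) by (simp add: mach_def)
  moreover have "code s \<noteq> accept mach" "code s \<noteq> reject mach" "code s \<noteq> query mach"
    using assms(1,2) code_eq_iff by (auto simp: mach_def)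
  ultimately show ?thesis by (simp add: step_def)
qed

definition reach :: "bool list set \<Rightarrow> nat \<Rightarrow> config \<Rightarrow> config \<Rightarrow> bool" where
  "reach X N c c' \<longleftrightarrow> (\<exists>n \<le> N. (step mach X ^^ n) c = c')"

lemma reach_refl: "reach X N c c"
  by (auto simp: reach_def intro: exI[of _ 0])

lemma reach_step: "step mach X c = c' \<Longrightarrow> reach X M c' c'' \<Longrightarrow> reach X (Suc M) c c''"
proof -
  assume "step mach X c = c'" "reach X M c' c''"
  then obtain n where "n \<le> M" "(step mach X ^^ n) (step mach X c) = c''" by (auto simp: reach_def)
  then show ?thesis unfolding reach_def by (intro exI[of _ "Suc n"]) (simp add: funpow_swap1)
qed

lemma reach_trans: "reach X N a b \<Longrightarrow> reach X M b c \<Longrightarrow> reach X (N + M) a c"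
proof -
  assume "reach X N a b" "reach X M b c"
  then obtain n m where "n \<le> N" "(step mach X ^^ n) a = b" "m \<le> M" "(step mach X ^^ m) b = c" by (auto simp: reach_def)
  then show ?thesis unfolding reach_def by (intro exI[of _ "m + n"]) (simp add: funpow_add)
qed

lemma reach_mono: "reach X N a b \<Longrightarrow> N \<le> M \<Longrightarrow> reach X M a b"
  unfolding reach_def using order_trans by blast

lemma syms_simps [simp]: "j < K \<Longrightarrow> j < syms" "0 < syms" "Suc 0 < syms"
  by (auto simp: syms_def)

lemma step_cfg:
  assumes "s \<in> ctls" "s \<notin> {Acc, Rej, Qu}"
    and "prog s (wfun w i) (wfun u h) (mark c) (mark e) j = (s', [(wfun w i, m0), (b1, m1), (mark c, m2), (mark e, m3), (j', 0)])"
    and "s' \<in> ctls" "(wfun u)(h := b1) = wfun u'" "b1 < syms" "j' < syms" "{m0, m1, m2, m3} \<subseteq> {-1, 0, 1}"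
  shows "step mach X (cfg w s i u h c e j) = cfg w s' (i + m0) u' (h + m1) (c + m2) (e + m3) j'"
proof -
  have "step mach X (cfg w s i u h c e j) = (code s', [((wfun w)(i := wfun w i), i + m0), ((wfun u)(h := b1), h + m1),
      (mark(c := mark c), c + m2), (mark(e := mark e), e + m3), ((reg j)(0 := j'), 0 + 0)])"
    unfolding cfg_def by (rule step_prog) (use assms in auto)
  then show ?thesis by (simp add: cfg_def assms(5))
qed

lemma step_Rd_end:
  assumes "q \<in> states K" "j < K" "wfun w i = 0"
  shows "step mach X (cfg w (Rd q) i u h c e j) =
    cfg w (if snd (snd q) = T [] \<and> c = 0 then Fi tail else Rej) i u h c e j"
  using step_cfg[of "Rd q" w i u h c e j "if snd (snd q) = T [] \<and> c = 0 then Fi tail else Rej" 0 "wfun u h" 0 0 0 j u X] assms B(1)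
  by simp

lemma step_Rd_None:
  assumes "q \<in> states K" "j < K" "wfun w i = bit b" "trans j q (c = 0) (e = 0) b = None"
  shows "step mach X (cfg w (Rd q) i u h c e j) = cfg w Rej i u h c e j"
  using step_cfg[of "Rd q" w i u h c e j Rej 0 "wfun u h" 0 0 0 j u X] assms by simp

lemma step_Rd_Some:
  assumes "q \<in> states K" "j < K" "wfun w i = bit b" "trans j q (c = 0) (e = 0) b = Some (q', out, d)"
  shows "step mach X (cfg w (Rd q) i u h c e j) = cfg w (Wr q' out d) (i + 1) u h c (e - 1) j"
  using step_cfg[of "Rd q" w i u h c e j "Wr q' out d" 1 "wfun u h" 0 0 "-1" j u X] assms
    B(2)[OF assms(1,2,4)] trans_states[OF assms(1,2,4)] by simp

lemma step_Wr_bit: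
  assumes "Wr q (x # out) d \<in> ctls" "j < K"
  shows "step mach X (cfg w (Wr q (x # out) d) i u (int (length u)) c e j) =
    cfg w (Wr q out d) i (u @ [x]) (int (length (u @ [x]))) c e j"
  using step_cfg[of "Wr q (x # out) d" w i u "int (length u)" c e j "Wr q out d" 0 "bit x" 1 0 0 j "u @ [x]" X] assms
  by (simp add: wfun_push algebra_simps)

lemma step_Wr_count:
  assumes "Wr q [] d \<in> ctls" "j < K" "d \<noteq> 0"
  shows "step mach X (cfg w (Wr q [] d) i u h c e j) = cfg w (Wr q [] (d - sgn d)) i u h (c + sgn d) e j"
proof -
  have "nat \<bar>d - sgn d\<bar> \<le> B" using assms by (auto simp: sgn_if)
  moreover have "sgn d \<in> {-1, 0, 1}" by (simp add: sgn_if)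
  ultimately show ?thesis
    using step_cfg[of "Wr q [] d" w i u h c e j "Wr q [] (d - sgn d)" 0 "wfun u h" 0 "sgn d" 0 j u X] assms by simp
qed

lemma step_Wr_done:
  assumes "q \<in> states K" "j < K"
  shows "step mach X (cfg w (Wr q [] 0) i u h c e j) = cfg w (Rd q) i u h c e j"
  using step_cfg[of "Wr q [] 0" w i u h c e j "Rd q" 0 "wfun u h" 0 0 0 j u X] assms by simp

lemma step_Fi_bit:
  assumes "length (x # out) \<le> B" "j < K"
  shows "step mach X (cfg w (Fi (x # out)) i u (int (length u)) c e j) = cfg w (Fi out) i (u @ [x]) (int (length (u @ [x]))) c e j"
  using step_cfg[of "Fi (x # out)" w i u "int (length u)" c e j "Fi out" 0 "bit x" 1 0 0 j "u @ [x]" X] assms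
  by (simp add: wfun_push algebra_simps)

lemma step_Fi_done:
  assumes "j < K"
  shows "step mach X (cfg w (Fi []) i u h c e j) = cfg w Qu i u h c e j"
  using step_cfg[of "Fi []" w i u h c e j Qu 0 "wfun u h" 0 0 0 j u X] assms by simp

lemma step_Yes_last:
  assumes "j < K"
  shows "step mach X (cfg w Yes i u h c 0 j) = cfg w Acc i u h c 0 j"
  using step_cfg[of Yes w i u h c 0 j Acc 0 "wfun u h" 0 0 0 j u X] assms by simp

lemma step_Yes_next:
  assumes "j < K" "e \<noteq> 0"
  shows "step mach X (cfg w Yes i u h c e j) = cfg w Er i u (h - 1) c (e + 1) 0"
  using step_cfg[of Yes w i u h c e j Er 0 "wfun u h" "-1" 0 1 0 u X] assms by simp

lemma step_No_next:
  assumes "j + 1 < K"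
  shows "step mach X (cfg w No i u h c e j) = cfg w Er i u (h - 1) c e (j + 1)"
  using step_cfg[of No w i u h c e j Er 0 "wfun u h" "-1" 0 0 "j + 1" u X] assms by simp

lemma step_No_last:
  assumes "j < K" "\<not> j + 1 < K"
  shows "step mach X (cfg w No i u h c e j) = cfg w Rej i u h c e j"
  using step_cfg[of No w i u h c e j Rej 0 "wfun u h" 0 0 0 j u X] assms by simp

lemma step_Er_pop:
  assumes "j < K"
  shows "step mach X (cfg w Er i (u @ [x]) (int (length u)) c e j) = cfg w Er i u (int (length u) - 1) c e j"
  using step_cfg[of Er w i "u @ [x]" "int (length u)" c e j Er 0 0 "-1" 0 0 j u X] assms wfun_in[of "length u" "u @ [x]"]
  by (simp add: wfun_pop)

lemma step_Er_done:
  assumes "j < K"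
  shows "step mach X (cfg w Er i [] (- 1) c e j) = cfg w Rw (i - 1) [] 0 c (e + 1) j"
  using step_cfg[of Er w i "[]" "- 1" c e j Rw "-1" "wfun [] (- 1)" 1 0 1 j "[]" X] assms
    fun_upd_idem[of "wfun []" "- 1" 0] by simp

lemma step_Rw_back:
  assumes "j < K" "wfun w i \<noteq> 0"
  shows "step mach X (cfg w Rw i u h c e j) = cfg w Rw (i - 1) u h c (e + 1) j"
  using step_cfg[of Rw w i u h c e j Rw "-1" "wfun u h" 0 0 1 j u X] assms by simp

lemma step_Rw_done:
  assumes "j < K" "wfun w i = 0"
  shows "step mach X (cfg w Rw i u h c e j) = cfg w (Rd start_tstate) (i + 1) u h c (e - 1) j"
  using step_cfg[of Rw w i u h c e j "Rd start_tstate" 1 "wfun u h" 0 0 "-1" j u X] assms start_state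
  by (simp add: start_tstate_def)

text \<open>Bits are never written as blanks, so the first blank determines the length of the query
  word.\<close>

lemma holds_word_wfun: "holds_word (wfun u, h) v \<longleftrightarrow> v = u"
proof
  assume v: "holds_word (wfun u, h) v"
  have "length v \<ge> length u"
  proof (rule ccontr)
    assume "\<not> length u \<le> length v"
    then have "wfun u (int (length v)) = bit (u ! length v)" by (simp add: wfun_in)
    then show False using v by (simp add: holds_word_def)
  qed
  have bits: "i < length u \<and> bit (u ! i) = bit (v ! i)" if "i < length v" for i
  proof -
    have *: "wfun u (int i) = bit (v ! i)" using v that by (simp add: holds_word_def)
    then have "i < length u" using wfun_eq_0_iff[of u "int i"] bit_simps(1)[of "v ! i"] by linarith
    then show ?thesis using * by (simp add: wfun_in)
  qed
  have "length v = length u" using bits[of "length u"] \<open>length u \<le> length v\<close> by (cases "length u = length v") auto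
  moreover have "v ! i = u ! i" if "i < length v" for i using bits[OF that] by (simp add: bit_def split: if_splits)
  ultimately show "v = u" by (rule nth_equalityI)
qed (simp add: holds_word_def wfun_in)

lemma step_Qu: "step mach X (cfg w Qu i u h c e j) = cfg w (if u \<in> X then Yes else No) i u h c e j"
proof -
  have "step mach X (code Qu, ts) = (if \<exists>v \<in> X. holds_word (ts ! 1) v then code Yes else code No, ts)" for ts
    by (simp add: step_def mach_def code_eq_iff)
  then show ?thesis by (simp add: cfg_def holds_word_wfun)
qed

lemma step_Start:
  "step mach X (initial mach w) = cfg w (Rd start_tstate) 0 [] 0 0 0 0"
proof -
  have wfun_Nil: "wfun [] = (\<lambda>_. 0)" by (auto simp: wfun_def word_tape_def)
  have "replicate 4 x = [x, x, x, x]" for x :: tape by (simp add: numeral_eq_Suc)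
  moreover have "tape_count mach - 1 = 4" "start mach = code Start" by (simp_all add: mach_def)
  moreover have "word_tape w = (wfun w, 0)" by (simp add: wfun_def word_tape_def)
  ultimately have 1: "initial mach w = (code Start, [(wfun w, 0), (wfun [], 0), (\<lambda>_. 0, 0), (\<lambda>_. 0, 0), (\<lambda>_. 0, 0)])"
    by (simp only: initial_def blank_tape_def wfun_Nil)
  have 2: "step mach X (code Start, [(wfun w, 0), (wfun [], 0), (\<lambda>_. 0, 0), (\<lambda>_. 0, 0), (\<lambda>_. 0, 0)]) =
    (code (Rd start_tstate), [((wfun w)(0 := wfun w 0), 0 + 0), ((wfun [])(0 := wfun [] 0), 0 + 0),
     ((\<lambda>_. 0)(0 := 1), 0 + 0), ((\<lambda>_. 0)(0 := 1), 0 + 0), ((\<lambda>_. 0)(0 := 0), 0 + 0)])"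
    by (rule step_prog[where s' = "Rd start_tstate"]) (use start_state in \<open>simp_all add: start_tstate_def\<close>)
  show ?thesis
    unfolding 1 2 cfg_def mark_def reg_def fun_upd_triv add_0 by (rule refl)
qed

section \<open>Passes over the input, rounds and the search\<close>

definition halts :: "bool list set \<Rightarrow> nat \<Rightarrow> config \<Rightarrow> ctl \<Rightarrow> bool" where
  "halts X N c s \<longleftrightarrow> (\<exists>c'. reach X N c c' \<and> fst c' = code s)"

lemma reach_imp_halts: "reach X N c (cfg w s i u h d e j) \<Longrightarrow> halts X N c s"
  unfolding halts_def by (intro exI conjI) (assumption, simp add: cfg_def)

lemma halts_mono: "halts X N c s \<Longrightarrow> N \<le> M \<Longrightarrow> halts X M c s"
  unfolding halts_def using reach_mono by blast

lemma reach_halts: "reach X N a b \<Longrightarrow> halts X M b s \<Longrightarrow> halts X (N + M) a s"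
  unfolding halts_def using reach_trans by blast

lemma reach_Wr_count:
  "q \<in> states K \<Longrightarrow> j < K \<Longrightarrow> nat \<bar>d\<bar> \<le> B \<Longrightarrow>
    reach X (nat \<bar>d\<bar> + 1) (cfg w (Wr q [] d) i u h c e j) (cfg w (Rd q) i u h (c + d) e j)"
proof (induction "nat \<bar>d\<bar>" arbitrary: d c)
  case 0
  then have "d = 0" by simp
  then show ?case using reach_step[OF step_Wr_done reach_refl] 0 by simp
next
  case (Suc n)
  have d: "d \<noteq> 0" "nat \<bar>d - sgn d\<bar> = n" using Suc.hyps(2) by (auto simp: sgn_if)
  have "reach X (n + 1) (cfg w (Wr q [] (d - sgn d)) i u h (c + sgn d) e j) (cfg w (Rd q) i u h (c + sgn d + (d - sgn d)) e j)"
    using Suc.hyps(1)[of "d - sgn d" "c + sgn d"] Suc.prems Suc.hyps(2) d by simp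
  from reach_step[OF step_Wr_count this] show ?case using Suc.prems Suc.hyps(2)[symmetric] d by simp
qed

lemma reach_Wr:
  "Wr q out d \<in> ctls \<Longrightarrow> j < K \<Longrightarrow>
    reach X (length out + nat \<bar>d\<bar> + 1) (cfg w (Wr q out d) i u (int (length u)) c e j)
      (cfg w (Rd q) i (u @ out) (int (length (u @ out))) (c + d) e j)"
proof (induction out arbitrary: u)
  case Nil
  then show ?case using reach_Wr_count by simp
next
  case (Cons x out)
  have "reach X (length out + nat \<bar>d\<bar> + 1) (cfg w (Wr q out d) i (u @ [x]) (int (length (u @ [x]))) c e j)
      (cfg w (Rd q) i ((u @ [x]) @ out) (int (length ((u @ [x]) @ out))) (c + d) e j)"
    by (rule Cons.IH) (use Cons.prems in auto)
  from reach_step[OF step_Wr_bit this] show ?case using Cons.prems by simp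
qed

lemma reach_Fi:
  "length out \<le> B \<Longrightarrow> j < K \<Longrightarrow>
    reach X (length out + 1) (cfg w (Fi out) i u (int (length u)) c e j) (cfg w Qu i (u @ out) (int (length (u @ out))) c e j)"
proof (induction out arbitrary: u)
  case Nil
  then show ?case using reach_step[OF step_Fi_done reach_refl] by simp
next
  case (Cons x out)
  have "reach X (length out + 1) (cfg w (Fi out) i (u @ [x]) (int (length (u @ [x]))) c e j)
      (cfg w Qu i ((u @ [x]) @ out) (int (length ((u @ [x]) @ out))) c e j)"
    by (rule Cons.IH) (use Cons.prems in auto)
  from reach_step[OF step_Fi_bit this] show ?case using Cons.prems by simp
qed

text \<open>The blank to the left of cell 0 acts as end marker. The last step moves the input head
  left and the head on tape 3 right, so their positions keep their sum \<open>pos\<close>.\<close>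

lemma reach_Er:
  assumes "j < K"
  shows "reach X (length u + 1) (cfg w Er i u (int (length u) - 1) c e j) (cfg w Rw (i - 1) [] 0 c (e + 1) j)"
proof (induction u rule: rev_induct)
  case Nil
  show ?case using reach_step[OF step_Er_done[OF assms] reach_refl] by simp
next
  case (snoc x u)
  from reach_step[OF step_Er_pop[OF assms] snoc.IH] show ?case by simp
qed

lemma reach_Rw:
  "j < K \<Longrightarrow> n \<le> length w \<Longrightarrow>
    reach X (n + 1) (cfg w Rw (int n - 1) u h c e j) (cfg w (Rd start_tstate) 0 u h c (e + int n - 1) j)"
proof (induction n arbitrary: e)
  case 0
  then show ?case using reach_step[OF step_Rw_done[of j w "-1"] reach_refl] by simp
next
  case (Suc n)
  have "wfun w (int n) \<noteq> 0" using Suc.prems by (simp add: wfun_in)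
  from reach_step[OF step_Rw_back[OF Suc.prems(1) this] Suc.IH] show ?case using Suc.prems by (simp add: algebra_simps)
qed

text \<open>The invariant is that tape 3 stands at the selected position minus the input position,
  so its marker is read exactly at the selected bit. A bit costs at most \<open>2 * B + 2\<close>
  steps: one for reading, up to \<open>B\<close> for output, up to \<open>B\<close> for the counter,
  and one to return to \<open>Rd\<close>.\<close>

lemma reach_pass:
  "w = x @ v \<Longrightarrow> q \<in> states K \<Longrightarrow> j < K \<Longrightarrow>
    (case arun pos j (int (length x)) q c v of
      Some out \<Rightarrow> reach X ((2 * B + 2) * length v + 1) (cfg w (Rd q) (int (length x)) u (int (length u)) c (pos - int (length x)) j)
        (cfg w (Fi tail) (int (length w)) (u @ out) (int (length (u @ out))) 0 (pos - int (length w)) j)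
    | None \<Rightarrow> \<exists>i u' h c' e. reach X ((2 * B + 2) * length v + 1)
        (cfg w (Rd q) (int (length x)) u (int (length u)) c (pos - int (length x)) j) (cfg w Rej i u' h c' e j))"
proof (induction v arbitrary: x q c u)
  case Nil
  have "wfun w (int (length x)) = 0" using Nil by simp
  note st = reach_step[OF step_Rd_end[OF Nil(2,3) this, of X u "int (length u)" c "pos - int (length x)"] reach_refl[of X 0]]
  show ?case
  proof (cases "snd (snd q) = T [] \<and> c = 0")
    case True
    then show ?thesis using st Nil by simp
  next
    case False
    then have "reach X 1 (cfg w (Rd q) (int (length x)) u (int (length u)) c (pos - int (length x)) j)
      (cfg w Rej (int (length x)) u (int (length u)) c (pos - int (length x)) j)"
      using st unfolding if_not_P[OF False] by simp
    moreover have "arun pos j (int (length x)) q c [] = None" using False by simp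
    ultimately show ?thesis by (simp del: arun.simps) (intro exI)
  qed
next
  case (Cons b v)
  let ?e = "pos - int (length x)" and ?N = "(2 * B + 2) * length v + 1"
  have b: "wfun w (int (length x)) = bit b" using Cons.prems(1) by (simp add: wfun_in nth_append)
  have sel: "(int (length x) = pos) = (?e = 0)" by auto
  show ?case
  proof (cases "trans j q (c = 0) (?e = 0) b")
    case None
    from reach_step[OF step_Rd_None[OF Cons.prems(2,3) b None] reach_refl[of X "(2 * B + 2) * length (b # v)"]]
    have "reach X ((2 * B + 2) * length (b # v) + 1) (cfg w (Rd q) (int (length x)) u (int (length u)) c ?e j)
      (cfg w Rej (int (length x)) u (int (length u)) c ?e j)" by simp
    moreover have "arun pos j (int (length x)) q c (b # v) = None" using None sel by simp
    ultimately show ?thesis by (simp only: option.case) (intro exI)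
  next
    case (Some r)
    obtain q' out d where r: "r = (q', out, d)" by (metis prod_cases3)
    note tr = Some[unfolded r]
    have q': "q' \<in> states K" using trans_states[OF Cons.prems(2,3) tr] .
    have bd: "length out \<le> B" "nat \<bar>d\<bar> \<le> B" using B(2)[OF Cons.prems(2,3) tr] by auto
    have Wr: "Wr q' out d \<in> ctls" using q' bd by simp
    have wr: "reach X (Suc (length out + nat \<bar>d\<bar> + 1)) (cfg w (Rd q) (int (length x)) u (int (length u)) c ?e j)
      (cfg w (Rd q') (int (length x) + 1) (u @ out) (int (length (u @ out))) (c + d) (?e - 1) j)"
      by (rule reach_step[OF step_Rd_Some[OF Cons.prems(2,3) b tr] reach_Wr[OF Wr Cons.prems(3)]])
    have i: "int (length x) + 1 = int (length (x @ [b]))" "?e - 1 = pos - int (length (x @ [b]))" by auto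
    have pre: "reach X (2 * B + 2) (cfg w (Rd q) (int (length x)) u (int (length u)) c ?e j)
      (cfg w (Rd q') (int (length (x @ [b]))) (u @ out) (int (length (u @ out))) (c + d) (pos - int (length (x @ [b]))) j)"
      by (rule reach_mono[OF wr[unfolded i]]) (use bd in simp)
    have ar: "arun pos j (int (length x)) q c (b # v) = pre out (arun pos j (int (length (x @ [b]))) q' (c + d) v)"
      using tr sel by (simp add: algebra_simps)
    have N: "(2 * B + 2) + ?N = (2 * B + 2) * length (b # v) + 1" by simp
    have "w = (x @ [b]) @ v" using Cons.prems(1) by simp
    note IH = Cons.IH[OF this q' Cons.prems(3), where c = "c + d" and u = "u @ out"]
    show ?thesis
    proof (cases "arun pos j (int (length (x @ [b]))) q' (c + d) v")
      case None
      from IH[unfolded None option.case] obtain i u' h c' e where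
        "reach X ?N (cfg w (Rd q') (int (length (x @ [b]))) (u @ out) (int (length (u @ out))) (c + d)
          (pos - int (length (x @ [b]))) j) (cfg w Rej i u' h c' e j)" by (elim exE) (rule that)
      from reach_trans[OF pre this] show ?thesis unfolding ar None N by (simp only: option.case pre_simps) (intro exI)
    next
      case (Some out')
      from reach_trans[OF pre IH[unfolded Some option.case]] show ?thesis unfolding ar Some N by simp
    qed
  qed
qed

text \<open>Bounds the query word and thereby the time for erasing it.\<close>

lemma length_arun:
  "q \<in> states K \<Longrightarrow> j < K \<Longrightarrow> arun pos j i q c v = Some out \<Longrightarrow> length out \<le> B * length v"
proof (induction v arbitrary: i q c out)
  case Nil
  then show ?case by (auto split: if_splits)
next
  case (Cons b v)
  obtain q' o1 d where tr: "trans j q (c = 0) (i = pos) b = Some (q', o1, d)"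
    using Cons.prems(3) by (cases "trans j q (c = 0) (i = pos) b") auto
  then obtain o2 where o2: "arun pos j (i + 1) q' (c + d) v = Some o2" "out = o1 @ o2"
    using Cons.prems(3) by (cases "arun pos j (i + 1) q' (c + d) v") auto
  have "length o1 \<le> B" using B(2)[OF Cons.prems(1,2) tr] by simp
  moreover have "length o2 \<le> B * length v"
    by (rule Cons.IH[OF trans_states[OF Cons.prems(1,2) tr] Cons.prems(2) o2(1)])
  ultimately show ?case using o2(2) by simp
qed

definition round_cfg :: "bool list \<Rightarrow> int \<Rightarrow> nat \<Rightarrow> config" where
  "round_cfg w pos j = cfg w (Rd start_tstate) 0 [] 0 0 pos j"

text \<open>Pass and query take at most \<open>(2 * B + 2) * n + B + 3\<close> steps, reacting to
  the answer, erasing and rewinding at most \<open>(B + 1) * n + B + 3\<close>.\<close>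

definition round_time :: "nat \<Rightarrow> nat" where
  "round_time n = (3 * B + 6) * (n + 1)"

lemma start_tstate_in: "start_tstate \<in> states K"
  by (simp add: start_tstate_def start_state)

lemma reach_pass_round:
  "j < K \<Longrightarrow> (case arun pos j 0 start_tstate 0 w of
      Some out \<Rightarrow> reach X ((2 * B + 2) * length w + 1) (round_cfg w pos j)
        (cfg w (Fi tail) (int (length w)) out (int (length out)) 0 (pos - int (length w)) j)
    | None \<Rightarrow> \<exists>i u h c e. reach X ((2 * B + 2) * length w + 1) (round_cfg w pos j) (cfg w Rej i u h c e j))"
  using reach_pass[where w = w and x = "[]" and v = w and u = "[]" and q = start_tstate and c = 0 and pos = pos and j = j and X = X]
    start_tstate_in by (cases "arun pos j 0 start_tstate 0 w") (simp_all add: round_cfg_def)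

lemma reach_invalid:
  assumes "arun pos j 0 start_tstate 0 w = None" "j < K"
  shows "halts X (round_time (length w)) (round_cfg w pos j) Rej"
proof -
  have "\<exists>i u h c e. reach X ((2 * B + 2) * length w + 1) (round_cfg w pos j) (cfg w Rej i u h c e j)"
    using reach_pass_round[OF assms(2), where pos = pos and w = w and X = X] assms(1) by simp
  then obtain i u h c e where "reach X ((2 * B + 2) * length w + 1) (round_cfg w pos j) (cfg w Rej i u h c e j)"
    by (elim exE) (rule that)
  then have "reach X (round_time (length w)) (round_cfg w pos j) (cfg w Rej i u h c e j)"
    by (rule reach_mono) (simp add: round_time_def algebra_simps)
  then show ?thesis by (rule reach_imp_halts)
qed

lemma reach_query:
  assumes "arun pos j 0 start_tstate 0 w = Some out" "j < K"
  shows "reach X ((2 * B + 2) * length w + B + 3) (round_cfg w pos j)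
    (cfg w (if out @ tail \<in> X then Yes else No) (int (length w)) (out @ tail) (int (length (out @ tail))) 0 (pos - int (length w)) j)"
proof -
  have "reach X ((2 * B + 2) * length w + 1) (round_cfg w pos j)
    (cfg w (Fi tail) (int (length w)) out (int (length out)) 0 (pos - int (length w)) j)"
    using reach_pass_round[OF assms(2), where pos = pos and w = w and X = X] assms(1) by simp
  from reach_trans[OF reach_trans[OF this reach_Fi[OF B(1) assms(2)]] reach_step[OF step_Qu reach_refl[of X 0]]]
  show ?thesis by (rule reach_mono) (use B(1) in simp)
qed

lemma reach_reset:
  assumes "arun pos j 0 start_tstate 0 w = Some out" "j' < K"  "j < K"
  shows "reach X (B * length w + B + length w + 2)
    (cfg w Er (int (length w)) (out @ tail) (int (length (out @ tail)) - 1) 0 (pos' - int (length w)) j') (round_cfg w pos' j')"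
proof -
  have "length out \<le> B * length w" by (rule length_arun[OF start_state assms(3) assms(1)[unfolded start_tstate_def]])
  moreover have "reach X (length (out @ tail) + 1 + (length w + 1))
    (cfg w Er (int (length w)) (out @ tail) (int (length (out @ tail)) - 1) 0 (pos' - int (length w)) j') (round_cfg w pos' j')"
    using reach_trans[OF reach_Er[OF assms(2)] reach_Rw[OF assms(2) order_refl], of X "out @ tail" w 0 "pos' - int (length w)"]
    by (simp add: round_cfg_def)
  ultimately show ?thesis using B(1) by (elim reach_mono) simp
qed

text \<open>After a pass the input head is at \<open>length w\<close>, hence tape 3 shows its marker
  iff \<open>pos = int (length w)\<close>. This is how the machine notices that the last position
  has been confirmed.\<close>

lemma round_step:
  assumes out: "arun pos j 0 start_tstate 0 w = Some out" and j: "j < K"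
  shows "out @ tail \<in> X \<Longrightarrow> pos = int (length w) \<Longrightarrow> halts X (round_time (length w)) (round_cfg w pos j) Acc"
    and "out @ tail \<in> X \<Longrightarrow> pos \<noteq> int (length w) \<Longrightarrow> reach X (round_time (length w)) (round_cfg w pos j) (round_cfg w (pos + 1) 0)"
    and "out @ tail \<notin> X \<Longrightarrow> j + 1 < K \<Longrightarrow> reach X (round_time (length w)) (round_cfg w pos j) (round_cfg w pos (j + 1))"
    and "out @ tail \<notin> X \<Longrightarrow> \<not> j + 1 < K \<Longrightarrow> halts X (round_time (length w)) (round_cfg w pos j) Rej"
proof -
  let ?u = "out @ tail" and ?n = "length w"
  note q = reach_query[OF out j, of X]
  have t: "(2 * B + 2) * ?n + B + 3 + Suc 0 \<le> round_time ?n"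
    "(2 * B + 2) * ?n + B + 3 + Suc (B * ?n + B + ?n + 2) \<le> round_time ?n" by (simp_all add: round_time_def algebra_simps)
  show "halts X (round_time ?n) (round_cfg w pos j) Acc" if "?u \<in> X" "pos = int ?n"
  proof -
    have "reach X ((2 * B + 2) * ?n + B + 3 + Suc 0) (round_cfg w pos j) (cfg w Acc (int ?n) ?u (int (length ?u)) 0 0 j)"
      by (rule reach_trans[OF q]) (use that reach_step[OF step_Yes_last[OF j] reach_refl[of X 0]] in simp)
    from reach_mono[OF this t(1)] show ?thesis by (rule reach_imp_halts)
  qed
  show "halts X (round_time ?n) (round_cfg w pos j) Rej" if "?u \<notin> X" "\<not> j + 1 < K"
  proof -
    have "reach X ((2 * B + 2) * ?n + B + 3 + Suc 0) (round_cfg w pos j) (cfg w Rej (int ?n) ?u (int (length ?u)) 0 (pos - int ?n) j)"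
      by (rule reach_trans[OF q]) (use that reach_step[OF step_No_last[OF j that(2)] reach_refl[of X 0]] in simp)
    from reach_mono[OF this t(1)] show ?thesis by (rule reach_imp_halts)
  qed
  show "reach X (round_time ?n) (round_cfg w pos j) (round_cfg w (pos + 1) 0)" if u: "?u \<in> X" and p: "pos \<noteq> int ?n"
  proof -
    have e: "pos - int ?n \<noteq> 0" "pos - int ?n + 1 = pos + 1 - int ?n" using p by auto
    have "reach X (Suc (B * ?n + B + ?n + 2)) (cfg w Yes (int ?n) ?u (int (length ?u)) 0 (pos - int ?n) j) (round_cfg w (pos + 1) 0)"
      by (rule reach_step[OF step_Yes_next[OF j e(1), unfolded e(2)] reach_reset[OF out K_pos j]])
    from reach_mono[OF reach_trans[OF q[unfolded if_P[OF u]] this] t(2)] show ?thesis .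
  qed
  show "reach X (round_time ?n) (round_cfg w pos j) (round_cfg w pos (j + 1))" if u: "?u \<notin> X" and j': "j + 1 < K"
  proof -
    have "reach X (Suc (B * ?n + B + ?n + 2)) (cfg w No (int ?n) ?u (int (length ?u)) 0 (pos - int ?n) j) (round_cfg w pos (j + 1))"
      by (rule reach_step[OF step_No_next[OF j'] reach_reset[OF out j' j]])
    from reach_mono[OF reach_trans[OF q[unfolded if_not_P[OF u]] this] t(2)] show ?thesis .
  qed
qed

lemma if_if_mono:
  "(if E then if P then A else A' else A'') \<Longrightarrow> (A \<Longrightarrow> C) \<Longrightarrow> (A' \<Longrightarrow> C') \<Longrightarrow> (A'' \<Longrightarrow> C'') \<Longrightarrow>
    if E then if P then C else C' else C''"
  by (auto split: if_splits)

text \<open>Values of \<open>j\<close> are tried upwards; the induction is on the number of those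
  still to be tried after the current one.\<close>

lemma search_step:
  assumes out: "\<And>j. j < K \<Longrightarrow> arun pos j 0 start_tstate 0 w = Some (out j)"
  shows "m < K \<Longrightarrow> (if \<exists>j. K - Suc m \<le> j \<and> j < K \<and> out j @ tail \<in> X
      then if pos = int (length w) then halts X (Suc m * round_time (length w)) (round_cfg w pos (K - Suc m)) Acc
        else reach X (Suc m * round_time (length w)) (round_cfg w pos (K - Suc m)) (round_cfg w (pos + 1) 0)
      else halts X (Suc m * round_time (length w)) (round_cfg w pos (K - Suc m)) Rej)"
proof (induction m)
  case 0
  have j: "K - 1 < K" "\<not> K - 1 + 1 < K" using K_pos by auto
  have "(\<exists>j. K - Suc 0 \<le> j \<and> j < K \<and> out j @ tail \<in> X) \<longleftrightarrow> out (K - 1) @ tail \<in> X"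
  proof
    assume "\<exists>j. K - Suc 0 \<le> j \<and> j < K \<and> out j @ tail \<in> X"
    then obtain j where "K - Suc 0 \<le> j" "j < K" "out j @ tail \<in> X" by blast
    moreover from this have "j = K - 1" by simp
    ultimately show "out (K - 1) @ tail \<in> X" by simp
  qed (use j in auto)
  then show ?case using round_step[OF out[OF j(1)] j(1), of X] j(2) by simp
next
  case (Suc m)
  define j where "j = K - Suc (Suc m)"
  have j: "j < K" "j + 1 = K - Suc m" "j + 1 < K" using Suc.prems by (auto simp: j_def)
  let ?t = "round_time (length w)"
  have mono: "?t \<le> Suc (Suc m) * ?t" by simp
  show ?case
  proof (cases "out j @ tail \<in> X")
    case True
    then have ex: "\<exists>j'. j \<le> j' \<and> j' < K \<and> out j' @ tail \<in> X" using j(1) by blast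
    show ?thesis
    proof (cases "pos = int (length w)")
      case p: True
      have "halts X (Suc (Suc m) * ?t) (round_cfg w pos j) Acc" by (rule halts_mono[OF round_step(1)[OF out[OF j(1)] j(1) True p] mono])
      then show ?thesis using ex p unfolding j_def[symmetric] by simp
    next
      case p: False
      have "reach X (Suc (Suc m) * ?t) (round_cfg w pos j) (round_cfg w (pos + 1) 0)"
        by (rule reach_mono[OF round_step(2)[OF out[OF j(1)] j(1) True p] mono])
      then show ?thesis using ex p unfolding j_def[symmetric] by simp
    qed
  next
    case False
    have eq: "(\<exists>j'. j \<le> j' \<and> j' < K \<and> out j' @ tail \<in> X) \<longleftrightarrow> (\<exists>j'. j + 1 \<le> j' \<and> j' < K \<and> out j' @ tail \<in> X)"
    proof
      assume "\<exists>j'. j \<le> j' \<and> j' < K \<and> out j' @ tail \<in> X"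
      then obtain j' where j': "j \<le> j'" "j' < K" "out j' @ tail \<in> X" by blast
      then have "j' \<noteq> j" using False by blast
      then show "\<exists>j'. j + 1 \<le> j' \<and> j' < K \<and> out j' @ tail \<in> X" using j' by (intro exI[of _ j']) simp
    next
      assume "\<exists>j'. j + 1 \<le> j' \<and> j' < K \<and> out j' @ tail \<in> X"
      then show "\<exists>j'. j \<le> j' \<and> j' < K \<and> out j' @ tail \<in> X" by (meson add_leD1)
    qed
    note first = round_step(3)[OF out[OF j(1)] j(1) False j(3)]
    have t: "?t + Suc m * ?t = Suc (Suc m) * ?t" by simp
    note lift = reach_trans[OF first, of "Suc m * ?t", unfolded t] reach_halts[OF first, of "Suc m * ?t", unfolded t]
    have "m < K" using Suc.prems by simp
    from if_if_mono[OF Suc.IH[OF this, folded j(2)] lift(2) lift(1) lift(2)] show ?thesis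
      unfolding j_def[symmetric] eq .
  qed
qed

lemma search:
  assumes "\<And>j. j < K \<Longrightarrow> arun pos j 0 start_tstate 0 w = Some (out j)"
  shows "if \<exists>j < K. out j @ tail \<in> X
      then if pos = int (length w) then halts X (K * round_time (length w)) (round_cfg w pos 0) Acc
        else reach X (K * round_time (length w)) (round_cfg w pos 0) (round_cfg w (pos + 1) 0)
      else halts X (K * round_time (length w)) (round_cfg w pos 0) Rej"
proof -
  have K: "Suc (K - 1) = K" "K - 1 < K" using K_pos by auto
  from search_step[where out = out and m = "K - 1" and X = X, unfolded K(1) diff_self_eq_0, OF assms K(2)]
  show ?thesis by simp
qed

text \<open>As for \<open>j\<close>, the induction counts the positions left. A confirmed position
  passes on to the next with \<open>j\<close> reset to 0, an unconfirmed one ends the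
  computation.\<close>

lemma search_all:
  assumes out: "\<And>p j. p \<le> length w \<Longrightarrow> j < K \<Longrightarrow> arun (int p) j 0 start_tstate 0 w = Some (out p j)"
  shows "m \<le> length w \<Longrightarrow> halts X (Suc m * (K * round_time (length w))) (round_cfg w (int (length w - m)) 0)
    (if \<forall>p. length w - m \<le> p \<and> p \<le> length w \<longrightarrow> (\<exists>j < K. out p j @ tail \<in> X) then Acc else Rej)"
proof (induction m)
  case 0
  have *: "(\<forall>p. length w - 0 \<le> p \<and> p \<le> length w \<longrightarrow> (\<exists>j < K. out p j @ tail \<in> X)) \<longleftrightarrow> (\<exists>j < K. out (length w) j @ tail \<in> X)"
    by (metis diff_zero le_antisym order_refl)
  have "if \<exists>j < K. out (length w) j @ tail \<in> X then halts X (K * round_time (length w)) (round_cfg w (int (length w)) 0) Acc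
      else halts X (K * round_time (length w)) (round_cfg w (int (length w)) 0) Rej"
    using search[of "int (length w)" w "out (length w)" X, OF out[OF order_refl]] unfolding if_P[OF refl] .
  then have "halts X (K * round_time (length w)) (round_cfg w (int (length w)) 0)
      (if \<exists>j < K. out (length w) j @ tail \<in> X then Acc else Rej)"
    by (cases "\<exists>j < K. out (length w) j @ tail \<in> X") (simp_all only: if_True if_False)
  then show ?case unfolding * by simp
next
  case (Suc m)
  define p where "p = length w - Suc m"
  have p: "p \<le> length w" "int p \<noteq> int (length w)" "int p + 1 = int (length w - m)" "p + 1 = length w - m" using Suc.prems by (auto simp: p_def)
  let ?t = "K * round_time (length w)" and ?Q = "\<lambda>p. \<exists>j < K. out p j @ tail \<in> X"
  have s: "if ?Q p then reach X ?t (round_cfg w (int p) 0) (round_cfg w (int (length w - m)) 0)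
    else halts X ?t (round_cfg w (int p) 0) Rej"
    using search[of "int p" w "out p" X, OF out[OF p(1)]] unfolding p(3)[symmetric] if_not_P[OF p(2)] .
  have all: "(\<forall>p'. p \<le> p' \<and> p' \<le> length w \<longrightarrow> ?Q p') \<longleftrightarrow> ?Q p \<and> (\<forall>p'. p + 1 \<le> p' \<and> p' \<le> length w \<longrightarrow> ?Q p')"
  proof (intro iffI conjI allI impI)
    fix p' assume *: "?Q p \<and> (\<forall>p'. p + 1 \<le> p' \<and> p' \<le> length w \<longrightarrow> ?Q p')" "p \<le> p' \<and> p' \<le> length w"
    show "?Q p'"
    proof (cases "p' = p")
      case False
      then have "p + 1 \<le> p' \<and> p' \<le> length w" using *(2) by simp
      then show ?thesis using *(1) by blast
    qed (use * in blast)
  next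
    assume *: "\<forall>p'. p \<le> p' \<and> p' \<le> length w \<longrightarrow> ?Q p'"
    show "?Q p" using * p(1) by blast
    fix p' assume "p + 1 \<le> p' \<and> p' \<le> length w"
    then have "p \<le> p' \<and> p' \<le> length w" by simp
    then show "?Q p'" using * by blast
  qed
  show ?case
  proof (cases "?Q p")
    case True
    have 1: "reach X ?t (round_cfg w (int p) 0) (round_cfg w (int (length w - m)) 0)" by (rule s[unfolded if_P[OF True]])
    have m: "m \<le> length w" and t: "?t + Suc m * ?t = Suc (Suc m) * ?t" using Suc.prems by simp_all
    from reach_halts[OF 1 Suc.IH[OF m], unfolded t] show ?thesis
      unfolding p_def[symmetric] all p(4)[symmetric] using True by simp
  next
    case False
    have "halts X (Suc (Suc m) * ?t) (round_cfg w (int p) 0) Rej" by (rule halts_mono[OF s[unfolded if_not_P[OF False]]]) simp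
    then show ?thesis unfolding p_def[symmetric] all using False by auto
  qed
qed

text \<open>The scheme common to both reductions. The range includes \<open>p = length w\<close>,
  where no bit stands and nothing is selected, so even the empty word leads to a query.\<close>

lemma poly_time_reducibleI:
  assumes Lang: "\<And>w. w \<in> Lang \<longleftrightarrow> (\<exists>\<alpha>s. csp_instance S \<alpha>s \<and> w = enc_conj \<alpha>s \<and>
      (\<forall>p \<le> length w. \<exists>j < K. oc (int p) j 0 \<alpha>s @ tail \<in> X))"
  shows "poly_time_reducible Lang X"
proof -
  \<comment> \<open>One initial step, and \<open>K\<close> rounds for each of the
    \<open>n + 1\<close> positions.\<close>
  define p :: "nat poly" where "p = [:K * (3 * B + 6):] * [:1, 1:] * [:1, 1:] + 1"
  have p: "poly p n = Suc (Suc n * (K * round_time n))" for n by (simp add: p_def round_time_def algebra_simps)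
  have run: "arun pos j 0 start_tstate 0 w = Some out \<longleftrightarrow> (\<exists>\<alpha>s. csp_instance S \<alpha>s \<and> w = enc_conj \<alpha>s \<and> out = oc pos j 0 \<alpha>s)"
    for pos j w out unfolding start_tstate_def by (rule arun_eq_Some_iff)
  have "halts X (Suc (length w) * (K * round_time (length w))) (round_cfg w 0 0) (if w \<in> Lang then Acc else Rej)" for w
  proof (cases "\<exists>\<alpha>s. csp_instance S \<alpha>s \<and> w = enc_conj \<alpha>s")
    case False
    have "arun 0 0 0 start_tstate 0 w = None"
    proof (rule ccontr)
      assume "arun 0 0 0 start_tstate 0 w \<noteq> None"
      then obtain out where "arun 0 0 0 start_tstate 0 w = Some out" by blast
      then show False using run False by blast
    qed
    note rej = reach_invalid[OF this K_pos, of X]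
    have "1 * round_time (length w) \<le> Suc (length w) * (K * round_time (length w))"
      unfolding mult.assoc[symmetric] by (rule mult_le_mono1) (use K_pos in simp)
    moreover have "w \<notin> Lang" using Lang False by blast
    ultimately show ?thesis using halts_mono[OF rej] by simp
  next
    case True
    then obtain \<alpha>s where \<alpha>s: "csp_instance S \<alpha>s" "w = enc_conj \<alpha>s" by blast
    have out: "arun (int p) j 0 start_tstate 0 w = Some (oc (int p) j 0 \<alpha>s)" for p j using run \<alpha>s by blast
    have "w \<in> Lang \<longleftrightarrow> (\<forall>p \<le> length w. \<exists>j < K. oc (int p) j 0 \<alpha>s @ tail \<in> X)"
    proof
      assume "w \<in> Lang"
      then obtain \<beta>s where \<beta>s: "csp_instance S \<beta>s" "w = enc_conj \<beta>s" "\<forall>p \<le> length w. \<exists>j < K. oc (int p) j 0 \<beta>s @ tail \<in> X"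
        using Lang by blast
      have "\<beta>s = \<alpha>s" by (rule enc_conj_inj[OF \<beta>s(1) \<alpha>s(1)]) (use \<alpha>s \<beta>s in simp)
      then show "\<forall>p \<le> length w. \<exists>j < K. oc (int p) j 0 \<alpha>s @ tail \<in> X" using \<beta>s(3) by simp
    qed (use Lang \<alpha>s in blast)
    then show ?thesis using search_all[of w "\<lambda>p j. oc (int p) j 0 \<alpha>s" "length w" X] out by simp
  qed
  then have halt: "halts X (poly p (length w)) (initial mach w) (if w \<in> Lang then Acc else Rej)" for w
    using reach_halts[OF reach_step[OF step_Start[of X w, folded round_cfg_def] reach_refl[of X 0]]] by (simp add: p)
  have "decides_in_time mach X Lang (poly p)"
    unfolding decides_in_time_def
  proof
    fix w
    have "code (if w \<in> Lang then Acc else Rej) = (if w \<in> Lang then accept mach else reject mach)" by (simp add: mach_def)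
    then show "\<exists>n \<le> poly p (length w). fst ((step mach X ^^ n) (initial mach w)) = (if w \<in> Lang then accept mach else reject mach)"
      using halt[of w] unfolding halts_def reach_def by metis
  qed
  then show ?thesis unfolding poly_time_reducible_def using is_otm_mach by blast
qed

end

section \<open>The two reductions\<close>

lemma enc_conj_in_CSP_iff:
  assumes "csp_instance \<sigma> \<alpha>s"
  shows "enc_conj \<alpha>s \<in> CSP \<sigma> A \<longleftrightarrow> satisfiable_in A \<alpha>s"
proof
  assume "enc_conj \<alpha>s \<in> CSP \<sigma> A"
  then obtain \<beta>s where "enc_conj \<alpha>s = enc_conj \<beta>s" "csp_instance \<sigma> \<beta>s" "satisfiable_in A \<beta>s"
    by (auto simp: CSP_def)
  then show "satisfiable_in A \<alpha>s" using enc_conj_inj assms by metis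
qed (use assms in \<open>auto simp: CSP_def\<close>)

lemma enc_conj_simps [simp]:
  "enc_conj [] = []" "enc_conj (\<alpha> # \<alpha>s) = enc_atom \<alpha> @ enc_conj \<alpha>s" "enc_conj (\<alpha>s @ \<beta>s) = enc_conj \<alpha>s @ enc_conj \<beta>s"
  by (simp_all add: enc_conj_def)

text \<open>The reason for sending variables to odd ones: the new code is the old one with a digit
  in front, so emitting \<open>[False, True, True]\<close> at the start of a variable performs the
  renaming.\<close>

lemma enc_nat_odd: "enc_nat (2 * x + 1) = True # True # enc_nat x"
  by (simp add: enc_nat_digits binary_pos)

text \<open>A many-one reduction in the common scheme: \<open>K\<close> is 1 and neither the
  selected position nor \<open>j\<close> affects the output, so every query is the same. The tail
  supplies the constraints \<open>\<psi>\<close> on the variables that stand for the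
  constants.\<close>

locale const_to_neq =
  fixes \<tau> :: signature and m :: nat and \<psi> :: "atom list"
begin

definition fo :: "nat \<Rightarrow> bool list" where
  "fo f = (if f < length (fun_ar \<tau>) then True # enc_nat f else False # enc_nat (2 * (f - length (fun_ar \<tau>))))"

definition ho :: "nat option \<Rightarrow> bool \<Rightarrow> nat \<Rightarrow> bool list \<times> nat \<times> bool \<times> bool list option" where
  "ho h sel j = (case h of None \<Rightarrow> ([False], 2, True, None) | Some r \<Rightarrow> (True # enc_nat r, rel_ar \<tau> ! r, True, None))"

sublocale query_transducer "const_sig \<tau> m" fo ho "[False, True, True]" 1 "enc_conj \<psi>"
  by unfold_locales (auto simp: ho_def split: option.splits)

abbreviation conv_term :: "trm \<Rightarrow> trm" where
  "conv_term \<equiv> conv (\<lambda>x. 2 * x + 1) (length (fun_ar \<tau>))"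

abbreviation conv_atoms :: "atom list \<Rightarrow> atom list" where
  "conv_atoms \<equiv> map (conv_atom (\<lambda>x. 2 * x + 1) (length (fun_ar \<tau>)))"

lemma ot_eq: "trm_ok (const_sig \<tau> m) t \<Longrightarrow> ot t = enc_trm (conv_term t)"
proof (induction t)
  case (Var x)
  then show ?case using enc_nat_odd[of x] by simp
next
  case (Fn f ts)
  show ?case
  proof (cases "f < length (fun_ar \<tau>)")
    case True
    have "map ot ts = map (\<lambda>t. enc_trm (conv_term t)) ts" using Fn by auto
    then have "concat (map ot ts) = concat (map (\<lambda>t. enc_trm (conv_term t)) ts)" by (rule arg_cong)
    moreover have "fo f = True # enc_nat f" using True by (simp add: fo_def)
    ultimately show ?thesis using True by (simp add: comp_def)
  next
    case False
    then have "ts = []" using Fn.prems by (auto simp: nth_append)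
    moreover have "fo f = False # enc_nat (2 * (f - length (fun_ar \<tau>)))" using False by (simp add: fo_def)
    ultimately show ?thesis using False by simp
  qed
qed

lemma oa_eq:
  assumes "atom_ok (const_sig \<tau> m) \<alpha>"
  shows "oa pos j i (ahead \<alpha>) (aargs \<alpha>) = enc_atom (conv_atom (\<lambda>x. 2 * x + 1) (length (fun_ar \<tau>)) \<alpha>)"
proof (cases \<alpha>)
  case (Eq s t)
  then show ?thesis using assms ot_eq by (simp add: ho_def emit_def)
next
  case (Rel r ts)
  have "map ot ts = map (\<lambda>t. enc_trm (conv_term t)) ts" using assms ot_eq Rel by auto
  then have "concat (map ot ts) = concat (map (\<lambda>t. enc_trm (conv_term t)) ts)" by (rule arg_cong)
  then show ?thesis using Rel by (simp add: ho_def emit_def comp_def)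
qed

lemma oc_eq: "csp_instance (const_sig \<tau> m) \<alpha>s \<Longrightarrow> oc pos j i \<alpha>s = enc_conj (conv_atoms \<alpha>s)"
  by (induction \<alpha>s arbitrary: i) (simp_all add: oa_eq del: oa.simps)

lemma reducible:
  assumes \<psi>: "csp_instance (neq_sig \<tau>) \<psi>"
    and sat: "\<And>\<alpha>s. csp_instance (const_sig \<tau> m) \<alpha>s \<Longrightarrow> satisfiable_in M \<alpha>s \<longleftrightarrow> satisfiable_in N (conv_atoms \<alpha>s @ \<psi>)"
  shows "poly_time_reducible (CSP (const_sig \<tau> m) M) (CSP (neq_sig \<tau>) N)"
proof (rule poly_time_reducibleI)
  fix w
  have "oc (int p) j 0 \<alpha>s @ enc_conj \<psi> \<in> CSP (neq_sig \<tau>) N \<longleftrightarrow> satisfiable_in M \<alpha>s"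
    if "csp_instance (const_sig \<tau> m) \<alpha>s" for p j \<alpha>s
  proof -
    have "csp_instance (neq_sig \<tau>) (conv_atoms \<alpha>s @ \<psi>)" using csp_instance_conv_const[OF that] \<psi> by simp
    from enc_conj_in_CSP_iff[OF this, of N] show ?thesis using oc_eq[OF that] sat[OF that] by simp
  qed
  then show "w \<in> CSP (const_sig \<tau> m) M \<longleftrightarrow> (\<exists>\<alpha>s. csp_instance (const_sig \<tau> m) \<alpha>s \<and> w = enc_conj \<alpha>s \<and>
      (\<forall>p \<le> length w. \<exists>j < 1. oc (int p) j 0 \<alpha>s @ enc_conj \<psi> \<in> CSP (neq_sig \<tau>) N))"
    by (auto simp: CSP_def)
qed

end

text \<open>
  A query keeps the positive atoms of the instance and at most one disequality, the selected one,
  whose two sides are equated with the \<open>j\<close>-th pair of constants. Without any pair (\<open>k = 0\<close>)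
  disequalities are unsatisfiable, hence rejected as syntax errors.
\<close>

locale neq_to_const =
  fixes \<tau> :: signature and k :: nat
begin

definition src :: signature where
  "src = (if k = 0 then \<tau> else neq_sig \<tau>)"

abbreviation neq_ix :: nat where
  "neq_ix \<equiv> length (rel_ar \<tau>)"

abbreviation const :: "nat \<Rightarrow> trm" where
  "const i \<equiv> Fn (length (fun_ar \<tau>) + i) []"

text \<open>With the constants on the left, each side of a selected disequality only needs a fixed
  text in front of it; the text for the second side is the due one. The terms of other disequalities
  are parsed invisibly.\<close>

definition ho :: "nat option \<Rightarrow> bool \<Rightarrow> nat \<Rightarrow> bool list \<times> nat \<times> bool \<times> bool list option" where
  "ho h sel j = (case h of None \<Rightarrow> ([False], 2, True, None)
    | Some r \<Rightarrow> if 0 < k \<and> r = neq_ix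
        then if sel then (False # enc_trm (const j), 1, True, Some (False # enc_trm (const (k + j)))) else ([], 2, False, None)
        else (True # enc_nat r, rel_ar src ! r, True, None))"

text \<open>The number of tries must be positive; for \<open>k = 0\<close> the only value
  \<open>j = 0\<close> has no effect, since \<open>src\<close> then lacks the disequality
  symbol.\<close>

sublocale query_transducer src "\<lambda>f. True # enc_nat f" ho "[False]" "max k 1" "[]"
  by unfold_locales (auto simp: ho_def src_def nth_append split: option.splits if_splits)

definition hpos :: "int \<Rightarrow> int" where
  "hpos i = i + int (length (hcode (Some neq_ix))) - 1"

fun neqs :: "int \<Rightarrow> atom list \<Rightarrow> (int \<times> trm \<times> trm) list" where
  "neqs i [] = []"
| "neqs i (\<alpha> # \<alpha>s) = (if ahead \<alpha> = Some neq_ix then [(hpos i, aargs \<alpha> ! 0, aargs \<alpha> ! 1)] else [])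
     @ neqs (i + int (length (enc_atom \<alpha>))) \<alpha>s"

definition positive :: "atom list \<Rightarrow> atom list" where
  "positive \<alpha>s = filter (\<lambda>\<alpha>. ahead \<alpha> \<noteq> Some neq_ix) \<alpha>s"

fun selected :: "int \<Rightarrow> nat \<Rightarrow> int \<Rightarrow> atom list \<Rightarrow> atom list" where
  "selected pos j i [] = []"
| "selected pos j i (\<alpha> # \<alpha>s) = (if ahead \<alpha> = Some neq_ix
     then if hpos i = pos then [Eq (const j) (aargs \<alpha> ! 0), Eq (const (k + j)) (aargs \<alpha> ! 1)] else []
     else [\<alpha>]) @ selected pos j (i + int (length (enc_atom \<alpha>))) \<alpha>s"

lemma ot_eq: "ot t = enc_trm t"
proof (induction t)
  case (Fn f ts)
  then have "map ot ts = map enc_trm ts" by simp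
  then have "concat (map ot ts) = concat (map enc_trm ts)" by (rule arg_cong)
  then show ?case by simp
qed simp

lemma src_atom_cases:
  assumes "atom_ok src \<alpha>"
  obtains (pos) "ahead \<alpha> \<noteq> Some neq_ix" "atom_ok \<tau> \<alpha>"
  | (neq) u v where "0 < k" "\<alpha> = Rel neq_ix [u, v]" "trm_ok \<tau> u" "trm_ok \<tau> v"
proof (cases "atom_ok \<tau> \<alpha>")
  case True
  then show ?thesis using pos by (cases \<alpha>) auto
next
  case False
  then have k: "0 < k" "atom_ok (neq_sig \<tau>) \<alpha>" using assms by (auto simp: src_def split: if_splits)
  from k(2) show ?thesis by (cases rule: atom_ok_neq_sig_cases) (use False neq k(1) in auto)
qed

lemma oc_eq: "csp_instance src \<alpha>s \<Longrightarrow> oc pos j i \<alpha>s = enc_conj (selected pos j i \<alpha>s)"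
proof (induction \<alpha>s arbitrary: i)
  case (Cons \<alpha> \<alpha>s)
  then have "atom_ok src \<alpha>" by simp
  then have "oa pos j i (ahead \<alpha>) (aargs \<alpha>) = enc_conj (selected pos j i [\<alpha>])"
  proof (cases rule: src_atom_cases)
    case pos
    then show ?thesis by (cases \<alpha>) (auto simp: ho_def emit_def ot_eq cong: map_cong)
  next
    case (neq u v)
    then show ?thesis by (simp add: ho_def hpos_def emit_def ot_eq)
  qed
  then show ?case using Cons by (simp del: oa.simps)
qed simp

lemma selected_ok:
  assumes "j < max k 1"
  shows "csp_instance src \<alpha>s \<Longrightarrow> csp_instance (const_sig \<tau> (2 * k)) (selected pos j i \<alpha>s)"
proof (induction \<alpha>s arbitrary: i)
  case (Cons \<alpha> \<alpha>s)
  then have "atom_ok src \<alpha>" by simp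
  then have "csp_instance (const_sig \<tau> (2 * k)) (selected pos j i [\<alpha>])"
  proof (cases rule: src_atom_cases)
    case pos
    have "atom_ok (const_sig \<tau> (2 * k)) \<alpha>" using pos(2) trm_ok_const_sig by (cases \<alpha>) auto
    then show ?thesis using pos by simp
  next
    case (neq u v)
    then show ?thesis using assms trm_ok_const_sig[of \<tau> _ "2 * k"] by (simp add: nth_append)
  qed
  then show ?case using Cons by simp
qed simp

lemma positive_ok: "csp_instance src \<alpha>s \<Longrightarrow> csp_instance \<tau> (positive \<alpha>s)"
proof -
  have "atom_ok src \<alpha> \<Longrightarrow> ahead \<alpha> \<noteq> Some neq_ix \<Longrightarrow> atom_ok \<tau> \<alpha>" for \<alpha> by (erule src_atom_cases) auto
  then show "csp_instance src \<alpha>s \<Longrightarrow> csp_instance \<tau> (positive \<alpha>s)" by (auto simp: positive_def csp_instance_def)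
qed

lemma neqs_ok: "csp_instance src \<alpha>s \<Longrightarrow> (q, u, v) \<in> set (neqs i \<alpha>s) \<Longrightarrow> 0 < k \<and> trm_ok \<tau> u \<and> trm_ok \<tau> v"
proof (induction \<alpha>s arbitrary: i)
  case (Cons \<alpha> \<alpha>s)
  then have "atom_ok src \<alpha>" by simp
  then show ?case
  proof (cases rule: src_atom_cases)
    case pos
    then show ?thesis using Cons by auto
  next
    case (neq u' v')
    then show ?thesis using Cons by auto
  qed
qed simp

lemma sats_neq_expansion_iff:
  assumes "is_structure \<tau> A" "s \<in> assignments A"
  shows "csp_instance src \<alpha>s \<Longrightarrow> sats (neq_expansion \<tau> A) \<alpha>s s \<longleftrightarrow>
    sats A (positive \<alpha>s) s \<and> (\<forall>(q, u, v) \<in> set (neqs i \<alpha>s). val A s u \<noteq> val A s v)"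
proof (induction \<alpha>s arbitrary: i)
  case (Cons \<alpha> \<alpha>s)
  then have "atom_ok src \<alpha>" by simp
  then show ?case
  proof (cases rule: src_atom_cases)
    case pos
    then show ?thesis using Cons.IH[of "i + int (length (enc_atom \<alpha>))"] Cons.prems sat_atom_pos[OF pos(2), of A s] by (simp add: positive_def)
  next
    case (neq u v)
    then show ?thesis using Cons.IH[of "i + int (length (enc_atom \<alpha>))"] Cons.prems sat_atom_neq[OF assms neq(3,4)]
      by (auto simp: positive_def)
  qed
qed (simp add: positive_def)

lemma val_const_expansion: "trm_ok \<tau> t \<Longrightarrow> val (const_expansion \<tau> A as) s t = val A s t"
proof (induction t)
  case (Fn f ts)
  then have "map (val (const_expansion \<tau> A as) s) ts = map (val A s) ts" by simp
  moreover have "funs (const_expansion \<tau> A as) f = funs A f" using Fn.prems by (simp add: const_expansion_def)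
  ultimately show ?case by (simp only: val.simps)
qed simp

lemma sats_selected_iff:
  assumes "j < max k 1" "length as = 2 * k"
  shows "csp_instance src \<alpha>s \<Longrightarrow> sats (const_expansion \<tau> A as) (selected pos j i \<alpha>s) s \<longleftrightarrow>
    sats A (positive \<alpha>s) s \<and> (\<forall>(q, u, v) \<in> set (neqs i \<alpha>s). q = pos \<longrightarrow> val A s u = as ! j \<and> val A s v = as ! (k + j))"
proof (induction \<alpha>s arbitrary: i)
  case (Cons \<alpha> \<alpha>s)
  let ?B = "const_expansion \<tau> A as"
  note IH = Cons.IH[of "i + int (length (enc_atom \<alpha>))"]
  from Cons.prems have "atom_ok src \<alpha>" by simp
  then show ?case
  proof (cases rule: src_atom_cases)
    case pos
    have "sat_atom ?B s \<alpha> = sat_atom A s \<alpha>"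
    proof (cases \<alpha>)
      case (Eq u v)
      then show ?thesis using pos(2) val_const_expansion[of _ A as s] by simp
    next
      case (Rel r ts)
      have m: "map (val ?B s) ts = map (val A s) ts" using pos(2) val_const_expansion[of _ A as s] Rel by auto
      have "rels ?B r = rels A r" by (simp add: const_expansion_def)
      then show ?thesis unfolding Rel sat_atom.simps m by simp
    qed
    then show ?thesis using IH Cons.prems pos by (simp add: positive_def)
  next
    case (neq u v)
    have const: "sat_atom ?B s (Eq (const n) t) \<longleftrightarrow> val A s t = as ! n" if "trm_ok \<tau> t" for n t
      using val_const_expansion[OF that, of A as s] by (auto simp: const_expansion_def)
    show ?thesis using IH Cons.prems const[OF neq(3)] const[OF neq(4)]
      by (auto simp: neq(2) positive_def simp del: sat_atom.simps)
  qed
qed (simp add: positive_def)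

lemma neqs_range: "(q, u, v) \<in> set (neqs i \<alpha>s) \<Longrightarrow> hpos i \<le> q \<and> q < i + int (length (enc_conj \<alpha>s))"
proof (induction \<alpha>s arbitrary: i)
  case (Cons \<alpha> \<alpha>s)
  have "hpos i \<le> hpos (i + int (length (enc_atom \<alpha>)))" by (simp add: hpos_def)
  moreover have "hpos i < i + int (length (enc_atom \<alpha>))" if "ahead \<alpha> = Some neq_ix" using that by (simp add: hpos_def enc_atom_eq)
  ultimately show ?case using Cons.IH[of "i + int (length (enc_atom \<alpha>))"] Cons.prems by (fastforce split: if_splits)
qed simp

text \<open>Header positions increase strictly along the instance, so a position selects at most one
  disequality.\<close>

lemma neqs_unique:
  "(q, u, v) \<in> set (neqs i \<alpha>s) \<Longrightarrow> (q, u', v') \<in> set (neqs i \<alpha>s) \<Longrightarrow> u = u' \<and> v = v'"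
proof (induction \<alpha>s arbitrary: i)
  case (Cons \<alpha> \<alpha>s)
  let ?i = "i + int (length (enc_atom \<alpha>))"
  have "length (enc_atom \<alpha>) > 0" by (cases \<alpha>) auto
  then have "hpos i < hpos ?i" by (simp add: hpos_def)
  then have "(hpos i, x, y) \<notin> set (neqs ?i \<alpha>s)" for x y using neqs_range[of "hpos i" x y ?i \<alpha>s] by auto
  then show ?case using Cons.IH[of ?i] Cons.prems by (auto split: if_splits)
qed simp

lemma hpos_nonneg: "0 \<le> i \<Longrightarrow> 0 \<le> hpos i"
  by (simp add: hpos_def hcode_def)

text \<open>A positive answer at any position shows that the positive part is satisfiable; at the
  header end of a disequality it moreover yields a suitable pair of constants. Jointly these are the
  conditions in \<open>char\<close>.\<close>

lemma queries_iff:
  assumes struct: "is_structure \<tau> A" and len: "length as = 2 * k"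
    and char: "\<And>\<phi> ps. csp_instance \<tau> \<phi> \<Longrightarrow> (\<forall>(u, v) \<in> set ps. trm_ok \<tau> u \<and> trm_ok \<tau> v) \<Longrightarrow>
      (\<exists>s \<in> assignments A. sats A \<phi> s \<and> (\<forall>(u, v) \<in> set ps. val A s u \<noteq> val A s v)) \<longleftrightarrow>
       (\<exists>s \<in> assignments A. sats A \<phi> s) \<and>
       (\<forall>(u, v) \<in> set ps. \<exists>j < k. \<exists>s \<in> assignments A. sats A \<phi> s \<and> val A s u = as ! j \<and> val A s v = as ! (k + j))"
    and \<alpha>s: "csp_instance src \<alpha>s"
  shows "(\<forall>p \<le> length (enc_conj \<alpha>s). \<exists>j < max k 1. oc (int p) j 0 \<alpha>s @ [] \<in> CSP (const_sig \<tau> (2 * k)) (const_expansion \<tau> A as)) \<longleftrightarrow>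
    satisfiable_in (neq_expansion \<tau> A) \<alpha>s"
proof -
  let ?B = "const_expansion \<tau> A as" and ?P = "positive \<alpha>s" and ?N = "neqs 0 \<alpha>s" and ?n = "length (enc_conj \<alpha>s)"
  let ?ps = "map snd ?N"
  let ?E = "\<lambda>j s u v. val A s u = as ! j \<and> val A s v = as ! (k + j)"
  have query: "oc (int p) j 0 \<alpha>s @ [] \<in> CSP (const_sig \<tau> (2 * k)) ?B \<longleftrightarrow>
      (\<exists>s \<in> assignments A. sats A ?P s \<and> (\<forall>(q, u, v) \<in> set ?N. q = int p \<longrightarrow> ?E j s u v))" if j: "j < max k 1" for p j
    unfolding append_Nil2 oc_eq[OF \<alpha>s] enc_conj_in_CSP_iff[OF selected_ok[OF j \<alpha>s]] satisfiable_in_iff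
      assignments_const_expansion sats_selected_iff[OF j len \<alpha>s] ..
  have ps: "\<forall>(u, v) \<in> set ?ps. trm_ok \<tau> u \<and> trm_ok \<tau> v" using neqs_ok[OF \<alpha>s] by auto
  have ps_iff: "(\<forall>(u, v) \<in> set ?ps. R u v) \<longleftrightarrow> (\<forall>(q, u, v) \<in> set ?N. R u v)" for R by auto
  have "satisfiable_in (neq_expansion \<tau> A) \<alpha>s \<longleftrightarrow> (\<exists>s \<in> assignments A. sats A ?P s \<and> (\<forall>(u, v) \<in> set ?ps. val A s u \<noteq> val A s v))"
    unfolding satisfiable_in_iff assignments_neq_expansion ps_iff
    using sats_neq_expansion_iff[OF struct _ \<alpha>s, where i = 0] by blast
  also have "\<dots> \<longleftrightarrow> (\<exists>s \<in> assignments A. sats A ?P s) \<and>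
      (\<forall>(q, u, v) \<in> set ?N. \<exists>j < k. \<exists>s \<in> assignments A. sats A ?P s \<and> ?E j s u v)"
    using char[OF positive_ok[OF \<alpha>s] ps] unfolding ps_iff .
  finally have sat: "satisfiable_in (neq_expansion \<tau> A) \<alpha>s \<longleftrightarrow> (\<exists>s \<in> assignments A. sats A ?P s) \<and>
      (\<forall>(q, u, v) \<in> set ?N. \<exists>j < k. \<exists>s \<in> assignments A. sats A ?P s \<and> ?E j s u v)" .
  show ?thesis
  proof
    assume all: "\<forall>p \<le> ?n. \<exists>j < max k 1. oc (int p) j 0 \<alpha>s @ [] \<in> CSP (const_sig \<tau> (2 * k)) ?B"
    have all': "\<exists>j < max k 1. \<exists>s \<in> assignments A. sats A ?P s \<and> (\<forall>(q, u, v) \<in> set ?N. q = int p \<longrightarrow> ?E j s u v)"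
      if "p \<le> ?n" for p using all that query by blast
    have "\<exists>s \<in> assignments A. sats A ?P s" using all'[of ?n] by blast
    moreover have "\<exists>j < k. \<exists>s \<in> assignments A. sats A ?P s \<and> ?E j s u v" if quv: "(q, u, v) \<in> set ?N" for q u v
    proof -
      \<comment> \<open>Every header ends inside the word, so its disequality is tested at one of
        the positions considered.\<close>
      have q: "0 \<le> q" "q < int ?n" using neqs_range[OF quv] hpos_nonneg[of 0] by auto
      then have "nat q \<le> ?n" "int (nat q) = q" by auto
      with all'[of "nat q"] obtain j s where js: "j < max k 1" "s \<in> assignments A" "sats A ?P s"
        "\<forall>(q', u, v) \<in> set ?N. q' = q \<longrightarrow> ?E j s u v" by auto
      have "j < k" using js(1) neqs_ok[OF \<alpha>s quv] by auto
      moreover have "?E j s u v" using js(4) quv by blast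
      ultimately show ?thesis using js(2,3) by blast
    qed
    ultimately show "satisfiable_in (neq_expansion \<tau> A) \<alpha>s" unfolding sat by blast
  next
    assume "satisfiable_in (neq_expansion \<tau> A) \<alpha>s"
    then have P: "\<exists>s \<in> assignments A. sats A ?P s"
      and N: "\<And>q u v. (q, u, v) \<in> set ?N \<Longrightarrow> \<exists>j < k. \<exists>s \<in> assignments A. sats A ?P s \<and> ?E j s u v" unfolding sat by blast+
    have "\<exists>j < max k 1. \<exists>s \<in> assignments A. sats A ?P s \<and> (\<forall>(q, u, v) \<in> set ?N. q = int p \<longrightarrow> ?E j s u v)" for p
    proof (cases "\<exists>u v. (int p, u, v) \<in> set ?N")
      case True
      then obtain u v where uv: "(int p, u, v) \<in> set ?N" by blast
      obtain j s where js: "j < k" "s \<in> assignments A" "sats A ?P s" "?E j s u v" using N[OF uv] by blast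
      have "\<forall>(q, u', v') \<in> set ?N. q = int p \<longrightarrow> ?E j s u' v'"
        using neqs_unique[OF uv] js(4) by blast
      moreover have "j < max k 1" using js(1) by simp
      ultimately show ?thesis using js(2,3) by blast
    next
      \<comment> \<open>Nothing is selected here, so the query is the positive part alone and any
        \<open>j\<close> serves, also the dummy value in case \<open>k = 0\<close>.\<close>
      case False
      have "(0 :: nat) < max k 1" by simp
      then show ?thesis using P False by blast
    qed
    then show "\<forall>p \<le> ?n. \<exists>j < max k 1. oc (int p) j 0 \<alpha>s @ [] \<in> CSP (const_sig \<tau> (2 * k)) ?B" using query by blast
  qed
qed

lemma csp_instance_src:
  assumes struct: "is_structure \<tau> A"
    and char: "\<And>u v. k = 0 \<Longrightarrow> trm_ok \<tau> u \<Longrightarrow> trm_ok \<tau> v \<Longrightarrow> \<not> (\<exists>s \<in> assignments A. val A s u \<noteq> val A s v)"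
  shows "csp_instance (neq_sig \<tau>) \<alpha>s \<and> satisfiable_in (neq_expansion \<tau> A) \<alpha>s \<longleftrightarrow>
    csp_instance src \<alpha>s \<and> satisfiable_in (neq_expansion \<tau> A) \<alpha>s"
proof (cases "k = 0")
  case True
  have "atom_ok \<tau> \<alpha>" if \<alpha>: "\<alpha> \<in> set \<alpha>s" "csp_instance (neq_sig \<tau>) \<alpha>s" "satisfiable_in (neq_expansion \<tau> A) \<alpha>s" for \<alpha>
  proof -
    have "atom_ok (neq_sig \<tau>) \<alpha>" using \<alpha>(1,2) by (simp add: csp_instance_def)
    then show ?thesis
    proof (cases rule: atom_ok_neq_sig_cases)
      case (neq u v)
      obtain s where s: "s \<in> assignments A" "sat_atom (neq_expansion \<tau> A) s \<alpha>"
        using \<alpha>(1,3) by (auto simp: satisfiable_in_def)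
      then have "val A s u \<noteq> val A s v" using sat_atom_neq[OF struct s(1) neq(2,3)] neq(1) by simp
      then show ?thesis using char[OF True neq(2,3)] s(1) by blast
    qed
  qed
  then have "csp_instance \<tau> \<alpha>s" if "csp_instance (neq_sig \<tau>) \<alpha>s" "satisfiable_in (neq_expansion \<tau> A) \<alpha>s"
    using that unfolding csp_instance_def[of \<tau>] by blast
  moreover have "src = \<tau>" unfolding src_def using True by simp
  ultimately show ?thesis using csp_instance_neq_sig[of \<tau> \<alpha>s] by auto
next
  case False
  then show ?thesis by (simp add: src_def)
qed

lemma reducible:
  assumes struct: "is_structure \<tau> A" and len: "length as = 2 * k"
    and char: "\<And>\<phi> ps. csp_instance \<tau> \<phi> \<Longrightarrow> (\<forall>(u, v) \<in> set ps. trm_ok \<tau> u \<and> trm_ok \<tau> v) \<Longrightarrow>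
      (\<exists>s \<in> assignments A. sats A \<phi> s \<and> (\<forall>(u, v) \<in> set ps. val A s u \<noteq> val A s v)) \<longleftrightarrow>
       (\<exists>s \<in> assignments A. sats A \<phi> s) \<and>
       (\<forall>(u, v) \<in> set ps. \<exists>j < k. \<exists>s \<in> assignments A. sats A \<phi> s \<and> val A s u = as ! j \<and> val A s v = as ! (k + j))"
  shows "poly_time_reducible (CSP (neq_sig \<tau>) (neq_expansion \<tau> A)) (CSP (const_sig \<tau> (2 * k)) (const_expansion \<tau> A as))"
proof (rule poly_time_reducibleI)
  fix w
  \<comment> \<open>With an empty conjunction and the single pair \<open>(u, v)\<close> the
    criterion asks for some \<open>j < k\<close>, which is impossible for
    \<open>k = 0\<close>.\<close>
  have "\<not> (\<exists>s \<in> assignments A. val A s u \<noteq> val A s v)" if "k = 0" "trm_ok \<tau> u" "trm_ok \<tau> v" for u v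
    using char[of "[]" "[(u, v)]"] that by simp
  note src = csp_instance_src[OF struct this]
  have "w \<in> CSP (neq_sig \<tau>) (neq_expansion \<tau> A) \<longleftrightarrow>
    (\<exists>\<alpha>s. csp_instance src \<alpha>s \<and> w = enc_conj \<alpha>s \<and> satisfiable_in (neq_expansion \<tau> A) \<alpha>s)"
    using src by (auto simp: CSP_def)
  then show "w \<in> CSP (neq_sig \<tau>) (neq_expansion \<tau> A) \<longleftrightarrow> (\<exists>\<alpha>s. csp_instance src \<alpha>s \<and> w = enc_conj \<alpha>s \<and>
    (\<forall>p \<le> length w. \<exists>j < max k 1. oc (int p) j 0 \<alpha>s @ [] \<in> CSP (const_sig \<tau> (2 * k)) (const_expansion \<tau> A as)))"
    using queries_iff[OF struct len char] by blast
qed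

end

theorem proposition3p8:
  fixes \<tau> :: signature and A :: "'a struct"
  assumes "is_structure \<tau> A"
    and "model_complete \<tau> A"
    and "omega_categorical \<tau> A"
    and "\<exists>e. embedding \<tau> e (prod_struct A A) A"
  shows "\<exists>as. set as \<subseteq> univ A \<and>
    poly_time_equivalent
      (CSP (neq_sig \<tau>) (neq_expansion \<tau> A))
      (CSP (const_sig \<tau> (length as)) (const_expansion \<tau> A as))"
proof -
  obtain e where e: "embedding \<tau> e (prod_struct A A) A" using assms(4) by blast
  from constants_exist[OF assms(1,3) e] obtain k as \<psi> where len: "length as = 2 * k" and "set as \<subseteq> univ A"
    and \<psi>: "csp_instance (neq_sig \<tau>) \<psi>"
    and 1: "\<forall>\<phi> ps. csp_instance \<tau> \<phi> \<longrightarrow> (\<forall>(u, v) \<in> set ps. trm_ok \<tau> u \<and> trm_ok \<tau> v) \<longrightarrow>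
      ((\<exists>s \<in> assignments A. sats A \<phi> s \<and> (\<forall>(u, v) \<in> set ps. val A s u \<noteq> val A s v)) \<longleftrightarrow>
       (\<exists>s \<in> assignments A. sats A \<phi> s) \<and>
       (\<forall>(u, v) \<in> set ps. \<exists>j < k. \<exists>s \<in> assignments A. sats A \<phi> s \<and> val A s u = as ! j \<and> val A s v = as ! (k + j)))"
    and 2: "\<forall>\<alpha>s. csp_instance (const_sig \<tau> (2 * k)) \<alpha>s \<longrightarrow>
      (satisfiable_in (const_expansion \<tau> A as) \<alpha>s \<longleftrightarrow>
       satisfiable_in (neq_expansion \<tau> A) (map (conv_atom (\<lambda>x. 2 * x + 1) (length (fun_ar \<tau>))) \<alpha>s @ \<psi>))"
    by (elim exE conjE) (rule that)
  have "poly_time_reducible (CSP (neq_sig \<tau>) (neq_expansion \<tau> A)) (CSP (const_sig \<tau> (2 * k)) (const_expansion \<tau> A as))"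
    by (rule neq_to_const.reducible[OF assms(1) len]) (rule 1[THEN spec, THEN spec, THEN mp, THEN mp])
  moreover have "poly_time_reducible (CSP (const_sig \<tau> (2 * k)) (const_expansion \<tau> A as)) (CSP (neq_sig \<tau>) (neq_expansion \<tau> A))"
    by (rule const_to_neq.reducible[OF \<psi>]) (rule 2[THEN spec, THEN mp])
  ultimately show ?thesis using \<open>set as \<subseteq> univ A\<close> len by (intro exI[of _ as]) (simp add: poly_time_equivalent_def)
qed

end
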